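(* Let $w$ be a strictly positive weight on $\mathbb{D}$ that is nearly constant on $\rho$-tops, i.e. there exist $0<\rho<1$ and a constant $C_\rho$ such that for every interval $I\subset\mathbb{T}$ $$C_{\rho}^{-1}w(\xi)\leq w(z)\leq C_{\rho}w(\xi)\quad\text{for all } z,\xi\in T_{I,\rho}.$$ Then the following are equivalent: (1) $w\in B_\infty$; (2) There exists a constant $C>0$ such that $$\int_{Q_I} w(x)\log\left(e+\frac{w(x)|Q_I|}{w(Q_I)}\right)dA(x)\leq C\,w(Q_I)$$ for all Carleson cubes $Q_I$; (3) For each $0<\varepsilon<1$ there exists $\delta>0$ such that for any interval $I\subset\mathbb{T}$ and any countable union of disjoint intervals $E\subset I$ with $|Q_E|/|Q_I|<\delta$, one has $w(Q_E)<\varepsilon\, w(Q_I)$; (3') For each $0<\varepsilon<1$ there exists $\delta>0$ such that for any interval $I\subset\mathbb{T}$ and any measurable subset $\Omega\subset Q_I$ with $|\Omega|/|Q_I|<\delta$, one has $w(\Omega)<\varepsilon\, w(Q_I)$; (4) $w$ has the reverse Hölder property on Carleson cubes, i.e. there exist $r>1$ and $C>0$ such that $$\left(\frac{1}{|Q_I|}\int_{Q_I}w^r\,dA\right)^{1/r}\le C\,\frac{1}{|Q_I|}\int_{Q_I}w\,dA$$ for all Carleson cubes $Q_I$; (5) There exists $p>1$ such that $w\in B_p$; (6) There exists $C>0$ such that $$\left(\frac{1}{|Q_I|}\int_{Q_I}w\,dA\right)\exp\left(\frac{1}{|Q_I|}\int_{Q_I}\log(w^{-1})\,dA\right)\leq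 C$$ for all Carleson cubes $Q_I$. Moreover, in (2) we can choose $C$ as $C'B_\infty(w)$, where $C'$ is an absolute numerical constant.
   Context: $\mathbb{D}$ is the unit disk, $\mathbb{T}$ its boundary circle, $dA$ is area measure on $\mathbb{D}$ and $|E|$ is the area of a set $E\subset\mathbb{D}$; for an interval (arc) $I\subset\mathbb{T}$, $|I|$ is its length. A weight is a positive measurable function on $\mathbb{D}$. For a set $E\subset\mathbb{D}$ and an integrable function $f$, $f(E):=\int_E f\,dA$. For an interval $I\subset\mathbb{T}$ with center $e^{i\theta}$, the Carleson box (Carleson cube) is $$Q_I:=\{re^{i\alpha}:\ 1-|I|<r<1,\ |\theta-\alpha|<|I|/2\},$$ and for $0<\rho<1$ the $\rho$-top of $Q_I$ is $$T_{I,\rho}:=\{re^{i\alpha}:\ 1-|I|<r<1-(1-\rho)|I|,\ |\theta-\alpha|<|I|/2\}.$$ For a countable union of disjoint intervals $E=\bigcup_i I_i\subset\mathbb{T}$, $Q_E:=\bigcup_i Q_{I_i}$. $M$ is the Hardy–Littlewood maximal function over Carleson cubes: $Mf(z)=\sup_{I:\ z\in Q_I}\frac{1}{|Q_I|}\int_{Q_I}|f|\,dA$. $w\in B_\infty$ means $$B_\infty(w):=\sup_{I\subset\mathbb{T}\text{ interval}}\frac{1}{w(Q_I)}\int_{Q_I}M(w1_{Q_I})\,dA<\infty.$$ For $1<p<\infty$ and $p'=p/(p-1)$, $w\in B_p$ means $$B_p(w):=\sup_{I\subset\mathbb{T}\text{ interval}}\left(\frac{1}{|Q_I|}\int_{Q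_I}w\,dA\right)\left(\frac{1}{|Q_I|}\int_{Q_I}w^{1-p'}dA\right)^{p-1}<\infty.$$
   Formalization: C' in the last sentence depends on ρ and C_ρ (uniformly in w) instead of being an absolute numerical constant, which is false (w = 1 + s^{-2} on a disc of radius s about 1/2, s→0); w is assumed integrable on the disk, so that every w(Q_I) is finite. *)

theory Defs
  imports "HOL-Analysis.Analysis"
begin

abbreviation unit_disk :: "complex set" where
  "unit_disk \<equiv> ball 0 1"

text \<open>
  An interval \<open>I\<close> of the unit circle is given by a centre \<open>cis \<theta>\<close> and an (unnormalised) arc length
  \<open>0 < l \<le> 2 * pi\<close>.  Only open arcs are used: Carleson boxes depend on the centre and the length
  alone, so endpoints do not matter.  For \<open>l = 2 * pi\<close> the arc is the circle without one point.
\<close>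

definition arc_length :: "real \<Rightarrow> bool" where
  "arc_length l \<longleftrightarrow> 0 < l \<and> l \<le> 2 * pi"

definition circle_arc :: "real \<Rightarrow> real \<Rightarrow> complex set" where
  "circle_arc \<theta> l = {cis \<alpha> | \<alpha>. \<bar>\<theta> - \<alpha>\<bar> < l / 2}"

text \<open>
  The radius of polar coordinates is nonnegative; the condition \<open>0 \<le> r\<close> matters only for
  arcs with \<open>l > 1\<close>.
\<close>

definition carleson_box :: "real \<Rightarrow> real \<Rightarrow> complex set" where
  "carleson_box \<theta> l =
     {of_real r * cis \<alpha> | r \<alpha>. 0 \<le> r \<and> 1 - l < r \<and> r < 1 \<and> \<bar>\<theta> - \<alpha>\<bar> < l / 2}"

definition carleson_top :: "real \<Rightarrow> real \<Rightarrow> real \<Rightarrow> complex set" where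
  "carleson_top \<rho> \<theta> l =
     {of_real r * cis \<alpha> | r \<alpha>. 0 \<le> r \<and> 1 - l < r \<and> r < 1 - (1 - \<rho>) * l \<and> \<bar>\<theta> - \<alpha>\<bar> < l / 2}"

text \<open>Values of \<open>w\<close> outside the disk are irrelevant.\<close>

definition weight :: "(complex \<Rightarrow> real) \<Rightarrow> bool" where
  "weight w \<longleftrightarrow> w \<in> borel_measurable (lebesgue_on unit_disk) \<and> (\<forall>z\<in>unit_disk. 0 < w z)"

definition nearly_constant_on_tops :: "real \<Rightarrow> real \<Rightarrow> (complex \<Rightarrow> real) \<Rightarrow> bool" where
  "nearly_constant_on_tops \<rho> C w \<longleftrightarrow>
     (\<forall>\<theta> l. arc_length l \<longrightarrow>
        (\<forall>z\<in>carleson_top \<rho> \<theta> l. \<forall>\<xi>\<in>carleson_top \<rho> \<theta> l.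
           inverse C * w \<xi> \<le> w z \<and> w z \<le> C * w \<xi>))"

text \<open>\<open>mass f E\<close> is \<open>f(E)\<close> and \<open>mean f E\<close> is \<open>f(E) / |E|\<close>, for nonnegative \<open>f\<close> and possibly infinite.\<close>

definition mass :: "(complex \<Rightarrow> real) \<Rightarrow> complex set \<Rightarrow> ennreal" where
  "mass f E = (\<integral>\<^sup>+ z \<in> E. ennreal (f z) \<partial>lebesgue)"

definition mean :: "(complex \<Rightarrow> real) \<Rightarrow> complex set \<Rightarrow> ennreal" where
  "mean f E = mass f E / emeasure lebesgue E"

text \<open>Intended for exponents \<open>a > 0\<close> only.\<close>

definition ennreal_powr :: "ennreal \<Rightarrow> real \<Rightarrow> ennreal" where
  "ennreal_powr x a = (if x = top then top else ennreal (enn2real x powr a))"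

definition carleson_maximal :: "(complex \<Rightarrow> real) \<Rightarrow> complex \<Rightarrow> ennreal" where
  "carleson_maximal f z =
     (SUP (\<theta>, l) \<in> {(\<theta>, l). arc_length l \<and> z \<in> carleson_box \<theta> l}.
        mean (\<lambda>x. \<bar>f x\<bar>) (carleson_box \<theta> l))"

definition B_infinity_const :: "(complex \<Rightarrow> real) \<Rightarrow> ennreal" where
  "B_infinity_const w =
     (SUP (\<theta>, l) \<in> {(\<theta>, l). arc_length l}.
        (\<integral>\<^sup>+ z \<in> carleson_box \<theta> l.
            carleson_maximal (\<lambda>x. w x * indicator (carleson_box \<theta> l) x) z \<partial>lebesgue)
          / mass w (carleson_box \<theta> l))"

definition B_infinity :: "(complex \<Rightarrow> real) \<Rightarrow> bool" where
  "B_infinity w \<longleftrightarrow> B_infinity_const w < top"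

definition B_const :: "real \<Rightarrow> (complex \<Rightarrow> real) \<Rightarrow> ennreal" where
  "B_const p w =
     (SUP (\<theta>, l) \<in> {(\<theta>, l). arc_length l}.
        mean w (carleson_box \<theta> l)
          * ennreal_powr (mean (\<lambda>z. w z powr (1 - p / (p - 1))) (carleson_box \<theta> l)) (p - 1))"

definition B_class :: "real \<Rightarrow> (complex \<Rightarrow> real) \<Rightarrow> bool" where
  "B_class p w \<longleftrightarrow> B_const p w < top"

definition LlogL_bound :: "real \<Rightarrow> (complex \<Rightarrow> real) \<Rightarrow> bool" where
  "LlogL_bound C w \<longleftrightarrow>
     (\<forall>\<theta> l. arc_length l \<longrightarrow>
        (let Q = carleson_box \<theta> l in
         (\<integral>\<^sup>+ x \<in> Q. ennreal (w x *
             ln (exp 1 + w x * measure lebesgue Q / enn2real (mass w Q))) \<partial>lebesgue)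
           \<le> ennreal C * mass w Q))"

text \<open>
  A countable family of arcs is a countable set \<open>F\<close> of pairs (centre, length).  Disjointness is
  required of the arcs themselves, as subsets of the circle.
\<close>

definition small_box_unions :: "(complex \<Rightarrow> real) \<Rightarrow> bool" where
  "small_box_unions w \<longleftrightarrow>
     (\<forall>\<epsilon>. 0 < \<epsilon> \<and> \<epsilon> < 1 \<longrightarrow> (\<exists>\<delta>>0. \<forall>\<theta> l F.
        arc_length l \<and> countable F \<and> (\<forall>(\<phi>, m)\<in>F. arc_length m)
          \<and> disjoint_family_on (\<lambda>(\<phi>, m). circle_arc \<phi> m) F
          \<and> (\<Union>(\<phi>, m)\<in>F. circle_arc \<phi> m) \<subseteq> circle_arc \<theta> l
          \<and> measure lebesgue (\<Union>(\<phi>, m)\<in>F. carleson_box \<phi> m)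
              / measure lebesgue (carleson_box \<theta> l) < \<delta>
        \<longrightarrow> mass w (\<Union>(\<phi>, m)\<in>F. carleson_box \<phi> m) < ennreal \<epsilon> * mass w (carleson_box \<theta> l)))"

definition small_measurable_sets :: "(complex \<Rightarrow> real) \<Rightarrow> bool" where
  "small_measurable_sets w \<longleftrightarrow>
     (\<forall>\<epsilon>. 0 < \<epsilon> \<and> \<epsilon> < 1 \<longrightarrow> (\<exists>\<delta>>0. \<forall>\<theta> l \<Omega>.
        arc_length l \<and> \<Omega> \<in> sets lebesgue \<and> \<Omega> \<subseteq> carleson_box \<theta> l
          \<and> measure lebesgue \<Omega> / measure lebesgue (carleson_box \<theta> l) < \<delta>
        \<longrightarrow> mass w \<Omega> < ennreal \<epsilon> * mass w (carleson_box \<theta> l)))"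

definition reverse_Hoelder :: "(complex \<Rightarrow> real) \<Rightarrow> bool" where
  "reverse_Hoelder w \<longleftrightarrow>
     (\<exists>r>1. \<exists>C>0. \<forall>\<theta> l. arc_length l \<longrightarrow>
        ennreal_powr (mean (\<lambda>z. w z powr r) (carleson_box \<theta> l)) (1 / r)
          \<le> ennreal C * mean w (carleson_box \<theta> l))"

text \<open>
  For integrable \<open>w > 0\<close> the integral of \<open>log (1 / w)\<close> over a box always exists in \<open>(-\<infinity>, \<infinity>]\<close>.  The
  integrability clause says that it is finite, as a finite bound requires; without it the
  Bochner integral would silently be 0 in the infinite case.
\<close>

definition exp_log_bound :: "(complex \<Rightarrow> real) \<Rightarrow> bool" where
  "exp_log_bound w \<longleftrightarrow>
     (\<exists>C>0. \<forall>\<theta> l. arc_length l \<longrightarrow>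
        (let Q = carleson_box \<theta> l in
         set_integrable lebesgue Q (\<lambda>x. ln (inverse (w x)))
         \<and> mean w Q * ennreal (exp ((LINT x:Q|lebesgue. ln (inverse (w x))) / measure lebesgue Q))
             \<le> ennreal C))"

end

theory Submission
  imports Defs
begin

text \<open>
  Since \<open>w\<close> is nearly constant on tops, it varies by at most a bounded factor on hyperbolic balls of
  bounded radius. Cut \<open>Q_I\<close> into the layers \<open>|I| / N ^ (k + 1) \<le> 1 - |z| < |I| / N ^ k\<close>: on the \<open>k\<close>-th layer
  \<open>w\<close> is comparable to its values on the top of \<open>Q_I\<close> up to a factor \<open>K ^ (k + 1)\<close>.
  The pivot of the equivalences is the estimate that, for some \<open>N\<close> and \<open>\<beta> < 1\<close>, the part of every
  \<open>Q_I\<close> with \<open>1 - |z| < |I| / N\<close> carries at most the fraction \<open>\<beta>\<close> of \<open>w(Q_I)\<close>. It follows from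
  (3) because that part is a union of \<open>N\<close> small boxes, and from (6) by Chebyshev's inequality for
  \<open>log (f / w) + w / f \<ge> 0\<close>, where \<open>f\<close> is the mean of \<open>w\<close>. Applied to the \<open>N ^ k\<close> subarcs of length
  \<open>|I| / N ^ k\<close> it gives \<open>w\<close>-mass at most \<open>\<beta> ^ k w(Q_I)\<close> in depth \<open>k\<close>, so the integrals in (4) and (5) are
  dominated by geometric series when the exponents are chosen close enough to their limits. For (1), the
  maximal function is bounded by the sum of the means over the \<open>N\<close>-adic boxes containing the point, and
  each such mean is comparable to the mean over the top; as the tops are disjoint, integration gives \<open>w(Q_I)\<close>.
  Conversely, on the top of a \<open>N\<close>-adic box the maximal function is at least the mean over the box, so (1)
  bounds the sum of \<open>w(Q_J)\<close> over all \<open>N\<close>-adic subarcs \<open>J\<close> by a multiple of \<open>B_\<infinity>(w) w(Q_I)\<close>. A point of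
  the \<open>k\<close>-th layer lies in \<open>k + 1\<close> of these boxes and the logarithm in (2) is of order \<open>k + 1\<close> there, which
  proves (2) with a constant linear in \<open>B_\<infinity>(w)\<close>.
\<close>

section \<open>Circular sectors and their area\<close>

text \<open>Carleson boxes are open in the angle, so cutting an arc would lose a ray at each cut.
  The estimates are therefore made on half-open sectors, which tile exactly and agree with the boxes
  almost everywhere. The depth \<open>t = 1 - |z|\<close> is the natural scale: two points lie in a
  common top if their angles differ by less than \<open>t / 2\<close> and the smaller depth is at
  least \<open>1 - \<rho> / 2\<close> times the larger depth \<open>t\<close>. Arcs may be as long
  as \<open>2 * pi\<close>, so boxes with \<open>l > 1\<close> reach the origin and depths are cut
  off at 1; this is the origin of \<open>min l 1\<close> and of the constant 7, an upper bound for
  \<open>2 * pi\<close>. From \<open>N = 128\<close> on, the top layer of a box has at least 1/16 of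
  its area. In the step from \<open>B_infinity\<close> to \<open>LlogL_bound\<close> the number
  \<open>N\<close> is fixed to 128 in advance, so that apart from \<open>B_infinity_const w\<close>
  only \<open>\<rho>\<close> and the constant of near constancy enter. \<open>LlogL_bound\<close>
  and \<open>reverse_Hoelder\<close> lead to \<open>small_measurable_sets\<close> by bounding the
  mass of the set where \<open>w\<close> is large; \<open>B_class\<close> leads to
  \<open>exp_log_bound\<close> by Jensen's inequality.\<close>

lemma lborel_complex_eq: "(lborel :: complex measure) = distr (lborel :: (real^2) measure) borel (\<lambda>x. Complex (x $ 1) (x $ 2))"
proof (rule lborel_eqI)
  let ?f = "\<lambda>x::real^2. Complex (x $ 1) (x $ 2)"
  have meas: "?f \<in> borel_measurable borel"
    by (intro borel_measurable_continuous_onI continuous_on_Complex continuous_intros)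
  fix l u :: complex
  assume le: "\<And>b. b \<in> Basis \<Longrightarrow> l \<bullet> b \<le> u \<bullet> b"
  define l' u' :: "real^2" where "l' = vector [Re l, Im l]" and "u' = vector [Re u, Im u]"
  have "?f -` box l u = box l' u'"
    by (auto simp: l'_def u'_def in_box_complex_iff mem_box_cart forall_2 vector_2)
  moreover have "l' \<bullet> axis i 1 \<le> u' \<bullet> axis i 1" for i :: 2
    using le[of 1] le[of \<i>] exhaust_2[of i]
    by (auto simp: l'_def u'_def inner_axis Basis_complex_def vector_2)
  then have "\<And>b. b \<in> Basis \<Longrightarrow> l' \<bullet> b \<le> u' \<bullet> b"
    by (auto simp: Basis_vec_def)
  moreover have "(\<Prod>b\<in>Basis. (u' - l') \<bullet> b) = (\<Prod>b\<in>Basis. (u - l) \<bullet> b)"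
    by (simp add: l'_def u'_def Basis_complex_def prod_constant Basis_vec_def UNIV_2 inner_axis axis_eq_axis)
  ultimately show "emeasure (distr lborel borel ?f) (box l u) = (\<Prod>b\<in>Basis. (u - l) \<bullet> b)"
    using meas by (simp add: emeasure_distr)
qed simp

lemma emeasure_complex_eq_cart:
  assumes "S \<in> sets borel"
  shows "emeasure lborel S = emeasure lborel {x::real^2. Complex (x $ 1) (x $ 2) \<in> S}"
proof -
  have meas: "(\<lambda>x::real^2. Complex (x $ 1) (x $ 2)) \<in> borel_measurable borel"
    by (intro borel_measurable_continuous_onI continuous_on_Complex continuous_intros)
  show ?thesis
    by (subst lborel_complex_eq) (use assms meas in \<open>simp add: emeasure_distr vimage_def\<close>)
qed

text \<open>Multiplication by a unimodular \<open>c\<close> is an orthogonal map of the real plane,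
  to which Lebesgue measure is transferred coordinatewise. Boundedness gives finite measure, as the
  theorem on orthogonal images asks.\<close>

lemma emeasure_rotation:
  fixes S :: "complex set"
  assumes S: "S \<in> sets borel" and "bounded S" and c: "cmod c = 1"
  shows "emeasure lborel {z. z * c \<in> S} = emeasure lborel S"
proof -
  define f :: "real^2 \<Rightarrow> real^2" where "f = (\<lambda>x. vector [x$1 * Re c - x$2 * Im c, x$1 * Im c + x$2 * Re c])"
  define S' where "S' = {x::real^2. Complex (x $ 1) (x $ 2) * c \<in> S}"
  have Re2: "(Re c)\<^sup>2 + (Im c)\<^sup>2 = 1" using c by (simp add: cmod_def)
  have lin: "linear f"
    by (rule linearI) (auto simp: f_def vec_eq_iff forall_2 vector_2 algebra_simps)
  have orth: "orthogonal_transformation f"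
  proof -
    have "norm (f x) = norm x" for x
    proof -
      have "(x$1 * Re c - x$2 * Im c)\<^sup>2 + (x$1 * Im c + x$2 * Re c)\<^sup>2 = ((x$1)\<^sup>2 + (x$2)\<^sup>2) * ((Re c)\<^sup>2 + (Im c)\<^sup>2)"
        by algebra
      then show ?thesis using Re2
        by (simp add: norm_vec_def L2_set_def sum_2 f_def vector_2)
    qed
    then show ?thesis using lin by (simp add: orthogonal_transformation)
  qed
  have m1: "(\<lambda>x::real^2. Complex (x $ 1) (x $ 2)) \<in> borel_measurable borel"
    by (intro borel_measurable_continuous_onI continuous_on_Complex continuous_intros)
  have mc: "(\<lambda>z::complex. z * c) \<in> borel_measurable borel" by simp
  have Sc: "{z. z * c \<in> S} \<in> sets borel"
    using measurable_sets[OF mc S] by (simp add: vimage_def)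
  have S'b: "S' \<in> sets borel"
    using measurable_sets[OF m1 Sc] by (simp add: vimage_def S'_def)
  obtain B where B: "\<And>z. z \<in> S \<Longrightarrow> cmod z \<le> B" using \<open>bounded S\<close> by (auto simp: bounded_iff)
  have "bounded S'"
    unfolding bounded_iff
  proof (intro exI ballI)
    fix x assume "x \<in> S'"
    then have "cmod (Complex (x $ 1) (x $ 2) * c) \<le> B" using B by (auto simp: S'_def)
    then have "cmod (Complex (x $ 1) (x $ 2)) \<le> B" using c by (simp only: norm_mult mult_1_right)
    then show "norm x \<le> B" by (simp add: cmod_def norm_vec_def L2_set_def sum_2)
  qed
  then have S'l: "S' \<in> lmeasurable" using S'b by (intro bounded_set_imp_lmeasurable) auto
  have im: "f ` S' = {x. Complex (x $ 1) (x $ 2) \<in> S}"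
  proof -
    have e: "Complex (f x $ 1) (f x $ 2) = Complex (x $ 1) (x $ 2) * c" for x
      by (simp add: f_def vector_2 complex_eq_iff algebra_simps)
    have "surj f" using orth by (simp add: orthogonal_transformation_surj)
    then show ?thesis by (fastforce simp: S'_def image_iff surj_def simp flip: e)
  qed
  have imb: "f ` S' \<in> sets borel" using measurable_sets[OF m1 S] by (simp add: im vimage_def)
  have iml: "f ` S' \<in> lmeasurable" by (rule measurable_orthogonal_image[OF orth S'l])
  have "emeasure lborel {z. z * c \<in> S} = emeasure lborel S'"
    by (subst emeasure_complex_eq_cart[OF Sc]) (simp add: S'_def)
  also have "\<dots> = emeasure lebesgue S'" using S'b by simp
  also have "\<dots> = ennreal (measure lebesgue S')" using S'l by (simp add: emeasure_eq_measure2)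
  also have "\<dots> = ennreal (measure lebesgue (f ` S'))" by (simp add: measure_orthogonal_image[OF orth S'l])
  also have "\<dots> = emeasure lebesgue (f ` S')" using iml by (simp add: emeasure_eq_measure2)
  also have "\<dots> = emeasure lborel S" using emeasure_complex_eq_cart[OF S] imb im by simp
  finally show ?thesis .
qed

text \<open>The angle is half-open so that consecutive sectors tile without overlap; the origin,
  which has every angle, is excluded. A general set \<open>A\<close> of radii covers strips and
  layers at once.\<close>

definition sector :: "real \<Rightarrow> real \<Rightarrow> real set \<Rightarrow> complex set" where
  "sector a l A = {of_real r * cis \<phi> | r \<phi>. r \<in> A \<and> 0 < r \<and> a \<le> \<phi> \<and> \<phi> < a + l}"

lemma Arg2pi_rcis: "0 < r \<Longrightarrow> 0 \<le> \<phi> \<Longrightarrow> \<phi> < 2 * pi \<Longrightarrow> Arg2pi (of_real r * cis \<phi>) = \<phi>"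
  by (rule Arg2pi_unique) (auto simp: cis_conv_exp)

text \<open>Rotating by \<open>- a\<close> moves the initial ray to the positive axis, from which
  \<open>Arg2pi\<close> measures the angle; an opening of at most a full turn makes it unambiguous.
  This form gives measurability and the behaviour under rotations.\<close>

lemma sector_eq:
  assumes "l \<le> 2 * pi"
  shows "sector a l A = {z. z \<noteq> 0 \<and> cmod z \<in> A \<and> Arg2pi (z * cis (- a)) < l}" (is "?L = ?R")
proof
  show "?L \<subseteq> ?R"
  proof
    fix z assume "z \<in> ?L"
    then obtain r \<phi> where z: "z = of_real r * cis \<phi>" "r \<in> A" "0 < r" "a \<le> \<phi>" "\<phi> < a + l"
      by (auto simp: sector_def)
    have e: "z * cis (- a) = of_real r * cis (\<phi> - a)" by (simp add: z mult.assoc cis_mult)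
    then have "Arg2pi (z * cis (- a)) = \<phi> - a" unfolding e using z assms by (intro Arg2pi_rcis) auto
    then show "z \<in> ?R" using z by (simp add: norm_mult)
  qed
  show "?R \<subseteq> ?L"
  proof
    fix z assume z: "z \<in> ?R"
    let ?\<phi> = "Arg2pi (z * cis (- a))"
    have "z * cis (- a) = of_real (cmod z) * cis ?\<phi>"
      using Arg2pi_eq[of "z * cis (- a)"] by (simp add: norm_mult cis_conv_exp)
    then have "z * cis (- a) * cis a = of_real (cmod z) * cis (?\<phi> + a)"
      by (metis cis_mult mult.assoc)
    then have "z = of_real (cmod z) * cis (a + ?\<phi>)" by (simp add: mult.assoc cis_mult add.commute[of a])
    then show "z \<in> ?L" unfolding sector_def using z Arg2pi_ge_0[of "z * cis (- a)"]
      by (intro CollectI exI[of _ "cmod z"] exI[of _ "a + ?\<phi>"]) auto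
  qed
qed

lemma measurable_Arg2pi [measurable]: "Arg2pi \<in> borel_measurable borel"
  by (rule borel_measurableI_greater) (simp add: open_Arg2pi2pi_gt)

lemma sector_borel:
  assumes "l \<le> 2 * pi" and A: "A \<in> sets borel"
  shows "sector a l A \<in> sets borel"
proof -
  have [measurable]: "(\<lambda>z. z * cis (- a)) \<in> borel_measurable borel" by simp
  have "{z. z \<noteq> 0 \<and> cmod z \<in> A \<and> Arg2pi (z * cis (- a)) < l} \<in> sets borel"
    using A by measurable
  then show ?thesis using assms by (simp add: sector_eq)
qed

lemma norm_sector: "z \<in> sector a l A \<Longrightarrow> cmod z \<in> A \<and> 0 < cmod z"
  by (auto simp: sector_def norm_mult)

lemma sector_Un: "sector a l (A \<union> B) = sector a l A \<union> sector a l B"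
  by (auto simp: sector_def)

lemma sector_UN: "sector a l (\<Union>i\<in>I. A i) = (\<Union>i\<in>I. sector a l (A i))"
  by (auto simp: sector_def)

lemma sector_mono: "A \<subseteq> B \<Longrightarrow> sector a l A \<subseteq> sector a l B"
  by (auto simp: sector_def)

lemma sector_disjoint: "A \<inter> B = {} \<Longrightarrow> sector a l A \<inter> sector b m B = {}"
  using norm_sector by blast

lemma sector_full: "sector a (2 * pi) A = {z. z \<noteq> 0 \<and> cmod z \<in> A}"
  by (simp add: sector_eq Arg2pi_lt_2pi)

lemma sector_subset: "b \<le> a \<Longrightarrow> a + l \<le> b + m \<Longrightarrow> A \<subseteq> B \<Longrightarrow> sector a l A \<subseteq> sector b m B"
  by (fastforce simp: sector_def)

lemma sector_partition:
  assumes "0 < l" "0 < N"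
  shows "sector a l A = (\<Union>j<N. sector (a + real j * (l / real N)) (l / real N) A)"
proof
  show "(\<Union>j<N. sector (a + real j * (l / real N)) (l / real N) A) \<subseteq> sector a l A"
  proof (intro UN_least sector_subset order_refl)
    fix j assume j: "j \<in> {..<N}"
    have "real j * (l / real N) + l / real N = (real j + 1) * l / real N" by (simp add: field_simps add_divide_distrib)
    also have "\<dots> \<le> real N * l / real N" using j assms by (intro divide_right_mono mult_right_mono) auto
    finally show "a + real j * (l / real N) + l / real N \<le> a + l" using assms by simp
  qed (use assms in simp)
  show "sector a l A \<subseteq> (\<Union>j<N. sector (a + real j * (l / real N)) (l / real N) A)"
  proof
    fix z assume "z \<in> sector a l A"
    then obtain r \<phi> where z: "z = of_real r * cis \<phi>" "r \<in> A" "0 < r" "a \<le> \<phi>" "\<phi> < a + l"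
      by (auto simp: sector_def)
    \<comment> \<open>The piece that contains the angle is found by rounding down its position,
      measured in units of \<open>l / N\<close>.\<close>
    define x where "x = (\<phi> - a) * real N / l"
    define j where "j = nat \<lfloor>x\<rfloor>"
    have "(\<phi> - a) * real N < l * real N" using z assms by (intro mult_strict_right_mono) auto
    then have x: "0 \<le> x" "x < real N" using z assms by (auto simp: x_def field_simps)
    have jx: "real j \<le> x" "x < real j + 1" using x by (auto simp: j_def)
    have "j < N" using jx x by linarith
    moreover have \<phi>: "\<phi> = a + x * (l / real N)" using assms by (simp add: x_def)
    have "real j * (l / real N) \<le> x * (l / real N)" "x * (l / real N) < (real j + 1) * (l / real N)"
      using jx assms by (auto intro!: divide_right_mono divide_strict_right_mono mult_right_mono mult_strict_right_mono)
    then have "z \<in> sector (a + real j * (l / real N)) (l / real N) A"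
      unfolding sector_def using z \<phi> by (intro CollectI exI[of _ r] exI[of _ \<phi>]) (auto simp: distrib_right add_divide_distrib)
    ultimately show "z \<in> (\<Union>j<N. sector (a + real j * (l / real N)) (l / real N) A)" by blast
  qed
qed

lemma cis_eq_close:
  assumes "cis \<phi> = cis \<psi>" "\<bar>\<phi> - \<psi>\<bar> < 2 * pi"
  shows "\<phi> = \<psi>"
proof -
  have "cis (\<phi> - \<psi>) = 1" using assms by (simp add: cis_divide[symmetric])
  then have "cos (\<phi> - \<psi>) = 1" by (metis cis.sel(1) one_complex.sel(1))
  then obtain n :: int where n: "\<phi> - \<psi> = of_int n * (2 * pi)"
    by (metis cos_one_2pi_int mult.assoc)
  then have "\<bar>real_of_int n\<bar> * (2 * pi) < 1 * (2 * pi)" using assms by (simp add: abs_mult)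
  then have "\<bar>real_of_int n\<bar> < 1" using pi_gt_zero mult_less_cancel_right_pos[of "2 * pi" "\<bar>real_of_int n\<bar>" 1] by simp
  then have "n = 0" by linarith
  then show ?thesis using n by simp
qed

text \<open>The angles used by any two pieces lie in one half-open interval of length
  \<open>l \<le> 2 * pi\<close>. They differ by less than a full turn, so equal points have equal
  angles.\<close>

lemma sector_partition_disjoint:
  assumes "0 < l" "l \<le> 2 * pi"
  shows "disjoint_family_on (\<lambda>j. sector (a + real j * (l / real N)) (l / real N) A) {..<N}"
proof -
  have *: "sector (a + real i * (l / real N)) (l / real N) A \<inter> sector (a + real j * (l / real N)) (l / real N) A = {}"
    if ij: "i < j" "j < N" for i j
  proof (rule ccontr)
    assume "\<not> ?thesis"
    then obtain z where z: "z \<in> sector (a + real i * (l / real N)) (l / real N) A" "z \<in> sector (a + real j * (l / real N)) (l / real N) A"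
      by blast
    let ?h = "l / real N"
    have h: "0 < ?h" using assms ij by simp
    obtain r \<phi> where 1: "z = of_real r * cis \<phi>" "0 < r" "a + real i * ?h \<le> \<phi>" "\<phi> < a + real i * ?h + ?h"
      using z(1) by (auto simp: sector_def)
    obtain s \<psi> where 2: "z = of_real s * cis \<psi>" "0 < s" "a + real j * ?h \<le> \<psi>" "\<psi> < a + real j * ?h + ?h"
      using z(2) by (auto simp: sector_def)
    have "cmod z = r" using 1 by (simp add: norm_mult)
    moreover have "cmod z = s" using 2 by (simp add: norm_mult)
    ultimately have "cis \<phi> = cis \<psi>" using 1 2 by simp
    have "real i * ?h + ?h \<le> real j * ?h"
      using mult_right_mono[of "real i + 1" "real j" ?h] ij h by (simp add: distrib_right add_divide_distrib)
    then have lt: "\<phi> < \<psi>" using 1 2 by simp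
    have "real j * ?h + ?h \<le> real N * ?h"
      using mult_right_mono[of "real j + 1" "real N" ?h] ij h by (simp add: distrib_right add_divide_distrib)
    also have "real N * ?h = l" using ij by simp
    finally have "\<psi> < a + l" using 2 by simp
    moreover have "a \<le> \<phi>" using 1 h mult_nonneg_nonneg[of "real i" ?h] by linarith
    ultimately have "\<bar>\<phi> - \<psi>\<bar> < 2 * pi" using lt assms by simp
    then show False using cis_eq_close[OF \<open>cis \<phi> = cis \<psi>\<close>] lt by simp
  qed
  show ?thesis unfolding disjoint_family_on_def
    by (metis * inf_commute lessThan_iff nat_neq_iff)
qed

lemma emeasure_sector_rotate:
  assumes "l \<le> 2 * pi" and A: "A \<in> sets borel" and A1: "A \<subseteq> {..<1}"
  shows "emeasure lebesgue (sector a l A) = emeasure lebesgue (sector 0 l A)"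
proof -
  have b: "sector 0 l A \<in> sets borel" "sector a l A \<in> sets borel" using sector_borel assms by auto
  have "bounded (sector 0 l A)"
    unfolding bounded_iff using norm_sector A1 by (intro exI[of _ 1]) force
  from emeasure_rotation[OF b(1) this, of "cis (- a)"]
  have "emeasure lborel {z. z * cis (- a) \<in> sector 0 l A} = emeasure lborel (sector 0 l A)" by simp
  moreover have "{z. z * cis (- a) \<in> sector 0 l A} = sector a l A"
    using assms by (auto simp: sector_eq norm_mult)
  ultimately show ?thesis using b by simp
qed

text \<open>For \<open>t = l\<close> this is a Carleson box up to a null set, for
  \<open>t < l\<close> its part of depth below \<open>t\<close>. Width and depth are separate
  because a shallow strip is also the union of the boxes over short subarcs.\<close>

definition strip :: "real \<Rightarrow> real \<Rightarrow> real \<Rightarrow> complex set" where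
  "strip a l t = sector a l {1 - t<..<1}"

lemma sector_lebesgue:
  "l \<le> 2 * pi \<Longrightarrow> A \<in> sets borel \<Longrightarrow> sector a l A \<in> sets lebesgue"
  using sector_borel by simp

lemma sector_lmeasurable:
  assumes "l \<le> 2 * pi" "A \<in> sets borel" "A \<subseteq> {..<1}"
  shows "sector a l A \<in> lmeasurable"
proof (rule bounded_set_imp_lmeasurable)
  show "bounded (sector a l A)"
    unfolding bounded_iff using norm_sector assms by (intro exI[of _ 1]) force
qed (use assms sector_lebesgue in auto)

lemma measure_sector_full:
  assumes "0 < t"
  shows "measure lebesgue (sector 0 (2 * pi) {1 - t<..<1}) = pi * (min t 1 * (2 - min t 1))"
proof -
  \<comment> \<open>For \<open>t > 1\<close> the condition \<open>1 - t < r\<close> is vacuous on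
    positive radii, and the annulus degenerates to the punctured disk.\<close>
  define s where "s = min t 1"
  have s: "0 < s" "s \<le> 1" using assms by (auto simp: s_def)
  have "sector 0 (2 * pi) {1 - t<..<1} = ball 0 1 - cball 0 (1 - s)"
  proof -
    have "1 - t < cmod z \<longleftrightarrow> 1 - s < cmod z" if "z \<noteq> 0" for z
    proof -
      have "0 < cmod z" using that by simp
      then show ?thesis unfolding s_def by linarith
    qed
    moreover have "z \<noteq> 0" if "1 - s < cmod z" for z :: complex using that s by auto
    ultimately show ?thesis using s by (auto simp: sector_full not_le)
  qed
  then have "measure lebesgue (sector 0 (2 * pi) {1 - t<..<1}) = measure lebesgue (ball (0::complex) 1) - measure lebesgue (cball (0::complex) (1 - s))"
    proof -
    have "cball (0::complex) (1 - s) \<subseteq> ball 0 1" using s by auto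
    then show ?thesis by (simp add: \<open>sector 0 (2 * pi) _ = _\<close> measurable_measure_Diff)
  qed
  also have "\<dots> = pi - pi * (1 - s)\<^sup>2"
    using s by (simp add: content_ball content_cball eval_unit_ball_vol)
  also have "\<dots> = pi * (s * (2 - s))" by (simp add: power2_eq_square algebra_simps)
  finally show ?thesis by (simp add: s_def)
qed

lemma measure_sector_rotate:
  "l \<le> 2 * pi \<Longrightarrow> A \<in> sets borel \<Longrightarrow> A \<subseteq> {..<1} \<Longrightarrow>
    measure lebesgue (sector a l A) = measure lebesgue (sector 0 l A)"
  using emeasure_sector_rotate[of l A a] by (simp only: measure_def)

lemma nn_integral_sector_partition:
  assumes "0 < l" "l \<le> 2 * pi" "0 < N" "A \<in> sets borel" "f \<in> borel_measurable lebesgue"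
  shows "(\<integral>\<^sup>+ z \<in> sector a l A. f z \<partial>lebesgue) =
    (\<Sum>j<N. \<integral>\<^sup>+ z \<in> sector (a + real j * (l / real N)) (l / real N) A. f z \<partial>lebesgue)"
proof -
  have le: "l / real N \<le> 2 * pi"
    using assms frac_le[of l l 1 "real N"] by simp
  let ?S = "\<lambda>j. sector (a + real j * (l / real N)) (l / real N) A"
  have d: "disjoint_family_on ?S {..<N}" using assms by (intro sector_partition_disjoint) auto
  have "indicator (sector a l A) z = (\<Sum>j<N. indicator (?S j) z :: ennreal)" for z
    unfolding sector_partition[OF assms(1,3)] by (rule indicator_UN_disjoint[OF _ d]) simp
  then have "(\<integral>\<^sup>+ z \<in> sector a l A. f z \<partial>lebesgue) = (\<integral>\<^sup>+ z. (\<Sum>j<N. f z * indicator (?S j) z) \<partial>lebesgue)"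
    by (simp add: sum_distrib_left)
  also have "\<dots> = (\<Sum>j<N. \<integral>\<^sup>+ z \<in> ?S j. f z \<partial>lebesgue)"
    using sector_lebesgue[OF le assms(4)] assms by (intro nn_integral_sum) auto
  finally show ?thesis .
qed

lemma measure_sector_div:
  assumes "0 < l" "l \<le> 2 * pi" "0 < N" and A: "A \<in> sets borel" "A \<subseteq> {..<1}"
  shows "measure lebesgue (sector a l A) = real N * measure lebesgue (sector 0 (l / real N) A)"
proof -
  have le: "l / real N \<le> 2 * pi"
    using assms frac_le[of l l 1 "real N"] by simp
  let ?S = "\<lambda>j. sector (a + real j * (l / real N)) (l / real N) A"
  have "measure lebesgue (sector a l A) = (\<Sum>j<N. measure lebesgue (?S j))"
    unfolding sector_partition[OF assms(1,3)]
    using sector_lmeasurable[OF le A] sector_partition_disjoint[OF assms(1,2)]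
    by (intro measure_finite_Union) (auto simp only: fmeasurable_def top.not_eq_extremum infinity_ennreal_def)
  also have "\<dots> = (\<Sum>j<N. measure lebesgue (sector 0 (l / real N) A))"
    by (intro sum.cong refl measure_sector_rotate le A)
  finally show ?thesis by simp
qed

text \<open>Only the area of the full annulus is computed. With \<open>N\<close> the integer part of
  \<open>2 * pi / l\<close>, the opening \<open>l\<close> lies between
  \<open>2 * pi / (N + 1)\<close> and \<open>2 * pi / N\<close>. Rotated copies of sectors with
  these openings tile the annulus, which determines the area up to constant factors.\<close>

lemma measure_strip_bounds:
  assumes l: "0 < l" "l \<le> 2 * pi" and t: "0 < t"
  shows "l * min t 1 / 4 \<le> measure lebesgue (strip a l t)"
    and "measure lebesgue (strip a l t) \<le> 2 * l * min t 1"
proof -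
  let ?A = "{1 - t<..<1::real}"
  define s where "s = min t 1"
  have s: "0 < s" "s \<le> 1" using t by (auto simp: s_def)
  define m where "m = pi * (s * (2 - s))"
  have "1 * s \<le> (2 - s) * s" "(2 - s) * s \<le> 2 * s" using s by (auto intro!: mult_right_mono)
  then have "pi * (1 * s) \<le> pi * ((2 - s) * s)" "pi * ((2 - s) * s) \<le> pi * (2 * s)"
    by (auto intro!: mult_left_mono)
  then have m: "pi * s \<le> m" "m \<le> 2 * pi * s" by (auto simp: m_def mult.commute mult.left_commute)
  define N where "N = nat \<lfloor>2 * pi / l\<rfloor>"
  have ge1: "1 \<le> 2 * pi / l" using l by simp
  have "real N = of_int \<lfloor>2 * pi / l\<rfloor>" using ge1 by (simp add: N_def)
  then have N: "real N \<le> 2 * pi / l" "2 * pi / l < real N + 1" by linarith+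
  have N1: "1 \<le> N" using ge1 unfolding N_def by (simp add: le_nat_floor)
  have part: "real n * measure lebesgue (sector 0 (2 * pi / real n) ?A) = m" if "0 < n" for n
    using measure_sector_div[of "2 * pi" n ?A 0] that measure_sector_full[OF t] by (simp add: m_def s_def subset_iff)
  have le: "2 * pi / real (Suc N) \<le> l" "l \<le> 2 * pi / real N"
    using N N1 l by (auto simp: field_simps)
  have mono: "measure lebesgue (sector 0 x ?A) \<le> measure lebesgue (sector 0 y ?A)"
    if "x \<le> y" "y \<le> 2 * pi" for x y
    using that by (intro measure_mono_fmeasurable sector_subset sector_lmeasurable sector_lebesgue) auto
  have rot: "measure lebesgue (strip a l t) = measure lebesgue (sector 0 l ?A)"
    unfolding strip_def using l by (intro measure_sector_rotate) auto
  have "2 * pi / real N \<le> 2 * pi" using N1 by (simp add: divide_le_eq)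
  then have up: "real N * measure lebesgue (strip a l t) \<le> m"
    using mono[OF le(2)] part[of N] N1 unfolding rot by (metis mult_left_mono of_nat_0_le_iff not_one_le_zero gr0I)
  have lo: "m \<le> real (Suc N) * measure lebesgue (strip a l t)"
    using mono[OF le(1) l(2)] part[of "Suc N"] unfolding rot by (metis mult_left_mono of_nat_0_le_iff zero_less_Suc)
  let ?M = "measure lebesgue (strip a l t)"
  have M0: "0 \<le> ?M" by simp
  have "real (Suc N) \<le> 4 * pi / l" proof -
    have "4 * pi / l = 2 * (2 * pi / l)" by simp
    then show ?thesis using N(1) ge1 by linarith
  qed
  then have "m \<le> 4 * pi / l * ?M" using lo mult_right_mono[OF _ M0] by (meson order_trans)
  then have "pi * s \<le> 4 * pi / l * ?M" using m by simp
  then have "pi * (s * l) \<le> pi * (4 * ?M)" using l by (simp add: field_simps)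
  then have "s * l \<le> 4 * ?M" by (simp add: mult_le_cancel_left_pos)
  then show "l * min t 1 / 4 \<le> ?M" by (simp add: s_def mult.commute)
  have "pi / l \<le> real N" proof -
    have "real N + 1 \<le> 2 * real N" using N1 by simp
    then have "2 * pi / l \<le> 2 * real N" using N(2) by linarith
    then show ?thesis by simp
  qed
  then have "pi / l * ?M \<le> m" using up mult_right_mono[OF _ M0] by (meson order_trans)
  then have "pi / l * ?M \<le> 2 * pi * s" using m by simp
  then have "pi * ?M \<le> pi * (2 * s * l)" using l by (simp add: field_simps)
  then have "?M \<le> 2 * s * l" by (simp add: mult_le_cancel_left_pos)
  then show "?M \<le> 2 * l * min t 1" by (simp add: s_def mult_ac)
qed

section \<open>Carleson boxes compared with half-open sectors\<close>

lemma ray_null: "{z. Im (z * cis b) = 0} \<in> null_sets lebesgue"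
proof -
  have "{z. Im (z * cis b) = 0} = {z. Complex (sin b) (cos b) \<bullet> z = 0}"
    by (auto simp: inner_complex_def algebra_simps)
  moreover have "Complex (sin b) (cos b) \<noteq> 0"
    by (metis complex.sel norm_zero norm_cis cmod_def sin_cos_squared_add real_sqrt_one zero_neq_one)
  ultimately show ?thesis
    using negligible_hyperplane[of "Complex (sin b) (cos b)" 0] by (simp add: negligible_iff_null_sets)
qed

lemma carleson_box_iff:
  assumes "arc_length l" "z \<noteq> 0"
  shows "z \<in> carleson_box \<theta> l \<longleftrightarrow>
    1 - l < cmod z \<and> cmod z < 1 \<and> 0 < Arg2pi (z * cis (- (\<theta> - l / 2))) \<and> Arg2pi (z * cis (- (\<theta> - l / 2))) < l"
    (is "?L \<longleftrightarrow> ?R")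
proof
  let ?a = "\<theta> - l / 2"
  have l: "0 < l" "l \<le> 2 * pi" using assms by (auto simp: arc_length_def)
  {
    assume ?L
    then obtain r \<phi> where z: "z = of_real r * cis \<phi>" "0 \<le> r" "1 - l < r" "r < 1" "\<bar>\<theta> - \<phi>\<bar> < l / 2"
      by (auto simp: carleson_box_def)
    have r: "0 < r" using z assms by (cases "r = 0") auto
    have e: "z * cis (- ?a) = of_real r * cis (\<phi> - ?a)" by (simp add: z mult.assoc cis_mult del: minus_diff_eq)
    have \<phi>: "0 < \<phi> - ?a" "\<phi> - ?a < l" using z(5) unfolding abs_less_iff by linarith+
    have "Arg2pi (z * cis (- ?a)) = \<phi> - ?a" unfolding e using z r \<phi> l by (intro Arg2pi_rcis) auto
    then show ?R using z r \<phi> by (simp add: norm_mult)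
  }
  {
    assume R: ?R
    then have "z \<in> sector ?a l {1 - l<..<1}" using assms l by (simp add: sector_eq)
    then obtain r \<phi> where z: "z = of_real r * cis \<phi>" "1 - l < r" "r < 1" "0 < r" "?a \<le> \<phi>" "\<phi> < ?a + l"
      by (auto simp: sector_def)
    have e: "z * cis (- ?a) = of_real r * cis (\<phi> - ?a)" by (simp add: z mult.assoc cis_mult del: minus_diff_eq)
    have "Arg2pi (z * cis (- ?a)) = \<phi> - ?a" unfolding e using z l by (intro Arg2pi_rcis) auto
    then have "?a < \<phi>" using R by simp
    then have "\<bar>\<theta> - \<phi>\<bar> < l / 2" using z unfolding abs_less_iff by linarith
    then show ?L unfolding carleson_box_def using z by (intro CollectI exI[of _ r] exI[of _ \<phi>]) auto
  }
qed

text \<open>A box with \<open>l > 1\<close> contains the origin but misses a ray issuing from it, so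
  it is not open there. Openness elsewhere suffices for Borel measurability, even of uncountable
  unions of boxes.\<close>

lemma open_carleson_box_Diff_0:
  assumes "arc_length l"
  shows "open (carleson_box \<theta> l - {0})"
proof -
  let ?c = "cis (- (\<theta> - l / 2))"
  have l: "0 < l" "l \<le> 2 * pi" using assms by (auto simp: arc_length_def)
  have "carleson_box \<theta> l - {0} = {z. z \<noteq> 0} \<inter> {z. 1 - l < cmod z} \<inter> {z. cmod z < 1}
      \<inter> (\<lambda>z. z * ?c) -` ({y. 0 < Arg2pi y} \<inter> {y. Arg2pi y < l})"
    using carleson_box_iff[OF assms] by (auto simp del: minus_diff_eq)
  moreover have "open ((\<lambda>z. z * ?c) -` ({y. 0 < Arg2pi y} \<inter> {y. Arg2pi y < l}))"
    using l by (intro open_vimage open_Arg2pi2pi_less_Int continuous_intros) auto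
  moreover have "open {z::complex. z \<noteq> 0}" "open {z. 1 - l < cmod z}" "open {z. cmod z < 1}"
    by (auto intro!: open_Collect_less open_Collect_neq continuous_intros)
  ultimately show ?thesis by (metis open_Int)
qed

lemma carleson_box_borel:
  assumes "arc_length l" shows "carleson_box \<theta> l \<in> sets borel"
proof -
  have "carleson_box \<theta> l - {0} \<in> sets borel" using open_carleson_box_Diff_0[OF assms] by simp
  moreover have "carleson_box \<theta> l = (carleson_box \<theta> l - {0}) \<union> (carleson_box \<theta> l \<inter> {0})" by blast
  moreover have "carleson_box \<theta> l \<inter> {0} \<in> sets borel" by (cases "0 \<in> carleson_box \<theta> l") auto
  ultimately show ?thesis by (metis sets.Un)
qed

lemma carleson_box_subset_disk: "carleson_box \<theta> l \<subseteq> unit_disk"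
  by (auto simp: carleson_box_def norm_mult)

lemma strip_subset_disk: "strip a l t \<subseteq> unit_disk"
  unfolding strip_def using norm_sector by fastforce

text \<open>The two sets differ at most at the origin and on the initial ray, which the half-open
  strip includes and the open box omits.\<close>

lemma AE_carleson_box_strip:
  assumes "arc_length l"
  shows "AE z in lebesgue. z \<in> carleson_box \<theta> l \<longleftrightarrow> z \<in> strip (\<theta> - l / 2) l l"
proof (rule AE_I')
  let ?c = "cis (- (\<theta> - l / 2))"
  have l: "l \<le> 2 * pi" using assms by (auto simp: arc_length_def)
  show "{z. Im (z * ?c) = 0} \<in> null_sets lebesgue" by (rule ray_null)
  show "{z \<in> space lebesgue. \<not> (z \<in> carleson_box \<theta> l \<longleftrightarrow> z \<in> strip (\<theta> - l / 2) l l)} \<subseteq> {z. Im (z * ?c) = 0}"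
  proof clarify
    fix z assume z: "\<not> (z \<in> carleson_box \<theta> l \<longleftrightarrow> z \<in> strip (\<theta> - l / 2) l l)"
    show "Im (z * ?c) = 0"
    proof (cases "z = 0")
      case False
      have "z \<in> strip (\<theta> - l / 2) l l \<longleftrightarrow> 1 - l < cmod z \<and> cmod z < 1 \<and> Arg2pi (z * ?c) < l"
        unfolding strip_def sector_eq[OF l] using False by (simp del: minus_diff_eq)
      then have "Arg2pi (z * ?c) = 0"
        using z carleson_box_iff[OF assms False, of \<theta>] Arg2pi_ge_0[of "z * ?c"] by (metis order_le_less)
      then show ?thesis by (auto simp: Arg2pi_eq_0 complex_is_Real_iff)
    qed simp
  qed
qed

lemma nn_integral_carleson_box:
  assumes "arc_length l"
  shows "(\<integral>\<^sup>+ z \<in> carleson_box \<theta> l. f z \<partial>lebesgue) = (\<integral>\<^sup>+ z \<in> strip (\<theta> - l / 2) l l. f z \<partial>lebesgue)"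
  by (rule nn_integral_cong_AE) (use AE_carleson_box_strip[OF assms, of \<theta>] in \<open>auto elim!: eventually_mono split: split_indicator\<close>)

lemma strip_borel: "l \<le> 2 * pi \<Longrightarrow> strip a l t \<in> sets borel"
  unfolding strip_def by (rule sector_borel) auto

lemma emeasure_carleson_box:
  assumes "arc_length l"
  shows "emeasure lebesgue (carleson_box \<theta> l) = emeasure lebesgue (strip (\<theta> - l / 2) l l)"
proof (rule emeasure_eq_AE[OF AE_carleson_box_strip[OF assms]])
  show "carleson_box \<theta> l \<in> sets lebesgue" using carleson_box_borel[OF assms] by simp
  show "strip (\<theta> - l / 2) l l \<in> sets lebesgue" using strip_borel assms by (simp add: arc_length_def)
qed

lemma measure_carleson_box:
  "arc_length l \<Longrightarrow> measure lebesgue (carleson_box \<theta> l) = measure lebesgue (strip (\<theta> - l / 2) l l)"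
  by (simp add: measure_def emeasure_carleson_box)

section \<open>Comparison of the values of the weight\<close>

text \<open>Coordinates adapted to the boundary: \<open>t\<close> is the distance to the circle, the
  scale on which near constancy allows comparison.\<close>

definition polar :: "real \<Rightarrow> real \<Rightarrow> complex" where
  "polar t \<alpha> = of_real (1 - t) * cis \<alpha>"

lemma sector_polarE:
  assumes "z \<in> sector a l A"
  obtains t \<phi> where "z = polar t \<phi>" "1 - t \<in> A" "t < 1" "a \<le> \<phi>" "\<phi> < a + l"
proof -
  from assms obtain r \<phi> where "z = of_real r * cis \<phi>" "r \<in> A" "0 < r" "a \<le> \<phi>" "\<phi> < a + l"
    by (auto simp: sector_def)
  then show ?thesis using that[of "1 - r" \<phi>] by (simp add: polar_def)
qed

lemma mass_cong: "(\<And>z. z \<in> E \<Longrightarrow> f z = g z) \<Longrightarrow> mass f E = mass g E"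
  unfolding mass_def by (intro nn_integral_cong) (simp split: split_indicator)

lemma mass_mono: "E \<subseteq> F \<Longrightarrow> mass f E \<le> mass f F"
  unfolding mass_def by (intro nn_integral_mono) (auto split: split_indicator)

lemma mass_carleson_box:
  "arc_length l \<Longrightarrow> mass f (carleson_box \<theta> l) = mass f (strip (\<theta> - l / 2) l l)"
  unfolding mass_def by (rule nn_integral_carleson_box)

lemma mean_carleson_box:
  "arc_length l \<Longrightarrow> mean f (carleson_box \<theta> l) = mean f (strip (\<theta> - l / 2) l l)"
  unfolding mean_def by (simp add: mass_carleson_box emeasure_carleson_box)

text \<open>Positivity and measurability on the whole plane spare side conditions on the domain; at
  the end the given weight is extended by 1 outside the disk. The last assumption is the
  integrability of the weight on the disk.\<close>

locale disk_weight =
  fixes w :: "complex \<Rightarrow> real"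
  assumes w_measurable [measurable]: "w \<in> borel_measurable lebesgue"
    and w_pos: "\<And>z. 0 < w z"
    and mass_disk: "mass w unit_disk < top"
begin

text \<open>Faithful on sets of finite mass, in particular on subsets of the disk;
  \<open>enn2real\<close> would send an infinite mass to 0.\<close>

definition \<nu> :: "complex set \<Rightarrow> real" where "\<nu> E = enn2real (mass w E)"

lemma \<nu>_nonneg [simp]: "0 \<le> \<nu> E"
  by (simp add: \<nu>_def)

lemma mass_eq_\<nu>: "E \<subseteq> unit_disk \<Longrightarrow> mass w E = ennreal (\<nu> E)"
  unfolding \<nu>_def using mass_mono[of E unit_disk w] mass_disk by (simp add: ennreal_enn2real order_le_less_trans)

lemma \<nu>_mono: "E \<subseteq> F \<Longrightarrow> F \<subseteq> unit_disk \<Longrightarrow> \<nu> E \<le> \<nu> F"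
  unfolding \<nu>_def using mass_mono[of E F w] mass_mono[of F unit_disk w] mass_disk
  by (intro enn2real_mono) auto

lemma \<nu>_pos:
  assumes "E \<in> sets lebesgue" "E \<subseteq> unit_disk" "0 < measure lebesgue E"
  shows "0 < \<nu> E"
proof -
  have "mass w E \<noteq> 0"
  proof
    assume "mass w E = 0"
    then have "AE z in lebesgue. ennreal (w z) * indicator E z = 0"
      unfolding mass_def using assms(1) by (subst (asm) nn_integral_0_iff_AE) auto
    moreover have "ennreal (w z) * indicator E z = 0 \<longleftrightarrow> z \<notin> E" for z
      using w_pos[of z] by (simp add: indicator_def ennreal_eq_0_iff not_le)
    ultimately have "AE z in lebesgue. z \<notin> E" by simp
    then have "emeasure lebesgue E = 0" using AE_iff_measurable[OF assms(1), of "\<lambda>z. z \<notin> E"] by simp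
    then show False using assms(3) by (simp add: measure_def)
  qed
  then show ?thesis using mass_eq_\<nu>[OF assms(2)] \<nu>_nonneg[of E] by (cases "\<nu> E = 0") (auto simp: less_le)
qed

lemma \<nu>_Un:
  assumes "E \<in> sets lebesgue" "F \<in> sets lebesgue" "E \<inter> F = {}" "E \<union> F \<subseteq> unit_disk"
  shows "\<nu> (E \<union> F) = \<nu> E + \<nu> F"
proof -
  have "mass w (E \<union> F) = (\<integral>\<^sup>+ z. ennreal (w z) * indicator E z + ennreal (w z) * indicator F z \<partial>lebesgue)"
    unfolding mass_def using assms(3) by (intro nn_integral_cong) (auto split: split_indicator)
  also have "\<dots> = mass w E + mass w F"
    unfolding mass_def using assms by (intro nn_integral_add) auto
  finally have "ennreal (\<nu> (E \<union> F)) = ennreal (\<nu> E + \<nu> F)"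
    using assms by (simp add: mass_eq_\<nu>)
  then show ?thesis by (subst (asm) ennreal_inj) (auto intro: add_nonneg_nonneg)
qed

lemma \<nu>_le_const:
  assumes "E \<in> lmeasurable" "E \<subseteq> unit_disk" "0 \<le> c" "\<And>z. z \<in> E \<Longrightarrow> w z \<le> c"
  shows "\<nu> E \<le> c * measure lebesgue E"
proof -
  have "mass w E \<le> (\<integral>\<^sup>+ z \<in> E. ennreal c \<partial>lebesgue)"
    unfolding mass_def using assms(4) by (intro nn_integral_mono) (auto split: split_indicator intro: ennreal_leI)
  also have "\<dots> = ennreal (c * measure lebesgue E)"
    using assms by (simp add: nn_integral_cmult_indicator fmeasurableD emeasure_eq_measure2 ennreal_mult)
  finally show ?thesis using assms by (simp add: mass_eq_\<nu>)
qed

lemma \<nu>_ge_const: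
  assumes "E \<in> lmeasurable" "E \<subseteq> unit_disk" "0 \<le> c" "\<And>z. z \<in> E \<Longrightarrow> c \<le> w z"
  shows "c * measure lebesgue E \<le> \<nu> E"
proof -
  have "ennreal (c * measure lebesgue E) = (\<integral>\<^sup>+ z \<in> E. ennreal c \<partial>lebesgue)"
    using assms by (simp add: nn_integral_cmult_indicator fmeasurableD emeasure_eq_measure2 ennreal_mult)
  also have "\<dots> \<le> mass w E"
    unfolding mass_def using assms(4) by (intro nn_integral_mono) (auto split: split_indicator intro: ennreal_leI)
  finally show ?thesis using assms by (simp add: mass_eq_\<nu>)
qed

end

locale top_weight = disk_weight +
  fixes \<rho> C :: real
  assumes \<rho>: "0 < \<rho>" "\<rho> < 1" and C_pos: "0 < C"
    and nearly_constant: "nearly_constant_on_tops \<rho> C w"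
begin

text \<open>Both points lie in the top over an arc centred at \<open>\<alpha>\<close> whose length
  \<open>l = t / (1 - \<rho> / 2)\<close> is slightly larger than \<open>t\<close>. The required
  \<open>(1 - \<rho>) * l < t'\<close> holds because the square of \<open>1 - \<rho> / 2\<close>
  exceeds \<open>1 - \<rho>\<close>.\<close>

lemma polar_step:
  assumes t: "0 < t" "t \<le> 1" "(1 - \<rho> / 2) * t \<le> t'" "t' \<le> t" and \<alpha>: "\<bar>\<alpha> - \<alpha>'\<bar> < t / 2"
  shows "w (polar t \<alpha>) \<le> C * w (polar t' \<alpha>')" "w (polar t' \<alpha>') \<le> C * w (polar t \<alpha>)"
proof -
  define q where "q = 1 - \<rho> / 2"
  have q: "1 / 2 < q" "q < 1" using \<rho> by (auto simp: q_def)
  define l where "l = t / q"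
  have l: "t < l" "0 < l" using t q by (auto simp: l_def field_simps)
  have "l \<le> 2 * t" using t q by (auto simp: l_def field_simps)
  then have al: "arc_length l" using l t pi_ge_two unfolding arc_length_def by linarith
  have "(1 - \<rho>) < q * q" using \<rho> by (simp add: q_def algebra_simps)
  then have "(1 - \<rho>) * t < q * q * t" using t by (intro mult_strict_right_mono) auto
  then have "(1 - \<rho>) * l < q * t" using q by (simp add: l_def field_simps)
  then have lo: "(1 - \<rho>) * l < t'" using t by (simp add: q_def)
  have "polar t \<alpha> \<in> carleson_top \<rho> \<alpha> l"
    unfolding carleson_top_def polar_def using t lo l
    by (intro CollectI exI[of _ "1 - t"] exI[of _ \<alpha>]) auto
  moreover have "polar t' \<alpha>' \<in> carleson_top \<rho> \<alpha> l"
    unfolding carleson_top_def polar_def using t lo l \<alpha>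
    by (intro CollectI exI[of _ "1 - t'"] exI[of _ \<alpha>']) auto
  ultimately show "w (polar t \<alpha>) \<le> C * w (polar t' \<alpha>')" "w (polar t' \<alpha>') \<le> C * w (polar t \<alpha>)"
    using nearly_constant al unfolding nearly_constant_on_tops_def by blast+
qed

lemma C_ge_1: "1 \<le> C"
  using polar_step(1)[of 1 1 0 0] \<rho> w_pos[of "polar 1 0"] by simp

text \<open>The angular distance is covered at constant depth in \<open>n\<close> equal steps of
  length at most \<open>t / 4\<close>, each costing a factor \<open>C\<close>.\<close>

lemma polar_angular:
  assumes t: "0 < t" "t \<le> 1" and "\<bar>\<alpha> - \<alpha>'\<bar> \<le> real n * t / 4"
  shows "w (polar t \<alpha>) \<le> C ^ n * w (polar t \<alpha>')"
  using assms(3)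
proof (induction n arbitrary: \<alpha>)
  case (Suc n)
  define \<beta> where "\<beta> = \<alpha> + (\<alpha>' - \<alpha>) / (real n + 1)"
  have "\<bar>\<alpha> - \<beta>\<bar> = \<bar>\<alpha> - \<alpha>'\<bar> / (real n + 1)" by (simp add: \<beta>_def abs_minus_commute)
  also have "\<dots> \<le> (real (Suc n) * t / 4) / (real n + 1)" using Suc.prems by (intro divide_right_mono) auto
  also have "\<dots> = t / 4" by (simp add: field_simps)
  also have "\<dots> < t / 2" using t by simp
  finally have 1: "w (polar t \<alpha>) \<le> C * w (polar t \<beta>)" using t \<rho> by (intro polar_step) (auto simp: mult_le_cancel_right2)
  have "\<beta> - \<alpha>' = (\<alpha> - \<alpha>') * (real n / (real n + 1))" by (simp add: \<beta>_def field_simps)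
  then have "\<bar>\<beta> - \<alpha>'\<bar> = \<bar>\<alpha> - \<alpha>'\<bar> * (real n / (real n + 1))" by (simp add: abs_mult)
  also have "\<dots> \<le> (real (Suc n) * t / 4) * (real n / (real n + 1))" using Suc.prems by (intro mult_right_mono) auto
  also have "\<dots> = real n * t / 4" by (simp add: field_simps)
  finally have "w (polar t \<beta>) \<le> C ^ n * w (polar t \<alpha>')" by (rule Suc.IH)
  then have "C * w (polar t \<beta>) \<le> C * (C ^ n * w (polar t \<alpha>'))" using C_pos by (intro mult_left_mono) auto
  then show ?case using 1 by simp
qed simp

text \<open>Along a radius the depth goes from \<open>t\<close> to \<open>t'\<close> in at most
  \<open>m\<close> steps, none of which shrinks it by more than the factor
  \<open>1 - \<rho> / 2\<close>.\<close>

lemma polar_radial: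
  assumes "0 < t'" "t' \<le> t" "t \<le> 1" "(1 - \<rho> / 2) ^ m * t \<le> t'"
  shows "w (polar t \<alpha>) \<le> C ^ m * w (polar t' \<alpha>)" "w (polar t' \<alpha>) \<le> C ^ m * w (polar t \<alpha>)"
proof -
  let ?q = "1 - \<rho> / 2"
  have q: "0 < ?q" "?q < 1" using \<rho> by auto
  have "w (polar t \<alpha>) \<le> C ^ m * w (polar t' \<alpha>) \<and> w (polar t' \<alpha>) \<le> C ^ m * w (polar t \<alpha>)"
    using assms
  proof (induction m arbitrary: t')
    case (Suc m)
    have t0: "0 < t" using Suc.prems by simp
    show ?case
    proof (cases "?q ^ m * t \<le> t'")
      case True
      then have IH: "w (polar t \<alpha>) \<le> C ^ m * w (polar t' \<alpha>)" "w (polar t' \<alpha>) \<le> C ^ m * w (polar t \<alpha>)"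
        using Suc by auto
      have "C ^ m \<le> C ^ Suc m" using C_ge_1 by (intro power_increasing) auto
      then have "C ^ m * w z \<le> C ^ Suc m * w z" for z using w_pos[of z] by (intro mult_right_mono) auto
      then show ?thesis using IH by (meson order_trans)
    next
      case False
      define u where "u = ?q ^ m * t"
      have u: "0 < u" "t' \<le> u" using False t0 q by (auto simp: u_def)
      have "?q ^ m \<le> 1" using q by (intro power_le_one) auto
      then have ut: "u \<le> t" using t0 by (simp add: u_def mult_le_cancel_right2)
      have IH: "w (polar t \<alpha>) \<le> C ^ m * w (polar u \<alpha>)" "w (polar u \<alpha>) \<le> C ^ m * w (polar t \<alpha>)"
        using Suc.IH[of u] u ut Suc.prems by (auto simp: u_def)
      have "w (polar u \<alpha>) \<le> C * w (polar t' \<alpha>)" "w (polar t' \<alpha>) \<le> C * w (polar u \<alpha>)"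
      proof -
        have "?q * u \<le> t'" using Suc.prems by (simp add: u_def)
        then show "w (polar u \<alpha>) \<le> C * w (polar t' \<alpha>)" "w (polar t' \<alpha>) \<le> C * w (polar u \<alpha>)"
          using polar_step[of u t' \<alpha> \<alpha>] u ut Suc.prems by simp_all
      qed
      then have "C ^ m * w (polar u \<alpha>) \<le> C ^ m * (C * w (polar t' \<alpha>))" "w (polar t' \<alpha>) \<le> C * w (polar u \<alpha>)"
        "C * w (polar u \<alpha>) \<le> C * (C ^ m * w (polar t \<alpha>))"
        using C_pos IH by (auto intro!: mult_left_mono)
      then show ?thesis using IH by (auto simp: mult_ac)
    qed
  qed auto
  then show "w (polar t \<alpha>) \<le> C ^ m * w (polar t' \<alpha>)" "w (polar t' \<alpha>) \<le> C ^ m * w (polar t \<alpha>)" by auto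
qed

end

text \<open>The constant does not depend on the weight; this is what makes \<open>C'\<close> below uniform.\<close>

definition comparison_exponent :: "real \<Rightarrow> real \<Rightarrow> nat" where
  "comparison_exponent \<rho> R = nat \<lceil>4 * R\<rceil> + (LEAST m. (1 - \<rho> / 2) ^ m \<le> 1 / R)"

text \<open>The path first follows the circle at depth \<open>t\<close> in
  \<open>n \<ge> 4 * R\<close> steps, then the radius in \<open>m\<close> steps with
  \<open>(1 - \<rho> / 2) ^ m \<le> 1 / R\<close>. The exponent is \<open>n + m\<close>.\<close>

lemma (in top_weight) polar_compare:
  assumes R: "1 \<le> R" and t: "0 < t" "t \<le> 1" "0 < t'" "t' \<le> 1" "t \<le> R * t'" "t' \<le> R * t"
    and \<alpha>: "\<bar>\<alpha> - \<alpha>'\<bar> \<le> R * t"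
  shows "w (polar t \<alpha>) \<le> C ^ comparison_exponent \<rho> R * w (polar t' \<alpha>')"
proof -
  let ?q = "1 - \<rho> / 2"
  define m where "m = (LEAST m. ?q ^ m \<le> 1 / R)"
  define n where "n = nat \<lceil>4 * R\<rceil>"
  have "\<exists>m. ?q ^ m < 1 / R" using \<rho> R by (intro real_arch_pow_inv) auto
  then have m: "?q ^ m \<le> 1 / R" unfolding m_def by (metis (mono_tags, lifting) LeastI less_imp_le)
  have "4 * R \<le> real n" unfolding n_def by linarith
  then have "4 * R * t \<le> real n * t" using t by (intro mult_right_mono) auto
  then have "\<bar>\<alpha> - \<alpha>'\<bar> \<le> real n * t / 4" using \<alpha> by simp
  then have 1: "w (polar t \<alpha>) \<le> C ^ n * w (polar t \<alpha>')" using t by (intro polar_angular) auto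
  have 2: "w (polar t \<alpha>') \<le> C ^ m * w (polar t' \<alpha>')"
  proof (cases "t' \<le> t")
    case True
    have "?q ^ m * t \<le> 1 / R * t" using m t by (intro mult_right_mono) auto
    also have "\<dots> \<le> t'" using t R by (simp add: field_simps)
    finally show ?thesis using True t by (intro polar_radial) auto
  next
    case False
    have "?q ^ m * t' \<le> 1 / R * t'" using m t by (intro mult_right_mono) auto
    also have "\<dots> \<le> t" using t R by (simp add: field_simps)
    finally show ?thesis using False t by (intro polar_radial) auto
  qed
  have "C ^ n * w (polar t \<alpha>') \<le> C ^ n * (C ^ m * w (polar t' \<alpha>'))" using 2 C_pos by (intro mult_left_mono) auto
  then show ?thesis using 1 by (simp add: comparison_exponent_def m_def n_def power_add mult_ac)
qed

section \<open>Layers of a Carleson box\<close>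

text \<open>Half-open in the radius, so that the layers tile the strip exactly. Layer 0 serves as
  the top of the box.\<close>

definition layer :: "nat \<Rightarrow> real \<Rightarrow> real \<Rightarrow> nat \<Rightarrow> complex set" where
  "layer N a l k = sector a l {1 - l / real N ^ k<..1 - l / real N ^ Suc k}"

lemma layer_exists:
  assumes "1 < N" "0 < l" "0 < t" "t < l"
  shows "\<exists>k. l / real N ^ Suc k \<le> t \<and> t < l / real N ^ k"
proof -
  let ?P = "\<lambda>k. l / real N ^ Suc k \<le> t"
  have "\<exists>n. (1 / real N) ^ n < t / l" using assms by (intro real_arch_pow_inv) auto
  then obtain n where "l / real N ^ n < t" using assms by (auto simp: power_divide field_simps)
  moreover have "l / real N ^ Suc n \<le> l / real N ^ n" using assms by (intro divide_left_mono power_increasing) auto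
  ultimately have ex: "?P n" by linarith
  define k where "k = (LEAST k. ?P k)"
  have "?P k" unfolding k_def by (rule LeastI[of ?P, OF ex])
  moreover have "t < l / real N ^ k"
  proof (cases k)
    case (Suc j)
    then have "\<not> ?P j" using not_less_Least[of j ?P] by (simp add: k_def)
    then show ?thesis using Suc by simp
  qed (use assms in simp)
  ultimately show ?thesis by blast
qed

lemma layer_bounds_antimono:
  assumes "1 < N" "0 < l" "i \<le> k"
  shows "l / real N ^ k \<le> l / real N ^ i"
  using assms by (intro divide_left_mono power_increasing) auto

lemma layer_UN: "1 < N \<Longrightarrow> 0 < l \<Longrightarrow> (\<Union>k. layer N a l k) = strip a l l"
proof -
  assume N: "1 < N" "0 < l"
  have "{1 - l<..<1} = (\<Union>k. {1 - l / real N ^ k<..1 - l / real N ^ Suc k})"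
  proof (intro set_eqI iffI)
    fix r assume "r \<in> {1 - l<..<1}"
    then obtain k where "l / real N ^ Suc k \<le> 1 - r" "1 - r < l / real N ^ k"
      using layer_exists[OF N, of "1 - r"] by auto
    then show "r \<in> (\<Union>k. {1 - l / real N ^ k<..1 - l / real N ^ Suc k})" by (intro UN_I[of k]) auto
  next
    fix r assume "r \<in> (\<Union>k. {1 - l / real N ^ k<..1 - l / real N ^ Suc k})"
    then obtain k where k: "1 - l / real N ^ k < r" "r \<le> 1 - l / real N ^ Suc k" by auto
    have "l / real N ^ k \<le> l" using layer_bounds_antimono[OF N, of 0 k] by simp
    moreover have "0 < l / real N ^ Suc k" using N by simp
    ultimately show "r \<in> {1 - l<..<1}" using k by (simp del: power_Suc)
  qed
  then show ?thesis unfolding layer_def strip_def by (simp add: sector_UN)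
qed

lemma layer_disjoint: "1 < N \<Longrightarrow> 0 < l \<Longrightarrow> disjoint_family (layer N a l)"
proof -
  assume N: "1 < N" "0 < l"
  have "layer N a l i \<inter> layer N a l j = {}" if "i < j" for i j
    unfolding layer_def
    using layer_bounds_antimono[OF N, of "Suc i" j] that by (intro sector_disjoint) (auto simp del: power_Suc)
  then show ?thesis unfolding disjoint_family_on_def by (metis inf_commute nat_neq_iff)
qed

lemma layer_borel: "l \<le> 2 * pi \<Longrightarrow> layer N a l k \<in> sets borel"
  unfolding layer_def by (rule sector_borel) auto

lemma layer_subset_strip: "1 < N \<Longrightarrow> 0 < l \<Longrightarrow> i \<le> k \<Longrightarrow> layer N a l k \<subseteq> strip a l (l / real N ^ i)"
proof -
  assume N: "1 < N" "0 < l" "i \<le> k"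
  have "0 < l / real N ^ Suc k" using N by simp
  then show ?thesis unfolding layer_def strip_def
    using layer_bounds_antimono[OF N] by (intro sector_mono) (auto simp del: power_Suc)
qed

lemma nn_integral_layers:
  assumes "1 < N" "0 < l" "l \<le> 2 * pi" "f \<in> borel_measurable lebesgue"
  shows "(\<integral>\<^sup>+ z \<in> strip a l l. f z \<partial>lebesgue) = (\<Sum>k. \<integral>\<^sup>+ z \<in> layer N a l k. f z \<partial>lebesgue)"
proof -
  have [measurable]: "layer N a l k \<in> sets lebesgue" for k using layer_borel assms by simp
  have "indicator (strip a l l) z = (\<Sum>k. indicator (layer N a l k) z :: ennreal)" for z
    using suminf_indicator[OF layer_disjoint[OF assms(1,2), of a], of z] by (simp add: layer_UN[OF assms(1,2)])
  then have "(\<integral>\<^sup>+ z \<in> strip a l l. f z \<partial>lebesgue) = (\<integral>\<^sup>+ z. (\<Sum>k. f z * indicator (layer N a l k) z) \<partial>lebesgue)"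
    by (simp add: ennreal_suminf_cmult)
  also have "\<dots> = (\<Sum>k. \<integral>\<^sup>+ z \<in> layer N a l k. f z \<partial>lebesgue)"
    using assms layer_borel[of l N a]
    by (intro nn_integral_suminf borel_measurable_times_ennreal borel_measurable_indicator) auto
  finally show ?thesis .
qed

text \<open>\<open>strip a l (l / N ^ i)\<close> is the union of the half-open boxes over the
  \<open>N ^ i\<close> subarcs of generation \<open>i\<close>, so the sum counts the boxes of all
  generations that contain \<open>z\<close>.\<close>

lemma layer_count:
  assumes "1 < N" "0 < l" "z \<in> layer N a l k"
  shows "ennreal (real (Suc k)) \<le> (\<Sum>i. indicator (strip a l (l / real N ^ i)) z)"
proof -
  have "ennreal (real (Suc k)) = (\<Sum>i\<le>k. indicator (strip a l (l / real N ^ i)) z)"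
    using layer_subset_strip[OF assms(1,2)] assms(3)
    by (subst sum.cong[OF refl, of _ _ "\<lambda>_. 1"]) (auto simp: subset_iff ennreal_of_nat_eq_real_of_nat simp del: of_nat_Suc)
  also have "\<dots> \<le> (\<Sum>i. indicator (strip a l (l / real N ^ i)) z)"
    by (intro sum_le_suminf) auto
  finally show ?thesis .
qed

lemma strip_lmeasurable: "l \<le> 2 * pi \<Longrightarrow> strip a l t \<in> lmeasurable"
  unfolding strip_def by (rule sector_lmeasurable) auto

lemma layer_lmeasurable: "0 < l \<Longrightarrow> l \<le> 2 * pi \<Longrightarrow> 1 < N \<Longrightarrow> layer N a l k \<in> lmeasurable"
proof -
  assume N: "0 < l" "l \<le> 2 * pi" "1 < N"
  have "0 < l / real N ^ Suc k" using N by simp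
  then have "x < 1" if "x \<le> 1 - l / real N ^ Suc k" for x using that by linarith
  then show ?thesis unfolding layer_def using N by (intro sector_lmeasurable) (auto simp del: power_Suc)
qed

lemma strip_split: "1 < N \<Longrightarrow> 0 < l \<Longrightarrow> strip a l l = layer N a l 0 \<union> strip a l (l / real N)"
proof -
  assume N: "1 < N" "0 < l"
  have "l / real N \<le> l" "0 < l / real N" using layer_bounds_antimono[OF N, of 0 1] N by auto
  then have "{1 - l<..<1} = {1 - l<..1 - l / real N} \<union> {1 - l / real N<..<1}" by auto
  then show ?thesis unfolding strip_def layer_def by (simp add: sector_Un)
qed

lemma layer_strip_disjoint: "layer N a l 0 \<inter> strip a l (l / real N) = {}"
  unfolding strip_def layer_def by (intro sector_disjoint) auto

lemma measure_strip_pos: "0 < l \<Longrightarrow> l \<le> 2 * pi \<Longrightarrow> 0 < t \<Longrightarrow> 0 < measure lebesgue (strip a l t)"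
proof -
  assume l: "0 < l" "l \<le> 2 * pi" "0 < t"
  then have "0 < l * min t 1 / 4" by simp
  then show ?thesis using measure_strip_bounds(1)[OF l, of a] by linarith
qed

text \<open>With \<open>s = min l 1\<close> the strip has area between \<open>l * s / 4\<close> and
  \<open>2 * l * s\<close>, and the part below the layer has area at most
  \<open>2 * l * (7 * s) / 128 \<le> l * s / 8\<close>. The layer keeps at least
  \<open>l * s / 8\<close>.\<close>

lemma measure_strip_le_layer:
  assumes N: "128 \<le> N" and l: "0 < l" "l \<le> 2 * pi"
  shows "measure lebesgue (strip a l l) \<le> 16 * measure lebesgue (layer N a l 0)"
proof -
  define s where "s = min l 1"
  have s: "0 < s" "l \<le> 7 * s" using l pi_less_4 pi_approx by (auto simp: s_def min_def)
  have N1: "1 < N" using N by simp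
  have "measure lebesgue (strip a l l) = measure lebesgue (layer N a l 0) + measure lebesgue (strip a l (l / real N))"
    unfolding strip_split[OF N1 l(1), of a]
    using layer_lmeasurable[OF l N1] strip_lmeasurable[OF l(2)] layer_strip_disjoint by (intro measure_Un2[THEN trans]) (auto simp: Diff_triv inf_commute)
  moreover have "measure lebesgue (strip a l (l / real N)) \<le> l * s / 8"
  proof -
    have "measure lebesgue (strip a l (l / real N)) \<le> 2 * l * min (l / real N) 1"
      using l N by (intro measure_strip_bounds) auto
    also have "\<dots> \<le> 2 * l * (l / real N)" using l by (intro mult_left_mono) auto
    also have "\<dots> \<le> 2 * l * (7 * s / 128)" using l s N by (intro mult_left_mono frac_le) auto
    also have "\<dots> \<le> 2 * l * (s / 16)" using l s by (intro mult_left_mono) auto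
    finally show ?thesis by simp
  qed
  moreover have "l * s / 4 \<le> measure lebesgue (strip a l l)" "measure lebesgue (strip a l l) \<le> 2 * (l * s)"
    using measure_strip_bounds[OF l l(1), of a] by (auto simp: s_def)
  ultimately show ?thesis by linarith
qed

lemma strip_partition_nn_integral:
  assumes "1 < N" "0 < l" "l \<le> 2 * pi" "f \<in> borel_measurable lebesgue"
  shows "(\<integral>\<^sup>+ z \<in> strip a l t. f z \<partial>lebesgue) =
    (\<Sum>j<N ^ k. \<integral>\<^sup>+ z \<in> strip (a + real j * (l / real N ^ k)) (l / real N ^ k) t. f z \<partial>lebesgue)"
  unfolding strip_def using nn_integral_sector_partition[of l "N ^ k" _ f a] assms by simp

text \<open>Dividing the arc into \<open>N ^ k\<close> parts cuts layer \<open>k\<close> into the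
  disjoint tops of the boxes of generation \<open>k\<close>, because
  \<open>(l / N ^ k) / N = l / N ^ (k + 1)\<close>.\<close>

lemma layer_partition_nn_integral:
  assumes "1 < N" "0 < l" "l \<le> 2 * pi" "f \<in> borel_measurable lebesgue"
  shows "(\<integral>\<^sup>+ z \<in> layer N a l k. f z \<partial>lebesgue) =
    (\<Sum>j<N ^ k. \<integral>\<^sup>+ z \<in> layer N (a + real j * (l / real N ^ k)) (l / real N ^ k) 0. f z \<partial>lebesgue)"
  unfolding layer_def using nn_integral_sector_partition[of l "N ^ k" _ f a] assms by (simp add: mult.commute)

lemma subarc:
  assumes "1 < N" "arc_length l" "j < N ^ k"
  defines "m \<equiv> l / real N ^ k"
  shows "arc_length m" "m \<le> l" "a \<le> a + real j * m" "a + real j * m + m \<le> a + l"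
proof -
  have l: "0 < l" "l \<le> 2 * pi" using assms(2) by (auto simp: arc_length_def)
  show m: "m \<le> l" unfolding m_def using layer_bounds_antimono[OF assms(1) l(1), of 0 k] by simp
  have m0: "0 < m" using l assms(1) by (simp add: m_def)
  show "arc_length m" using m m0 l by (auto simp: arc_length_def)
  show "a \<le> a + real j * m" using m0 by simp
  have "real j + 1 \<le> real (N ^ k)" using assms(3) by linarith
  then have "(real j + 1) * m \<le> real (N ^ k) * m" using m0 by (intro mult_right_mono) auto
  also have "\<dots> = l" using assms(1) by (simp add: m_def)
  finally show "a + real j * m + m \<le> a + l" by (simp add: algebra_simps)
qed

lemma carleson_box_mono:
  "\<theta> - l / 2 \<le> \<phi> - m / 2 \<Longrightarrow> \<phi> + m / 2 \<le> \<theta> + l / 2 \<Longrightarrow> m \<le> l \<Longrightarrow> carleson_box \<phi> m \<subseteq> carleson_box \<theta> l"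
proof
  assume le: "\<theta> - l / 2 \<le> \<phi> - m / 2" "\<phi> + m / 2 \<le> \<theta> + l / 2" "m \<le> l"
  fix z assume "z \<in> carleson_box \<phi> m"
  then obtain r \<alpha> where z: "z = of_real r * cis \<alpha>" "0 \<le> r" "1 - m < r" "r < 1" "\<bar>\<phi> - \<alpha>\<bar> < m / 2"
    by (auto simp: carleson_box_def)
  have "1 - l < r" "\<bar>\<theta> - \<alpha>\<bar> < l / 2" using z le by linarith+
  then show "z \<in> carleson_box \<theta> l" unfolding carleson_box_def using z by blast
qed

text \<open>A superlevel set is a union of boxes over possibly uncountably many arcs; it is Borel
  because each box is open off the origin.\<close>

lemma carleson_maximal_measurable: "carleson_maximal f \<in> borel_measurable borel"
proof (rule borel_measurableI_greater)
  fix y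
  define U where "U = {z. y < carleson_maximal f z}"
  define P where "P = {(\<theta>, l). arc_length l \<and> y < mean (\<lambda>x. \<bar>f x\<bar>) (carleson_box \<theta> l)}"
  have "U = (\<Union>(\<theta>, l)\<in>P. carleson_box \<theta> l)"
    unfolding U_def P_def carleson_maximal_def by (auto simp: less_SUP_iff)
  then have "U - {0} = (\<Union>(\<theta>, l)\<in>P. carleson_box \<theta> l - {0})" by auto
  moreover have "open \<dots>" by (auto simp: P_def open_carleson_box_Diff_0)
  ultimately have "U - {0} \<in> sets borel" by simp
  moreover have "U \<inter> {0} \<in> sets borel" by (cases "0 \<in> U") auto
  moreover have "U = (U - {0}) \<union> (U \<inter> {0})" by blast
  ultimately have "U \<in> sets borel" by (metis sets.Un)
  then show "{x \<in> space borel. y < carleson_maximal f x} \<in> sets borel" by (simp add: U_def)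
qed

lemma carleson_maximal_ge:
  "arc_length l \<Longrightarrow> z \<in> carleson_box \<theta> l \<Longrightarrow> mean (\<lambda>x. \<bar>f x\<bar>) (carleson_box \<theta> l) \<le> carleson_maximal f z"
  unfolding carleson_maximal_def by (rule SUP_upper2[of "(\<theta>, l)"]) auto

text \<open>The range \<open>2 * N ^ 2\<close> is made for the tops over two arcs of lengths
  \<open>m < h \<le> N * m\<close> whose boxes meet: their depths have ratio at most
  \<open>N ^ 2\<close>, and their angles differ by at most \<open>2 * h\<close>, that is,
  \<open>2 * N ^ 2\<close> times the depth.\<close>

definition layer_exponent :: "real \<Rightarrow> nat \<Rightarrow> nat" where
  "layer_exponent \<rho> N = comparison_exponent \<rho> (2 * real N ^ 2)"

section \<open>Boxes of all generations and the maximal function\<close>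

context disk_weight
begin

lemma \<nu>_strip_pos: "0 < l \<Longrightarrow> l \<le> 2 * pi \<Longrightarrow> 0 < t \<Longrightarrow> 0 < \<nu> (strip a l t)"
  using strip_lmeasurable[of l a t] measure_strip_pos[of l t a] strip_subset_disk
  by (intro \<nu>_pos) auto

lemma emeasure_strip: "l \<le> 2 * pi \<Longrightarrow> emeasure lebesgue (strip a l t) = ennreal (measure lebesgue (strip a l t))"
  using strip_lmeasurable[of l a t] by (simp add: emeasure_eq_measure2)

lemma mean_strip:
  "0 < l \<Longrightarrow> l \<le> 2 * pi \<Longrightarrow> 0 < t \<Longrightarrow>
    mean w (strip a l t) = ennreal (\<nu> (strip a l t) / measure lebesgue (strip a l t))"
  using measure_strip_pos[of l t a]
  by (simp add: mean_def mass_eq_\<nu>[OF strip_subset_disk] emeasure_strip divide_ennreal)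

lemma mass_strip_times_w:
  assumes "l \<le> 2 * pi" "0 \<le> c"
  shows "(\<integral>\<^sup>+ z \<in> strip a l t. ennreal (c * w z) \<partial>lebesgue) = ennreal c * mass w (strip a l t)"
proof -
  have [measurable]: "strip a l t \<in> sets lebesgue" using strip_borel[of l a t] assms by simp
  show ?thesis unfolding mass_def
    by (subst nn_integral_cmult[symmetric]) (auto simp: ennreal_mult' assms mult.assoc intro!: nn_integral_cong)
qed

text \<open>Subdivide \<open>I\<close> into \<open>N ^ k\<close> arcs \<open>J\<close>: the maximal function dominates the mean over \<open>Q_J\<close> on the
  \<open>k\<close>-th layer of \<open>Q_J\<close>, whose area is comparable to that of \<open>Q_J\<close>.\<close>

lemma sum_mass_strips_le_maximal:
  fixes \<theta> l :: real
  assumes N: "128 \<le> N" and l: "arc_length l"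
  defines "a \<equiv> \<theta> - l / 2"
  defines "F \<equiv> carleson_maximal (\<lambda>x. w x * indicator (carleson_box \<theta> l) x)"
  shows "(\<Sum>k. mass w (strip a l (l / real N ^ k))) \<le> 16 * (\<integral>\<^sup>+ z \<in> strip a l l. F z \<partial>lebesgue)"
proof -
  have N1: "1 < N" using N by simp
  have l0: "0 < l" "l \<le> 2 * pi" using l by (auto simp: arc_length_def)
  have F [measurable]: "F \<in> borel_measurable lebesgue"
    using carleson_maximal_measurable[of "\<lambda>x. w x * indicator (carleson_box \<theta> l) x"] unfolding F_def
    by (intro measurable_completion) simp
  have node: "mass w (strip b m m) \<le> 16 * (\<integral>\<^sup>+ z \<in> layer N b m 0. F z \<partial>lebesgue)"
    if m: "arc_length m" "m \<le> l" "a \<le> b" "b + m \<le> a + l" for b m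
  proof -
    define \<phi> where "\<phi> = b + m / 2"
    have b: "b = \<phi> - m / 2" by (simp add: \<phi>_def)
    have m0: "0 < m" "m \<le> 2 * pi" using m by (auto simp: arc_length_def)
    have sub: "carleson_box \<phi> m \<subseteq> carleson_box \<theta> l"
      using m by (intro carleson_box_mono) (auto simp: a_def \<phi>_def field_simps)
    define c where "c = mean w (strip b m m)"
    have "mean (\<lambda>x. \<bar>w x * indicator (carleson_box \<theta> l) x\<bar>) (carleson_box \<phi> m) = mean w (carleson_box \<phi> m)"
      unfolding mean_def using sub w_pos by (intro arg_cong2[of _ _ _ _ divide] mass_cong) (auto simp: less_imp_le)
    also have "\<dots> = c" unfolding c_def b by (rule mean_carleson_box[OF m(1)])
    finally have Fge: "c \<le> F z" if "z \<in> carleson_box \<phi> m" for z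
      using carleson_maximal_ge[OF m(1) that] unfolding F_def by metis
    have T: "layer N b m 0 \<in> lmeasurable" "layer N b m 0 \<subseteq> strip b m m"
      using layer_lmeasurable[OF m0 N1] layer_subset_strip[OF N1 m0(1), of 0 0 b] by auto
    have [measurable]: "layer N b m 0 \<in> sets lebesgue" using T(1) by auto
    have "AE z in lebesgue. z \<in> carleson_box \<phi> m \<longleftrightarrow> z \<in> strip b m m"
      unfolding b by (rule AE_carleson_box_strip[OF m(1)])
    then have "AE z in lebesgue. c * indicator (layer N b m 0) z \<le> F z * indicator (layer N b m 0) z"
      using T(2) Fge by (auto elim!: eventually_mono split: split_indicator)
    then have 1: "c * emeasure lebesgue (layer N b m 0) \<le> (\<integral>\<^sup>+ z \<in> layer N b m 0. F z \<partial>lebesgue)"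
      using nn_integral_mono_AE by (subst nn_integral_cmult_indicator[symmetric]) auto
    have "ennreal (measure lebesgue (strip b m m)) \<le> ennreal (16 * measure lebesgue (layer N b m 0))"
      using measure_strip_le_layer[OF N m0] by (rule ennreal_leI)
    then have "emeasure lebesgue (strip b m m) \<le> 16 * emeasure lebesgue (layer N b m 0)"
      using T(1) emeasure_strip[OF m0(2)] by (simp add: emeasure_eq_measure2 ennreal_mult)
    then have "c * emeasure lebesgue (strip b m m) \<le> 16 * (c * emeasure lebesgue (layer N b m 0))"
      by (metis mult_left_mono mult.left_commute zero_le)
    also have "\<dots> \<le> 16 * (\<integral>\<^sup>+ z \<in> layer N b m 0. F z \<partial>lebesgue)" using 1 by (intro mult_left_mono) auto
    also have "c * emeasure lebesgue (strip b m m) = mass w (strip b m m)"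
      using measure_strip_pos[OF m0 m0(1), of b] unfolding c_def mean_strip[OF m0 m0(1)] emeasure_strip[OF m0(2)]
      by (simp add: ennreal_mult[symmetric] mass_eq_\<nu>[OF strip_subset_disk])
    finally show ?thesis .
  qed
  \<comment> \<open>The tops of the boxes of generation \<open>k\<close> tile layer
    \<open>k\<close>, so the bounds for the single boxes add up without overlap.\<close>
  have "mass w (strip a l (l / real N ^ k)) \<le> 16 * (\<integral>\<^sup>+ z \<in> layer N a l k. F z \<partial>lebesgue)" for k
  proof -
    have "mass w (strip a l (l / real N ^ k)) = (\<Sum>j<N ^ k. mass w (strip (a + real j * (l / real N ^ k)) (l / real N ^ k) (l / real N ^ k)))"
      unfolding mass_def by (rule strip_partition_nn_integral[OF N1 l0]) simp
    also have "\<dots> \<le> (\<Sum>j<N ^ k. 16 * (\<integral>\<^sup>+ z \<in> layer N (a + real j * (l / real N ^ k)) (l / real N ^ k) 0. F z \<partial>lebesgue))"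
      using subarc[OF N1 l] by (intro sum_mono node) auto
    also have "\<dots> = 16 * (\<integral>\<^sup>+ z \<in> layer N a l k. F z \<partial>lebesgue)"
      unfolding layer_partition_nn_integral[OF N1 l0 F] by (simp add: sum_distrib_left)
    finally show ?thesis .
  qed
  then have "(\<Sum>k. mass w (strip a l (l / real N ^ k))) \<le> (\<Sum>k. 16 * (\<integral>\<^sup>+ z \<in> layer N a l k. F z \<partial>lebesgue))"
    by (intro suminf_le) auto
  also have "\<dots> = 16 * (\<integral>\<^sup>+ z \<in> strip a l l. F z \<partial>lebesgue)"
    unfolding nn_integral_layers[OF N1 l0 F] by (rule ennreal_suminf_cmult)
  finally show ?thesis .
qed

end

section \<open>Values of the weight across the layers\<close>

context top_weight
begin

definition K :: "nat \<Rightarrow> real" where "K N = C ^ layer_exponent \<rho> N"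

lemma K_ge_1: "1 \<le> K N"
  unfolding K_def using C_ge_1 by simp

lemma K_compare:
  assumes N: "1 \<le> N" and t: "0 < t" "t \<le> 1" "0 < t'" "t' \<le> 1" "t \<le> 2 * real N ^ 2 * t'" "t' \<le> 2 * real N ^ 2 * t"
    and \<alpha>: "\<bar>\<alpha> - \<alpha>'\<bar> \<le> 2 * real N ^ 2 * t"
  shows "w (polar t \<alpha>) \<le> K N * w (polar t' \<alpha>')"
proof -
  have "1 \<le> real N ^ 2" using N by simp
  then have "1 \<le> 2 * real N ^ 2" by linarith
  then show ?thesis unfolding K_def layer_exponent_def using assms by (intro polar_compare) auto
qed

text \<open>At a fixed angle the depth is multiplied by \<open>N\<close>, at the cost of a factor
  \<open>K N\<close> per generation, until the point lies in the top. There a last factor absorbs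
  the change of angle and depth.\<close>

lemma polar_chain:
  assumes N: "7 \<le> N" and l: "arc_length l"
    and \<phi>: "a \<le> \<phi>" "\<phi> < a + l" "a \<le> \<phi>'" "\<phi>' < a + l"
    and t': "l / real N \<le> t'" "t' < l" "t' \<le> 1"
    and t: "l / real N ^ Suc k \<le> t" "t < l" "t \<le> 1"
  shows "w (polar t \<phi>) \<le> K N ^ Suc k * w (polar t' \<phi>')" "w (polar t' \<phi>') \<le> K N ^ Suc k * w (polar t \<phi>)"
proof -
  have l0: "0 < l" "l \<le> 2 * pi" using l by (auto simp: arc_length_def)
  have lN: "l \<le> real N" using l0 pi_less_4 N pi_approx by simp
  have N0: "0 < real N" "1 \<le> real N" using N by auto
  have NN: "real N * x \<le> 2 * real N ^ 2 * x" if "0 \<le> x" for x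
    using that N0 by (intro mult_right_mono) (auto simp: power2_eq_square)
  have base: "w (polar u \<phi>) \<le> K N * w (polar t' \<phi>') \<and> w (polar t' \<phi>') \<le> K N * w (polar u \<phi>)"
    if u: "l / real N \<le> u" "u < l" "u \<le> 1" for u
  proof -
    have "0 < l / real N" using l0 N0 by simp
    then have p: "0 < u" "0 < t'" using u t' by linarith+
    have u': "l \<le> real N * u" and t'': "l \<le> real N * t'" using u t' N0 by (auto simp: field_simps)
    have 1: "l \<le> 2 * real N ^ 2 * u" "l \<le> 2 * real N ^ 2 * t'"
      using u' t'' NN[of u] NN[of t'] p by linarith+
    have "\<bar>\<phi> - \<phi>'\<bar> \<le> l" "\<bar>\<phi>' - \<phi>\<bar> \<le> l" using \<phi> by auto
    then have 2: "\<bar>\<phi> - \<phi>'\<bar> \<le> 2 * real N ^ 2 * u" "\<bar>\<phi>' - \<phi>\<bar> \<le> 2 * real N ^ 2 * t'" using 1 by linarith+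
    show ?thesis using p 1 2 u t' N by (intro conjI K_compare) auto
  qed
  have "w (polar t \<phi>) \<le> K N ^ Suc k * w (polar t' \<phi>') \<and> w (polar t' \<phi>') \<le> K N ^ Suc k * w (polar t \<phi>)"
    using t
  proof (induction k arbitrary: t)
    case 0
    then show ?case using base[of t] by simp
  next
    case (Suc k)
    show ?case
    proof (cases "l / real N \<le> t")
      case True
      then have b: "w (polar t \<phi>) \<le> K N * w (polar t' \<phi>')" "w (polar t' \<phi>') \<le> K N * w (polar t \<phi>)"
        using base Suc.prems by auto
      have "K N ^ 1 \<le> K N ^ Suc (Suc k)" using K_ge_1 by (intro power_increasing) auto
      then have "K N * w z \<le> K N ^ Suc (Suc k) * w z" for z using w_pos[of z] by (intro mult_right_mono) auto
      then show ?thesis using b by (meson order_trans)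
    next
      case False
      \<comment> \<open>A depth cannot exceed 1, but for \<open>l > 1\<close> the value
        \<open>N * t\<close> may. Since \<open>l \<le> N\<close>, the truncated depth is still at
        least \<open>l / N ^ Suc k\<close>.\<close>
      define u where "u = min (real N * t) 1"
      have "0 < l / real N ^ Suc (Suc k)" using l0 N0 by simp
      then have t0: "0 < t" using Suc.prems by linarith
      have Nt: "real N * t < l" using False N0 by (simp add: field_simps)
      have "l \<le> real N ^ Suc k" using lN N0 self_le_power[of "real N" "Suc k"] by linarith
      then have "l / real N ^ Suc k \<le> 1" using N0 by (simp del: power_Suc)
      moreover have "l / real N ^ Suc k \<le> real N * t" using Suc.prems(1) N0 by (simp add: field_simps)
      ultimately have "l / real N ^ Suc k \<le> u" by (simp add: u_def del: power_Suc)
      moreover have "u < l" "u \<le> 1" using Nt by (auto simp: u_def)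
      ultimately have IH: "w (polar u \<phi>) \<le> K N ^ Suc k * w (polar t' \<phi>')" "w (polar t' \<phi>') \<le> K N ^ Suc k * w (polar u \<phi>)"
        using Suc.IH by blast+
      have ut: "0 < u" "t \<le> u" "u \<le> real N * t"
        using t0 N0 Suc.prems mult_right_mono[OF N0(2), of t] by (auto simp: u_def)
      have c: "0 \<le> 2 * real N ^ 2 * t" "0 \<le> 2 * real N ^ 2 * u" using t0 ut by auto
      have "u \<le> 2 * real N ^ 2 * t" using ut NN[of t] t0 by linarith
      moreover have "t \<le> 2 * real N ^ 2 * u" using ut NN[of u] mult_right_mono[OF N0(2), of u] by linarith
      ultimately have st: "w (polar u \<phi>) \<le> K N * w (polar t \<phi>)" "w (polar t \<phi>) \<le> K N * w (polar u \<phi>)"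
        using t0 ut c N Suc.prems \<open>u \<le> 1\<close> by (auto intro!: K_compare)
      have K0: "0 \<le> K N" "0 \<le> K N ^ Suc k" using K_ge_1[of N] by auto
      have "K N * w (polar u \<phi>) \<le> K N * (K N ^ Suc k * w (polar t' \<phi>'))"
        using IH K0 by (intro mult_left_mono) auto
      moreover have "K N ^ Suc k * w (polar u \<phi>) \<le> K N ^ Suc k * (K N * w (polar t \<phi>))"
        using st K0 by (intro mult_left_mono) auto
      ultimately show ?thesis using st IH by (auto simp: mult_ac)
    qed
  qed
  then show "w (polar t \<phi>) \<le> K N ^ Suc k * w (polar t' \<phi>')" "w (polar t' \<phi>') \<le> K N ^ Suc k * w (polar t \<phi>)" by auto
qed

lemma layer_compare:
  assumes N: "7 \<le> N" and l: "arc_length l" and z: "z \<in> layer N a l k" and \<xi>: "\<xi> \<in> layer N a l 0"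
  shows "w z \<le> K N ^ Suc k * w \<xi>" "w \<xi> \<le> K N ^ Suc k * w z"
proof -
  have N1: "1 < N" using N by simp
  have l0: "0 < l" using l by (simp add: arc_length_def)
  have e: "l / real N ^ k \<le> l" using layer_bounds_antimono[OF N1 l0, of 0 k] by simp
  from z obtain t \<phi> where t: "z = polar t \<phi>" "1 - t \<in> {1 - l / real N ^ k<..1 - l / real N ^ Suc k}" "t < 1" "a \<le> \<phi>" "\<phi> < a + l"
    unfolding layer_def by (rule sector_polarE)
  from \<xi> obtain t' \<phi>' where t': "\<xi> = polar t' \<phi>'" "1 - t' \<in> {1 - l / real N ^ 0<..1 - l / real N ^ Suc 0}" "t' < 1" "a \<le> \<phi>'" "\<phi>' < a + l"
    unfolding layer_def by (rule sector_polarE)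
  have "l / real N \<le> t'" "t' < l" "t' \<le> 1" "l / real N ^ Suc k \<le> t" "t < l" "t \<le> 1"
    using t t' e by (auto simp del: power_Suc)
  from polar_chain[OF N l t(4,5) t'(4,5) this]
  show "w z \<le> K N ^ Suc k * w \<xi>" "w \<xi> \<le> K N ^ Suc k * w z"
    unfolding t(1) t'(1) .
qed

text \<open>On the top the values are at least \<open>w z / K N ^ Suc k\<close>, and the top has at
  least 1/16 of the area, so its mass alone bounds \<open>w z\<close> by the mean over the
  strip.\<close>

lemma layer_upper:
  assumes N: "128 \<le> N" and l: "arc_length l" and z: "z \<in> layer N a l k"
  shows "w z \<le> 16 * K N ^ Suc k * (\<nu> (strip a l l) / measure lebesgue (strip a l l))"
proof -
  have N7: "7 \<le> N" "1 < N" using N by auto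
  have l0: "0 < l" "l \<le> 2 * pi" using l by (auto simp: arc_length_def)
  let ?T = "layer N a l 0" and ?Q = "strip a l l"
  have Kp: "0 < K N ^ Suc k" using K_ge_1[of N] by (intro zero_less_power) linarith
  have sub: "?T \<subseteq> ?Q" using layer_subset_strip[OF N7(2) l0(1), of 0 0 a] by simp
  have "w z / K N ^ Suc k * measure lebesgue ?T \<le> \<nu> ?T"
  proof (rule \<nu>_ge_const)
    show "?T \<subseteq> unit_disk" using sub strip_subset_disk by blast
    show "w z / K N ^ Suc k \<le> w \<xi>" if "\<xi> \<in> ?T" for \<xi>
      using layer_compare(1)[OF N7(1) l z that] Kp by (simp add: field_simps del: power_Suc)
  qed (use layer_lmeasurable[OF l0 N7(2)] Kp w_pos[of z] in \<open>auto simp: less_imp_le simp del: power_Suc\<close>)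
  also have "\<dots> \<le> \<nu> ?Q" using sub strip_subset_disk by (intro \<nu>_mono) auto
  finally have 1: "w z / K N ^ Suc k * measure lebesgue ?T \<le> \<nu> ?Q" .
  define x where "x = w z / K N ^ Suc k"
  have "x * measure lebesgue ?Q \<le> x * (16 * measure lebesgue ?T)"
    using measure_strip_le_layer[OF N l0, of a] Kp w_pos[of z] unfolding x_def by (intro mult_left_mono) (auto simp: less_imp_le simp del: power_Suc)
  also have "\<dots> = 16 * (x * measure lebesgue ?T)" by simp
  also have "\<dots> \<le> 16 * \<nu> ?Q" using 1 unfolding x_def by (intro mult_left_mono) auto
  finally have "w z / K N ^ Suc k * measure lebesgue ?Q \<le> 16 * \<nu> ?Q" by (simp add: x_def)
  then have "w z * measure lebesgue ?Q \<le> 16 * \<nu> ?Q * K N ^ Suc k" using Kp by (simp add: field_simps del: power_Suc)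
  then show ?thesis using measure_strip_pos[OF l0 l0(1), of a] by (simp add: field_simps del: power_Suc)
qed

end

section \<open>From \<open>B_infinity\<close> to the L log L bound\<close>

context disk_weight
begin

text \<open>Passage from extended values on a Carleson box to real arithmetic on the half-open
  strip, with the positivity that divisions and logarithms need.\<close>

lemma box_facts:
  fixes \<theta> l :: real
  assumes "arc_length l"
  defines "Q \<equiv> strip (\<theta> - l / 2) l l"
  shows "mass w (carleson_box \<theta> l) = ennreal (\<nu> Q)" "0 < \<nu> Q" "0 < measure lebesgue Q"
    "measure lebesgue (carleson_box \<theta> l) = measure lebesgue Q"
    "mean w (carleson_box \<theta> l) = ennreal (\<nu> Q / measure lebesgue Q)"
    "0 < \<nu> Q / measure lebesgue Q" "Q \<in> lmeasurable" "Q \<subseteq> unit_disk"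
proof -
  have l: "0 < l" "l \<le> 2 * pi" using assms by (auto simp: arc_length_def)
  show "mass w (carleson_box \<theta> l) = ennreal (\<nu> Q)"
    unfolding Q_def mass_carleson_box[OF assms(1)] by (rule mass_eq_\<nu>[OF strip_subset_disk])
  show "0 < \<nu> Q" "0 < measure lebesgue Q"
    unfolding Q_def using l by (auto intro!: \<nu>_strip_pos measure_strip_pos)
  then show "0 < \<nu> Q / measure lebesgue Q" by simp
  show "measure lebesgue (carleson_box \<theta> l) = measure lebesgue Q"
    unfolding Q_def by (rule measure_carleson_box[OF assms(1)])
  show "mean w (carleson_box \<theta> l) = ennreal (\<nu> Q / measure lebesgue Q)"
    unfolding Q_def mean_carleson_box[OF assms(1)] using l by (intro mean_strip) auto
  show "Q \<in> lmeasurable" "Q \<subseteq> unit_disk"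
    unfolding Q_def using strip_lmeasurable[OF l(2)] strip_subset_disk by auto
qed

lemma integral_maximal_le:
  assumes "arc_length l"
  shows "(\<integral>\<^sup>+ z \<in> carleson_box \<theta> l. carleson_maximal (\<lambda>x. w x * indicator (carleson_box \<theta> l) x) z \<partial>lebesgue)
    \<le> B_infinity_const w * mass w (carleson_box \<theta> l)" (is "?I \<le> _")
proof -
  note b = box_facts[OF assms, of \<theta>]
  have "?I / mass w (carleson_box \<theta> l) \<le> B_infinity_const w"
    unfolding B_infinity_const_def by (rule SUP_upper2[of "(\<theta>, l)"]) (use assms in auto)
  then have "?I / mass w (carleson_box \<theta> l) * mass w (carleson_box \<theta> l) \<le> B_infinity_const w * mass w (carleson_box \<theta> l)"
    by (rule mult_right_mono) simp
  moreover have "?I / mass w (carleson_box \<theta> l) * mass w (carleson_box \<theta> l) = ?I"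
    using b(1,2) by (simp add: ennreal_divide_times ennreal_divide_self)
  ultimately show ?thesis by simp
qed

end

text \<open>On layer \<open>k\<close> the logarithm is at most
  \<open>ln (exp 1 + 16) + (k + 1) * ln (K 128)\<close>, hence at most \<open>k + 1\<close> times
  this factor.\<close>

definition LlogL_factor :: "real \<Rightarrow> real \<Rightarrow> real" where
  "LlogL_factor \<rho> C = ln (exp 1 + 16) + ln (C ^ layer_exponent \<rho> 128)"

lemma (in top_weight) LlogL_factor_pos: "0 < LlogL_factor \<rho> C"
proof -
  have "1 < exp (1::real) + 16" by (simp add: add_pos_pos less_add_same_cancel2)
  then have "0 < ln (exp (1::real) + 16)" by (rule ln_gt_zero)
  moreover have "0 \<le> ln (C ^ layer_exponent \<rho> 128)" using K_ge_1[of 128] unfolding K_def by (rule ln_ge_zero)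
  ultimately show ?thesis by (simp add: LlogL_factor_def)
qed

lemma (in top_weight) LlogL_of_B_infinity:
  assumes "B_infinity w"
  shows "LlogL_bound (16 * LlogL_factor \<rho> C * enn2real (B_infinity_const w)) w"
  unfolding LlogL_bound_def Let_def
proof (intro allI impI)
  fix \<theta> l :: real assume l: "arc_length l"
  let ?B = "carleson_box \<theta> l"
  define a where "a = \<theta> - l / 2"
  define Q where "Q = strip a l l"
  define c where "c = LlogL_factor \<rho> C"
  define N :: nat where "N = 128"
  have c: "0 < c" using LlogL_factor_pos by (simp add: c_def)
  have N: "128 \<le> N" "1 < N" by (auto simp: N_def)
  have l0: "0 < l" "l \<le> 2 * pi" using l by (auto simp: arc_length_def)
  note b = box_facts[OF l, of \<theta>, folded a_def, folded Q_def]
  define S where "S = (\<lambda>i. strip a l (l / real N ^ i))"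
  have [measurable]: "S i \<in> sets lebesgue" "Q \<in> sets lebesgue" for i
    unfolding S_def Q_def using strip_borel[OF l0(2)] by simp_all
  \<comment> \<open>The factor \<open>k + 1\<close> in the bound for the logarithm is at most the
    number of strips \<open>S i\<close> containing \<open>z\<close>; this turns the logarithm into a
    sum of indicators.\<close>
  have pt: "ennreal (w z * ln (exp 1 + w z * measure lebesgue ?B / enn2real (mass w ?B)))
      \<le> (\<Sum>i. ennreal (c * w z) * indicator (S i) z)" if z: "z \<in> Q" for z
  proof -
    have "z \<in> (\<Union>k. layer N a l k)" unfolding layer_UN[OF N(2) l0(1)] using z by (simp add: Q_def)
    then obtain k where k: "z \<in> layer N a l k" by blast
    let ?x = "w z * measure lebesgue Q / \<nu> Q"
    let ?K = "K N ^ Suc k"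
    have K1: "1 \<le> ?K" using K_ge_1[of N] by (rule one_le_power)
    have x: "?x \<le> 16 * ?K"
      using layer_upper[OF N(1) l k, folded Q_def] b(2,3) by (simp add: field_simps del: power_Suc)
    have x0: "0 < ?x" using b w_pos[of z] by simp
    have e: "0 < exp (1::real)" by simp
    \<comment> \<open>Since the power of \<open>K N\<close> is at least 1, the summand
      \<open>exp 1\<close> can be absorbed into the same power, which leaves a logarithm of a
      product.\<close>
    have "exp 1 \<le> exp (1::real) * ?K" using mult_left_mono[OF K1, of "exp 1"] by simp
    then have "exp 1 + ?x \<le> exp 1 * ?K + 16 * ?K" using x by linarith
    then have "ln (exp 1 + ?x) \<le> ln ((exp 1 + 16) * ?K)"
      using x0 e by (subst ln_le_cancel_iff) (auto simp: distrib_right add_pos_pos intro!: mult_pos_pos add_pos_pos simp del: power_Suc intro: less_le_trans[OF _ K1])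
    also have "\<dots> = ln (exp 1 + 16) + ln ?K"
      using K1 e by (intro ln_mult_pos) (auto simp: add_pos_pos simp del: power_Suc)
    also have "ln ?K = real (Suc k) * ln (K N)" by (rule ln_realpow)
    also have "ln (exp 1 + 16) + real (Suc k) * ln (K N) \<le> real (Suc k) * ln (exp (1::real) + 16) + real (Suc k) * ln (K N)"
    proof (rule add_right_mono)
      have "0 \<le> ln (exp (1::real) + 16)" using e by (intro ln_ge_zero) linarith
      then show "ln (exp 1 + 16) \<le> real (Suc k) * ln (exp (1::real) + 16)"
        using mult_right_mono[of 1 "real (Suc k)" "ln (exp (1::real) + 16)"] by simp
    qed
    also have "\<dots> = real (Suc k) * c" by (simp add: c_def LlogL_factor_def K_def N_def distrib_left)
    finally have "w z * ln (exp 1 + ?x) \<le> w z * (real (Suc k) * c)" using w_pos[of z] by (intro mult_left_mono) auto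
    then have "ennreal (w z * ln (exp 1 + ?x)) \<le> ennreal (c * w z) * ennreal (real (Suc k))"
      using w_pos[of z] c by (subst ennreal_mult'[symmetric]) (auto intro!: ennreal_leI simp: mult_ac simp del: of_nat_Suc)
    also have "\<dots> \<le> ennreal (c * w z) * (\<Sum>i. indicator (S i) z)"
      unfolding S_def by (intro mult_left_mono layer_count[OF N(2) l0(1) k]) simp
    also have "\<dots> = (\<Sum>i. ennreal (c * w z) * indicator (S i) z)" by simp
    finally show ?thesis using b by simp
  qed
  have "(\<integral>\<^sup>+ x \<in> ?B. ennreal (w x * ln (exp 1 + w x * measure lebesgue ?B / enn2real (mass w ?B))) \<partial>lebesgue)
     = (\<integral>\<^sup>+ x \<in> Q. ennreal (w x * ln (exp 1 + w x * measure lebesgue ?B / enn2real (mass w ?B))) \<partial>lebesgue)"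
    unfolding Q_def a_def by (rule nn_integral_carleson_box[OF l])
  also have "\<dots> \<le> (\<integral>\<^sup>+ x. (\<Sum>i. ennreal (c * w x) * indicator (S i) x) \<partial>lebesgue)"
    using pt by (intro nn_integral_mono) (auto split: split_indicator)
  also have "\<dots> = (\<Sum>i. \<integral>\<^sup>+ x. ennreal (c * w x) * indicator (S i) x \<partial>lebesgue)"
    by (intro nn_integral_suminf) measurable
  also have "\<dots> = (\<Sum>i. ennreal c * mass w (S i))"
    unfolding S_def using c l0 by (intro suminf_cong mass_strip_times_w) auto
  also have "\<dots> = ennreal c * (\<Sum>i. mass w (S i))" by simp
  also have "\<dots> \<le> ennreal c * (16 * (\<integral>\<^sup>+ z \<in> Q. carleson_maximal (\<lambda>x. w x * indicator ?B x) z \<partial>lebesgue))"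
    unfolding S_def Q_def a_def by (intro mult_left_mono sum_mass_strips_le_maximal N l) auto
  also have "(\<integral>\<^sup>+ z \<in> Q. carleson_maximal (\<lambda>x. w x * indicator ?B x) z \<partial>lebesgue)
      = (\<integral>\<^sup>+ z \<in> ?B. carleson_maximal (\<lambda>x. w x * indicator ?B x) z \<partial>lebesgue)"
    unfolding Q_def a_def by (rule nn_integral_carleson_box[OF l, symmetric])
  also have "ennreal c * (16 * \<dots>) \<le> ennreal c * (16 * (B_infinity_const w * mass w ?B))"
    by (intro mult_left_mono integral_maximal_le l) auto
  also have "B_infinity_const w = ennreal (enn2real (B_infinity_const w))"
    using assms by (simp add: B_infinity_def ennreal_enn2real)
  also have "ennreal c * (16 * (\<dots> * mass w ?B)) = ennreal (16 * c * enn2real (B_infinity_const w)) * mass w ?B"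
    using c by (simp add: ennreal_mult mult_ac)
  finally show "(\<integral>\<^sup>+ x \<in> ?B. ennreal (w x * ln (exp 1 + w x * measure lebesgue ?B / enn2real (mass w ?B))) \<partial>lebesgue)
     \<le> ennreal (16 * LlogL_factor \<rho> C * enn2real (B_infinity_const w)) * mass w ?B"
    by (simp add: c_def)
qed

section \<open>Absolute continuity from estimates of the tails\<close>

context disk_weight
begin

text \<open>The set \<open>\<Omega>\<close> is split where \<open>w\<close> passes
  \<open>\<kappa>\<close> times its mean: below this level the mass is at most the level times the
  area of \<open>\<Omega>\<close>, above it the tail estimate applies.\<close>

lemma small_measurable_sets_of_tails:
  assumes tails: "\<And>\<epsilon>. 0 < \<epsilon> \<Longrightarrow> \<exists>\<kappa>>0. \<forall>\<theta> l. arc_length l \<longrightarrow>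
    (\<integral>\<^sup>+ z \<in> {z \<in> carleson_box \<theta> l. \<kappa> * (\<nu> (strip (\<theta> - l / 2) l l) / measure lebesgue (strip (\<theta> - l / 2) l l)) < w z}.
       ennreal (w z) \<partial>lebesgue) \<le> ennreal (\<epsilon> * \<nu> (strip (\<theta> - l / 2) l l))"
  shows "small_measurable_sets w"
  unfolding small_measurable_sets_def
proof (intro allI impI)
  fix \<epsilon> :: real assume \<epsilon>: "0 < \<epsilon> \<and> \<epsilon> < 1"
  with tails[of "\<epsilon> / 4"] obtain \<kappa> where \<kappa>: "\<kappa> > 0" and tail: "\<And>\<theta> l. arc_length l \<Longrightarrow>
    (\<integral>\<^sup>+ z \<in> {z \<in> carleson_box \<theta> l. \<kappa> * (\<nu> (strip (\<theta> - l / 2) l l) / measure lebesgue (strip (\<theta> - l / 2) l l)) < w z}.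
       ennreal (w z) \<partial>lebesgue) \<le> ennreal (\<epsilon> / 4 * \<nu> (strip (\<theta> - l / 2) l l))"
    by auto
  show "\<exists>\<delta>>0. \<forall>\<theta> l \<Omega>. arc_length l \<and> \<Omega> \<in> sets lebesgue \<and> \<Omega> \<subseteq> carleson_box \<theta> l \<and>
      measure lebesgue \<Omega> / measure lebesgue (carleson_box \<theta> l) < \<delta> \<longrightarrow>
      mass w \<Omega> < ennreal \<epsilon> * mass w (carleson_box \<theta> l)"
  \<comment> \<open>With this bound on the area, and the tail estimate taken at
    \<open>\<epsilon> / 4\<close>, each part carries at most the fraction
    \<open>\<epsilon> / 4\<close>, which leaves room for the strict inequality.\<close>
  proof (intro exI[of _ "\<epsilon> / (4 * \<kappa>)"] conjI allI impI)
    show "0 < \<epsilon> / (4 * \<kappa>)" using \<epsilon> \<kappa> by simp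
    fix \<theta> l \<Omega>
    assume "arc_length l \<and> \<Omega> \<in> sets lebesgue \<and> \<Omega> \<subseteq> carleson_box \<theta> l \<and>
      measure lebesgue \<Omega> / measure lebesgue (carleson_box \<theta> l) < \<epsilon> / (4 * \<kappa>)"
    then have l: "arc_length l" and \<Omega>: "\<Omega> \<in> sets lebesgue" "\<Omega> \<subseteq> carleson_box \<theta> l"
      and small: "measure lebesgue \<Omega> / measure lebesgue (carleson_box \<theta> l) < \<epsilon> / (4 * \<kappa>)" by auto
    define Q where "Q = strip (\<theta> - l / 2) l l"
    note b = box_facts[OF l, of \<theta>, folded Q_def]
    define c where "c = \<kappa> * (\<nu> Q / measure lebesgue Q)"
    have c0: "0 < c" unfolding c_def using \<kappa> b(6) by (rule mult_pos_pos)
    have \<Omega>d: "\<Omega> \<subseteq> unit_disk" using \<Omega> carleson_box_subset_disk by blast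
    then have \<Omega>m: "\<Omega> \<in> lmeasurable" using \<Omega> bounded_set_imp_lmeasurable bounded_subset[OF bounded_ball] by blast
    define T where "T = {z \<in> carleson_box \<theta> l. c < w z}"
    have "T = carleson_box \<theta> l \<inter> {z \<in> space lebesgue. c < w z}" by (auto simp: T_def)
    moreover have "{z \<in> space lebesgue. c < w z} \<in> sets lebesgue" by measurable
    moreover have "carleson_box \<theta> l \<in> sets lebesgue" using carleson_box_borel[OF l, of \<theta>] by simp
    ultimately have [measurable]: "T \<in> sets lebesgue" by (metis sets.Int)
    have "mass w \<Omega> \<le> (\<integral>\<^sup>+ z. ennreal c * indicator \<Omega> z + ennreal (w z) * indicator T z \<partial>lebesgue)"
      unfolding mass_def
      using \<Omega>(2) c0 by (intro nn_integral_mono) (auto simp: T_def subset_iff ennreal_leI not_less split: split_indicator)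
    also have "\<dots> = ennreal c * emeasure lebesgue \<Omega> + (\<integral>\<^sup>+ z \<in> T. ennreal (w z) \<partial>lebesgue)"
      using \<Omega>(1) by (subst nn_integral_add) (auto simp: nn_integral_cmult_indicator)
    also have "\<dots> \<le> ennreal (c * measure lebesgue \<Omega>) + ennreal (\<epsilon> / 4 * \<nu> Q)"
    proof (rule add_mono)
      show "ennreal c * emeasure lebesgue \<Omega> \<le> ennreal (c * measure lebesgue \<Omega>)"
        using \<Omega>m c0 by (simp add: emeasure_eq_measure2 ennreal_mult)
      show "(\<integral>\<^sup>+ z \<in> T. ennreal (w z) \<partial>lebesgue) \<le> ennreal (\<epsilon> / 4 * \<nu> Q)"
        using tail[OF l, of \<theta>] unfolding T_def c_def Q_def .
    qed
    also have "\<dots> = ennreal (c * measure lebesgue \<Omega> + \<epsilon> / 4 * \<nu> Q)"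
      using c0 \<epsilon> by (simp add: ennreal_plus)
    also have "\<dots> < ennreal (\<epsilon> * \<nu> Q)"
    proof (rule ennreal_lessI)
      have "measure lebesgue \<Omega> < \<epsilon> / (4 * \<kappa>) * measure lebesgue Q" using small b(3,4) by (simp add: field_simps)
      then have "c * measure lebesgue \<Omega> < c * (\<epsilon> / (4 * \<kappa>) * measure lebesgue Q)" using c0 by (intro mult_strict_left_mono)
      also have "\<dots> = (\<epsilon> * \<nu> Q) / 4" using b(3) \<kappa> by (simp add: c_def)
      finally have "c * measure lebesgue \<Omega> < (\<epsilon> * \<nu> Q) / 4" .
      moreover have "\<epsilon> / 4 * \<nu> Q = (\<epsilon> * \<nu> Q) / 4" by simp
      moreover have "0 < \<epsilon> * \<nu> Q" using \<epsilon> b(2) by simp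
      ultimately show "c * measure lebesgue \<Omega> + \<epsilon> / 4 * \<nu> Q < \<epsilon> * \<nu> Q" by linarith
      show "0 < \<epsilon> * \<nu> Q" using \<epsilon> b(2) by simp
    qed
    also have "\<dots> = ennreal \<epsilon> * mass w (carleson_box \<theta> l)" using b \<epsilon> by (simp add: ennreal_mult)
    finally show "mass w \<Omega> < ennreal \<epsilon> * mass w (carleson_box \<theta> l)" .
  qed
qed

text \<open>Where \<open>w\<close> exceeds \<open>\<kappa>\<close> times its mean, the logarithm is
  at least \<open>ln \<kappa> = C / \<epsilon>\<close>, so the tail is at most
  \<open>\<epsilon> / C\<close> times the integral that is bounded by hypothesis.\<close>

lemma small_measurable_sets_of_LlogL:
  assumes C: "C > 0" and LL: "LlogL_bound C w"
  shows "small_measurable_sets w"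
proof (rule small_measurable_sets_of_tails)
  fix \<epsilon> :: real assume \<epsilon>: "0 < \<epsilon>"
  define \<kappa> where "\<kappa> = exp (C / \<epsilon>)"
  show "\<exists>\<kappa>>0. \<forall>\<theta> l. arc_length l \<longrightarrow>
    (\<integral>\<^sup>+ z \<in> {z \<in> carleson_box \<theta> l. \<kappa> * (\<nu> (strip (\<theta> - l / 2) l l) / measure lebesgue (strip (\<theta> - l / 2) l l)) < w z}.
       ennreal (w z) \<partial>lebesgue) \<le> ennreal (\<epsilon> * \<nu> (strip (\<theta> - l / 2) l l))"
  proof (intro exI[of _ \<kappa>] conjI allI impI)
    show "0 < \<kappa>" by (simp add: \<kappa>_def)
    fix \<theta> l assume l: "arc_length l"
    let ?B = "carleson_box \<theta> l"
    define Q where "Q = strip (\<theta> - l / 2) l l"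
    note b = box_facts[OF l, of \<theta>, folded Q_def]
    let ?L = "\<lambda>z. w z * ln (exp 1 + w z * measure lebesgue ?B / enn2real (mass w ?B))"
    have pt: "w z \<le> \<epsilon> / C * ?L z" if z: "\<kappa> * (\<nu> Q / measure lebesgue Q) < w z" for z
    proof -
      have "\<kappa> \<le> exp 1 + w z * measure lebesgue Q / \<nu> Q"
        using z b(2,3) by (simp add: field_simps add_increasing)
      then have "ln \<kappa> \<le> ln (exp 1 + w z * measure lebesgue Q / \<nu> Q)"
        by (subst ln_le_cancel_iff) (auto simp: \<kappa>_def intro: less_le_trans[rotated])
      then have "C / \<epsilon> \<le> ln (exp 1 + w z * measure lebesgue ?B / enn2real (mass w ?B))" using b by (simp add: \<kappa>_def)
      then have "w z * (\<epsilon> / C) * (C / \<epsilon>) \<le> w z * (\<epsilon> / C) * ln (exp 1 + w z * measure lebesgue ?B / enn2real (mass w ?B))"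
        using w_pos[of z] \<epsilon> C by (intro mult_left_mono) (auto simp: less_imp_le)
      then show ?thesis using \<epsilon> C by (simp add: mult_ac)
    qed
    have [measurable]: "?B \<in> sets lebesgue" using carleson_box_borel[OF l] by simp
    have "(\<integral>\<^sup>+ z \<in> {z \<in> ?B. \<kappa> * (\<nu> Q / measure lebesgue Q) < w z}. ennreal (w z) \<partial>lebesgue)
        \<le> (\<integral>\<^sup>+ z. ennreal (\<epsilon> / C) * (ennreal (?L z) * indicator ?B z) \<partial>lebesgue)"
    proof (rule nn_integral_mono)
      fix z
      show "ennreal (w z) * indicator {z \<in> ?B. \<kappa> * (\<nu> Q / measure lebesgue Q) < w z} z \<le> ennreal (\<epsilon> / C) * (ennreal (?L z) * indicator ?B z)"
        using pt[of z] \<epsilon> C by (auto simp: ennreal_mult'[symmetric] ennreal_leI split: split_indicator)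
    qed
    also have "\<dots> = ennreal (\<epsilon> / C) * (\<integral>\<^sup>+ z \<in> ?B. ennreal (?L z) \<partial>lebesgue)"
      by (intro nn_integral_cmult) measurable
    also have "\<dots> \<le> ennreal (\<epsilon> / C) * (ennreal C * mass w ?B)"
      using LL l unfolding LlogL_bound_def Let_def by (intro mult_left_mono) auto
    also have "\<dots> = ennreal (\<epsilon> * \<nu> Q)" using \<epsilon> C b by (simp add: ennreal_mult'[symmetric])
    finally show "(\<integral>\<^sup>+ z \<in> {z \<in> ?B. \<kappa> * (\<nu> (strip (\<theta> - l / 2) l l) / measure lebesgue (strip (\<theta> - l / 2) l l)) < w z}.
       ennreal (w z) \<partial>lebesgue) \<le> ennreal (\<epsilon> * \<nu> (strip (\<theta> - l / 2) l l))" unfolding Q_def .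
  qed
qed

text \<open>The \<open>a\<close>-th power is inverted. The finite bound excludes the value
  \<open>top\<close>, after which real powers apply.\<close>

lemma powr_mean_bound:
  assumes l: "arc_length l" and "0 < a" "0 \<le> y"
    and le: "ennreal_powr (mean g (carleson_box \<theta> l)) a \<le> ennreal y"
  shows "mass g (carleson_box \<theta> l) \<le> ennreal (y powr (1 / a) * measure lebesgue (strip (\<theta> - l / 2) l l))"
proof -
  let ?B = "carleson_box \<theta> l"
  define Q where "Q = strip (\<theta> - l / 2) l l"
  note b = box_facts[OF l, of \<theta>, folded Q_def]
  have fin: "mean g ?B \<noteq> top" using le by (auto simp: ennreal_powr_def top_unique)
  define x where "x = enn2real (mean g ?B)"
  have x: "mean g ?B = ennreal x" "0 \<le> x" using fin by (auto simp: x_def less_top)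
  have "x powr a \<le> y" using le fin assms x by (simp add: ennreal_powr_def)
  then have "(x powr a) powr (1 / a) \<le> y powr (1 / a)" using assms by (intro powr_mono2) auto
  then have xy: "x \<le> y powr (1 / a)" using x assms by (simp add: powr_powr)
  have em: "emeasure lebesgue ?B = ennreal (measure lebesgue Q)"
    using l unfolding emeasure_carleson_box[OF l] Q_def arc_length_def by (intro emeasure_strip) simp
  have "mass g ?B = mean g ?B * emeasure lebesgue ?B"
    unfolding mean_def em using b(3) by (simp add: ennreal_divide_times ennreal_divide_self)
  also have "\<dots> = ennreal (x * measure lebesgue Q)" using x by (simp add: em ennreal_mult)
  also have "\<dots> \<le> ennreal (y powr (1 / a) * measure lebesgue Q)" using xy by (intro ennreal_leI mult_right_mono) auto
  finally show ?thesis unfolding Q_def .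
qed

text \<open>Where \<open>w\<close> exceeds \<open>\<kappa> * f\<close>, with \<open>f\<close> its
  mean, \<open>w\<close> is at most \<open>(\<kappa> * f) powr - (r - 1) * w powr r\<close>;
  integration brings in the hypothesis.\<close>

lemma small_measurable_sets_of_reverse_Hoelder:
  assumes "reverse_Hoelder w"
  shows "small_measurable_sets w"
proof (rule small_measurable_sets_of_tails)
  obtain r C where r: "1 < r" and C: "0 < C" and rh: "\<And>\<theta> l. arc_length l \<Longrightarrow>
      ennreal_powr (mean (\<lambda>z. w z powr r) (carleson_box \<theta> l)) (1 / r) \<le> ennreal C * mean w (carleson_box \<theta> l)"
    using assms unfolding reverse_Hoelder_def by auto
  define s where "s = r - 1"
  have s: "0 < s" using r by (simp add: s_def)
  fix \<epsilon> :: real assume \<epsilon>: "0 < \<epsilon>"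
  \<comment> \<open>Solves \<open>C powr r * \<kappa> powr - s = \<epsilon>\<close>, the left side
    being the constant left after the reverse Hoelder bound is inserted.\<close>
  define \<kappa> where "\<kappa> = (C powr r / \<epsilon>) powr (1 / s)"
  have \<kappa>: "0 < \<kappa>" using C \<epsilon> by (simp add: \<kappa>_def)
  have \<kappa>s: "\<kappa> powr s = C powr r / \<epsilon>" using C \<epsilon> s by (simp add: \<kappa>_def powr_powr)
  show "\<exists>\<kappa>>0. \<forall>\<theta> l. arc_length l \<longrightarrow>
    (\<integral>\<^sup>+ z \<in> {z \<in> carleson_box \<theta> l. \<kappa> * (\<nu> (strip (\<theta> - l / 2) l l) / measure lebesgue (strip (\<theta> - l / 2) l l)) < w z}.
       ennreal (w z) \<partial>lebesgue) \<le> ennreal (\<epsilon> * \<nu> (strip (\<theta> - l / 2) l l))"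
  proof (intro exI[of _ \<kappa>] conjI allI impI \<kappa>)
    fix \<theta> l assume l: "arc_length l"
    let ?B = "carleson_box \<theta> l"
    define Q where "Q = strip (\<theta> - l / 2) l l"
    note b = box_facts[OF l, of \<theta>, folded Q_def]
    define f where "f = \<nu> Q / measure lebesgue Q"
    have f: "0 < f" using b by (simp add: f_def)
    define u where "u = (\<kappa> * f) powr - s"
    have pt: "w z \<le> u * w z powr r" if z: "\<kappa> * f < w z" for z
    proof -
      have "(\<kappa> * f) powr s \<le> w z powr s" using z \<kappa> f s by (intro powr_mono2) auto
      then have "1 \<le> u * w z powr s" unfolding u_def using \<kappa> f by (simp add: powr_minus field_simps)
      then have "w z * 1 \<le> w z * (u * w z powr s)" using w_pos[of z] by (intro mult_left_mono) auto
      also have "\<dots> = u * w z powr r" using w_pos[of z] by (simp add: s_def powr_diff)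
      finally show ?thesis by simp
    qed
    have [measurable]: "?B \<in> sets lebesgue" using carleson_box_borel[OF l] by simp
    have "(\<integral>\<^sup>+ z \<in> {z \<in> ?B. \<kappa> * f < w z}. ennreal (w z) \<partial>lebesgue)
        \<le> (\<integral>\<^sup>+ z. ennreal u * (ennreal (w z powr r) * indicator ?B z) \<partial>lebesgue)"
    proof (rule nn_integral_mono)
      fix z
      show "ennreal (w z) * indicator {z \<in> ?B. \<kappa> * f < w z} z \<le> ennreal u * (ennreal (w z powr r) * indicator ?B z)"
        using pt[of z] by (auto simp: ennreal_mult'[symmetric] u_def ennreal_leI split: split_indicator)
    qed
    also have "\<dots> = ennreal u * mass (\<lambda>z. w z powr r) ?B"
      unfolding mass_def by (intro nn_integral_cmult) measurable
    also have "\<dots> \<le> ennreal u * ennreal ((C * f) powr (1 / (1 / r)) * measure lebesgue Q)"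
    proof (intro mult_left_mono)
      have "ennreal_powr (mean (\<lambda>z. w z powr r) ?B) (1 / r) \<le> ennreal (C * f)"
        using rh[OF l, of \<theta>] C f unfolding b(5) f_def[symmetric] by (simp add: ennreal_mult)
      then show "mass (\<lambda>z. w z powr r) ?B \<le> ennreal ((C * f) powr (1 / (1 / r)) * measure lebesgue Q)"
        unfolding Q_def using r C f by (intro powr_mean_bound l) auto
    qed simp
    also have "\<dots> = ennreal (u * ((C * f) powr r * measure lebesgue Q))"
      by (simp add: ennreal_mult' u_def)
    also have "u * ((C * f) powr r * measure lebesgue Q) = \<epsilon> * \<nu> Q"
    proof -
      have "u = \<epsilon> / C powr r * f powr - s" using \<kappa> f \<kappa>s C \<epsilon> by (simp add: u_def powr_mult powr_minus field_simps)
      then have "u * ((C * f) powr r * measure lebesgue Q) = \<epsilon> * (f powr - s * f powr r) * measure lebesgue Q"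
        using C f by (simp add: powr_mult)
      also have "f powr - s * f powr r = f" using f by (simp add: powr_add[symmetric] s_def)
      finally show ?thesis using b by (simp add: f_def)
    qed
    finally show "(\<integral>\<^sup>+ z \<in> {z \<in> ?B. \<kappa> * (\<nu> (strip (\<theta> - l / 2) l l) / measure lebesgue (strip (\<theta> - l / 2) l l)) < w z}.
       ennreal (w z) \<partial>lebesgue) \<le> ennreal (\<epsilon> * \<nu> (strip (\<theta> - l / 2) l l))" unfolding f_def Q_def .
  qed
qed

end

section \<open>Decay of the mass near the boundary\<close>

text \<open>If \<open>m\<close> were larger than \<open>l\<close>, the first arc would contain an
  endpoint of the second, which that open arc omits.\<close>

lemma circle_arc_subset_length:
  assumes l: "arc_length l" and sub: "circle_arc \<phi> m \<subseteq> circle_arc \<theta> l" and m: "arc_length m"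
  shows "m \<le> l"
proof (rule ccontr)
  assume "\<not> m \<le> l"
  have l0: "0 < l" "l \<le> 2 * pi" "0 < m" using l m by (auto simp: arc_length_def)
  have "cis \<phi> \<in> circle_arc \<phi> m" unfolding circle_arc_def using l0 by (intro CollectI exI[of _ \<phi>]) auto
  then obtain \<alpha> where \<alpha>: "cis \<phi> = cis \<alpha>" "\<bar>\<theta> - \<alpha>\<bar> < l / 2" using sub by (auto simp: circle_arc_def)
  \<comment> \<open>The arc of length \<open>m > l\<close> around \<open>\<alpha>\<close> cannot fit
    between the endpoints \<open>\<theta> - l / 2\<close> and \<open>\<theta> + l / 2\<close>;
    \<open>\<beta>\<close> is an endpoint that it passes.\<close>
  define \<beta> where "\<beta> = (if \<theta> + l / 2 < \<alpha> + m / 2 then \<theta> + l / 2 else \<theta> - l / 2)"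
  have \<beta>: "\<bar>\<alpha> - \<beta>\<bar> < m / 2" using \<alpha>(2) \<open>\<not> m \<le> l\<close> l0 unfolding \<beta>_def abs_less_iff by (auto simp: field_simps)
  have "cis \<beta> = cis \<phi> * cis (\<beta> - \<alpha>)" by (simp add: \<alpha> cis_mult)
  then have "cis \<beta> = cis (\<phi> + (\<beta> - \<alpha>))" by (simp only: cis_mult)
  moreover have "\<bar>\<phi> - (\<phi> + (\<beta> - \<alpha>))\<bar> < m / 2" using \<beta> by (simp add: abs_minus_commute)
  ultimately have "cis \<beta> \<in> circle_arc \<phi> m" unfolding circle_arc_def by blast
  then obtain \<gamma> where \<gamma>: "cis \<beta> = cis \<gamma>" "\<bar>\<theta> - \<gamma>\<bar> < l / 2" using sub by (auto simp: circle_arc_def)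
  have "\<bar>\<beta> - \<gamma>\<bar> < 2 * pi" "\<beta> \<noteq> \<gamma>" using \<gamma>(2) l0 unfolding \<beta>_def abs_less_iff by (auto split: if_splits)
  then show False using cis_eq_close[OF \<gamma>(1)] by simp
qed

text \<open>Inclusion of the arcs settles the angles; the radii need \<open>m \<le> l\<close>, which
  has to be extracted from an inclusion of sets on the circle.\<close>

lemma carleson_box_subset_of_arc:
  assumes l: "arc_length l" and sub: "circle_arc \<phi> m \<subseteq> circle_arc \<theta> l" and m: "arc_length m"
  shows "carleson_box \<phi> m \<subseteq> carleson_box \<theta> l"
proof
  have ml: "m \<le> l" by (rule circle_arc_subset_length[OF l sub m])
  fix z assume "z \<in> carleson_box \<phi> m"
  then obtain r \<alpha> where z: "z = of_real r * cis \<alpha>" "0 \<le> r" "1 - m < r" "r < 1" "\<bar>\<phi> - \<alpha>\<bar> < m / 2"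
    by (auto simp: carleson_box_def)
  then have "cis \<alpha> \<in> circle_arc \<theta> l" using sub by (auto simp: circle_arc_def)
  then obtain \<beta> where "cis \<alpha> = cis \<beta>" "\<bar>\<theta> - \<beta>\<bar> < l / 2" by (auto simp: circle_arc_def)
  then show "z \<in> carleson_box \<theta> l"
    unfolding carleson_box_def using z ml by (intro CollectI exI[of _ r] exI[of _ \<beta>]) auto
qed

lemma small_box_unions_of_small_measurable_sets:
  assumes "small_measurable_sets w"
  shows "small_box_unions w"
  unfolding small_box_unions_def
proof (intro allI impI)
  fix \<epsilon> :: real assume "0 < \<epsilon> \<and> \<epsilon> < 1"
  then obtain \<delta> where \<delta>: "\<delta> > 0" and H: "\<And>\<theta> l \<Omega>. arc_length l \<Longrightarrow> \<Omega> \<in> sets lebesgue \<Longrightarrow> \<Omega> \<subseteq> carleson_box \<theta> l \<Longrightarrow>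
      measure lebesgue \<Omega> / measure lebesgue (carleson_box \<theta> l) < \<delta> \<Longrightarrow> mass w \<Omega> < ennreal \<epsilon> * mass w (carleson_box \<theta> l)"
    using assms unfolding small_measurable_sets_def by meson
  show "\<exists>\<delta>>0. \<forall>\<theta> l F.
        arc_length l \<and> countable F \<and> (\<forall>(\<phi>, m)\<in>F. arc_length m)
          \<and> disjoint_family_on (\<lambda>(\<phi>, m). circle_arc \<phi> m) F
          \<and> (\<Union>(\<phi>, m)\<in>F. circle_arc \<phi> m) \<subseteq> circle_arc \<theta> l
          \<and> measure lebesgue (\<Union>(\<phi>, m)\<in>F. carleson_box \<phi> m)
              / measure lebesgue (carleson_box \<theta> l) < \<delta>
        \<longrightarrow> mass w (\<Union>(\<phi>, m)\<in>F. carleson_box \<phi> m) < ennreal \<epsilon> * mass w (carleson_box \<theta> l)"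
  proof (intro exI[of _ \<delta>] conjI allI impI \<delta>, elim conjE)
    fix \<theta> l F
    assume l: "arc_length l" and F: "countable F" "\<forall>(\<phi>, m)\<in>F. arc_length m"
      and sub: "(\<Union>(\<phi>, m)\<in>F. circle_arc \<phi> m) \<subseteq> circle_arc \<theta> l"
      and small: "measure lebesgue (\<Union>(\<phi>, m)\<in>F. carleson_box \<phi> m) / measure lebesgue (carleson_box \<theta> l) < \<delta>"
    show "mass w (\<Union>(\<phi>, m)\<in>F. carleson_box \<phi> m) < ennreal \<epsilon> * mass w (carleson_box \<theta> l)"
    proof (rule H[OF l _ _ small])
      have "carleson_box \<phi> m \<in> sets lebesgue" if "(\<phi>, m) \<in> F" for \<phi> m
        using carleson_box_borel[of m \<phi>] F(2) that by auto
      then show "(\<Union>(\<phi>, m)\<in>F. carleson_box \<phi> m) \<in> sets lebesgue"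
        using F(1) by (intro sets.countable_UN') auto
      have "carleson_box \<phi> m \<subseteq> carleson_box \<theta> l" if "(\<phi>, m) \<in> F" for \<phi> m
        using carleson_box_subset_of_arc[OF l, of \<phi> m \<theta>] sub F(2) that by blast
      then show "(\<Union>(\<phi>, m)\<in>F. carleson_box \<phi> m) \<subseteq> carleson_box \<theta> l" by auto
    qed
  qed
qed

text \<open>The bound \<open>128 \<le> N\<close> is built in so that the area estimates for layers
  apply to the same \<open>N\<close>. Strips instead of boxes let the estimate be added over the
  arcs of a subdivision.\<close>

definition shallow_decay :: "(complex \<Rightarrow> real) \<Rightarrow> nat \<Rightarrow> real \<Rightarrow> bool" where
  "shallow_decay w N \<beta> \<longleftrightarrow> 128 \<le> N \<and> 0 < \<beta> \<and> \<beta> < 1 \<and>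
    (\<forall>a l. arc_length l \<longrightarrow> mass w (strip a l (l / real N)) \<le> ennreal \<beta> * mass w (strip a l l))"

lemma shallow_decayD:
  assumes "shallow_decay w N \<beta>"
  shows "128 \<le> N" "1 < N" "0 < \<beta>" "\<beta> < 1"
    "arc_length l \<Longrightarrow> mass w (strip a l (l / real N)) \<le> ennreal \<beta> * mass w (strip a l l)"
  using assms by (auto simp: shallow_decay_def)

text \<open>The upper bound \<open>2 * l * (l / N)\<close>, the lower bound \<open>l * s / 4\<close>
  and \<open>l \<le> 7 * s\<close> combine to \<open>56 = 2 * 7 * 4\<close>.\<close>

lemma measure_shallow_strip:
  assumes "0 < N" "arc_length l"
  shows "measure lebesgue (strip a l (l / real N)) \<le> 56 / real N * measure lebesgue (strip a l l)"
proof -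
  have l: "0 < l" "l \<le> 2 * pi" using assms by (auto simp: arc_length_def)
  define s where "s = min l 1"
  have s: "0 < s" "l \<le> 7 * s" using l pi_less_4 pi_approx by (auto simp: s_def min_def)
  have lN: "0 < l / real N" using l assms by simp
  have "measure lebesgue (strip a l (l / real N)) \<le> 2 * l * min (l / real N) 1"
    using measure_strip_bounds(2)[OF l lN] .
  also have "\<dots> \<le> 2 * l * (l / real N)" using l by (intro mult_left_mono) auto
  also have "\<dots> \<le> 2 * l * (7 * s / real N)" using l s by (intro mult_left_mono divide_right_mono) auto
  also have "\<dots> = 56 / real N * (l * s / 4)" by simp
  also have "\<dots> \<le> 56 / real N * measure lebesgue (strip a l l)"
    using measure_strip_bounds(1)[OF l l(1), of a] by (intro mult_left_mono) (auto simp: s_def)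
  finally show ?thesis .
qed

lemma (in disk_weight) shallow_decay_of_small_box_unions:
  assumes "small_box_unions w"
  shows "\<exists>N \<beta>. shallow_decay w N \<beta>"
proof -
  have "\<exists>\<delta>>0. \<forall>\<theta> l F.
        arc_length l \<and> countable F \<and> (\<forall>(\<phi>, m)\<in>F. arc_length m)
          \<and> disjoint_family_on (\<lambda>(\<phi>, m). circle_arc \<phi> m) F
          \<and> (\<Union>(\<phi>, m)\<in>F. circle_arc \<phi> m) \<subseteq> circle_arc \<theta> l
          \<and> measure lebesgue (\<Union>(\<phi>, m)\<in>F. carleson_box \<phi> m)
              / measure lebesgue (carleson_box \<theta> l) < \<delta>
        \<longrightarrow> mass w (\<Union>(\<phi>, m)\<in>F. carleson_box \<phi> m) < ennreal (1 / 2) * mass w (carleson_box \<theta> l)"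
    using assms unfolding small_box_unions_def by (elim allE[of _ "1 / 2"]) simp
  then obtain \<delta> where \<delta>: "\<delta> > 0" and H: "\<And>\<theta> l F. arc_length l \<Longrightarrow> countable F \<Longrightarrow> (\<forall>(\<phi>, m)\<in>F. arc_length m)
          \<Longrightarrow> disjoint_family_on (\<lambda>(\<phi>, m). circle_arc \<phi> m) F
          \<Longrightarrow> (\<Union>(\<phi>, m)\<in>F. circle_arc \<phi> m) \<subseteq> circle_arc \<theta> l
          \<Longrightarrow> measure lebesgue (\<Union>(\<phi>, m)\<in>F. carleson_box \<phi> m)
              / measure lebesgue (carleson_box \<theta> l) < \<delta>
        \<Longrightarrow> mass w (\<Union>(\<phi>, m)\<in>F. carleson_box \<phi> m) < ennreal (1 / 2) * mass w (carleson_box \<theta> l)"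
    by blast
  \<comment> \<open>Makes \<open>56 / N < \<delta>\<close>, so that the shallow strip is small
    enough for the hypothesis with \<open>\<epsilon> = 1 / 2\<close>.\<close>
  define N where "N = nat \<lceil>56 / \<delta>\<rceil> + 128"
  have "56 / \<delta> < real N" unfolding N_def by linarith
  moreover have "0 < real N" by (simp add: N_def)
  ultimately have N\<delta>: "56 / real N < \<delta>" using \<delta> by (simp add: field_simps)
  have N: "128 \<le> N" "1 < N" by (auto simp: N_def)
  have "mass w (strip a l (l / real N)) \<le> ennreal (1 / 2) * mass w (strip a l l)" if l: "arc_length l" for a l
  proof -
    have l0: "0 < l" "l \<le> 2 * pi" using l by (auto simp: arc_length_def)
    define h where "h = l / real N"
    define \<phi> where "\<phi> = (\<lambda>j. a + real j * h + h / 2)"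
    define \<theta> where "\<theta> = a + l / 2"
    have h: "arc_length h" "h \<le> l" "\<And>j. j < N \<Longrightarrow> a + real j * h + h \<le> a + l"
      using subarc(1,2)[OF N(2) l, of 0 1] subarc(4)[OF N(2) l, of _ 1 a] N by (auto simp: h_def)
    have h0: "0 < h" using h by (simp add: arc_length_def)
    define F where "F = (\<lambda>j. (\<phi> j, h)) ` {..<N}"
    have UF: "(\<Union>(\<phi>, m)\<in>F. S \<phi> m) = (\<Union>j<N. S (\<phi> j) h)" for S :: "real \<Rightarrow> real \<Rightarrow> complex set"
      by (simp add: F_def)
    have mem: "\<exists>\<alpha>. z = cis \<alpha> \<and> a + real j * h < \<alpha> \<and> \<alpha> < a + real j * h + h" if z: "z \<in> circle_arc (\<phi> j) h" for z j
    proof -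
      obtain \<alpha> where "z = cis \<alpha>" "\<bar>\<phi> j - \<alpha>\<bar> < h / 2" using z by (auto simp: circle_arc_def)
      then show ?thesis unfolding \<phi>_def abs_less_iff by (intro exI[of _ \<alpha>]) linarith
    qed
    have disj: "circle_arc (\<phi> i) h \<inter> circle_arc (\<phi> j) h = {}" if ij: "i < j" "j < N" for i j
    proof (rule ccontr)
      assume "\<not> ?thesis"
      then obtain z where z: "z \<in> circle_arc (\<phi> i) h" "z \<in> circle_arc (\<phi> j) h" by blast
      obtain \<alpha> where \<alpha>: "z = cis \<alpha>" "a + real i * h < \<alpha>" "\<alpha> < a + real i * h + h" using mem[OF z(1)] by blast
      obtain \<beta> where \<beta>: "z = cis \<beta>" "a + real j * h < \<beta>" "\<beta> < a + real j * h + h" using mem[OF z(2)] by blast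
      have "(real i + 1) * h \<le> real j * h" using ij h0 by (intro mult_right_mono) auto
      then have lt: "\<alpha> < \<beta>" using \<alpha> \<beta> by (simp add: distrib_right)
      have "0 \<le> real i * h" using h0 by simp
      then have "\<bar>\<alpha> - \<beta>\<bar> < 2 * pi" using h(3)[OF ij(2)] \<alpha> \<beta> lt l0 by linarith
      then show False using cis_eq_close[of \<alpha> \<beta>] \<alpha> \<beta> lt by simp
    qed
    have "AE z in lebesgue. \<forall>j\<in>{..<N}. z \<in> carleson_box (\<phi> j) h \<longleftrightarrow> z \<in> strip (a + real j * h) h h"
    proof (rule AE_finite_allI)
      fix j
      have "\<phi> j - h / 2 = a + real j * h" by (simp add: \<phi>_def)
      then show "AE z in lebesgue. z \<in> carleson_box (\<phi> j) h \<longleftrightarrow> z \<in> strip (a + real j * h) h h"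
        using AE_carleson_box_strip[OF h(1), of "\<phi> j"] by simp
    qed simp
    moreover have "strip a l h = (\<Union>j<N. strip (a + real j * h) h h)"
      unfolding strip_def h_def using sector_partition[OF l0(1), of N] N by simp
    \<comment> \<open>The union of the open boxes differs from the half-open strip by finitely many
      null sets.\<close>
    ultimately have AE: "AE z in lebesgue. z \<in> (\<Union>j<N. carleson_box (\<phi> j) h) \<longleftrightarrow> z \<in> strip a l h"
      by (auto elim!: eventually_mono)
    have "mass w (\<Union>(\<phi>, m)\<in>F. carleson_box \<phi> m) < ennreal (1 / 2) * mass w (carleson_box \<theta> l)"
    proof (rule H[OF l])
      show "countable F" "\<forall>(\<phi>, m)\<in>F. arc_length m" using h by (auto simp: F_def)
      show "disjoint_family_on (\<lambda>(\<phi>, m). circle_arc \<phi> m) F"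
        unfolding disjoint_family_on_def
      proof (intro ballI impI)
        fix p q assume "p \<in> F" "q \<in> F" "p \<noteq> q"
        then obtain i j where "p = (\<phi> i, h)" "q = (\<phi> j, h)" "i < N" "j < N" "i \<noteq> j" by (auto simp: F_def)
        then show "(case p of (\<phi>, m) \<Rightarrow> circle_arc \<phi> m) \<inter> (case q of (\<phi>, m) \<Rightarrow> circle_arc \<phi> m) = {}"
          using disj[of i j] disj[of j i] by (cases "i < j") auto
      qed
      show "(\<Union>(\<phi>, m)\<in>F. circle_arc \<phi> m) \<subseteq> circle_arc \<theta> l"
        unfolding UF
      proof (intro UN_least subsetI)
        fix j z assume j: "j \<in> {..<N}" and "z \<in> circle_arc (\<phi> j) h"
        then obtain \<alpha> where \<alpha>: "z = cis \<alpha>" "a + real j * h < \<alpha>" "\<alpha> < a + real j * h + h" using mem by blast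
        have "0 \<le> real j * h" using h0 by simp
        moreover have "a + real j * h + h \<le> a + l" using h(3) j by blast
        ultimately have "\<bar>\<theta> - \<alpha>\<bar> < l / 2" using \<alpha> unfolding \<theta>_def abs_less_iff by linarith
        then show "z \<in> circle_arc \<theta> l" using \<alpha>(1) by (auto simp: circle_arc_def)
      qed
      have "emeasure lebesgue (\<Union>j<N. carleson_box (\<phi> j) h) = emeasure lebesgue (strip a l h)"
      proof (rule emeasure_eq_AE[OF AE])
        show "(\<Union>j<N. carleson_box (\<phi> j) h) \<in> sets lebesgue" using carleson_box_borel[OF h(1)] by auto
        show "strip a l h \<in> sets lebesgue" using strip_borel[OF l0(2)] by simp
      qed
      then have "measure lebesgue (\<Union>(\<phi>, m)\<in>F. carleson_box \<phi> m) = measure lebesgue (strip a l h)"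
        unfolding UF by (simp add: measure_def)
      also have "\<dots> \<le> 56 / real N * measure lebesgue (strip a l l)"
        unfolding h_def using N l by (intro measure_shallow_strip) auto
      also have "measure lebesgue (strip a l l) = measure lebesgue (carleson_box \<theta> l)"
        using measure_carleson_box[OF l, of \<theta>] by (simp add: \<theta>_def)
      finally have "measure lebesgue (\<Union>(\<phi>, m)\<in>F. carleson_box \<phi> m) / measure lebesgue (carleson_box \<theta> l) \<le> 56 / real N"
        using measure_strip_pos[OF l0 l0(1), of a] measure_carleson_box[OF l, of \<theta>] by (simp add: \<theta>_def divide_le_eq)
      then show "measure lebesgue (\<Union>(\<phi>, m)\<in>F. carleson_box \<phi> m) / measure lebesgue (carleson_box \<theta> l) < \<delta>"
        using N\<delta> by linarith
    qed
    moreover have "mass w (strip a l h) \<le> mass w (\<Union>(\<phi>, m)\<in>F. carleson_box \<phi> m)"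
      unfolding mass_def UF by (rule nn_integral_mono_AE) (use AE in \<open>auto elim!: eventually_mono split: split_indicator\<close>)
    moreover have "mass w (carleson_box \<theta> l) = mass w (strip a l l)"
      using mass_carleson_box[OF l, of w \<theta>] by (simp add: \<theta>_def)
    ultimately show ?thesis unfolding h_def by (metis order_le_less_trans less_imp_le)
  qed
  then have "shallow_decay w N (1 / 2)" using N by (auto simp: shallow_decay_def)
  then show ?thesis by blast
qed

lemma carleson_box_lmeasurable: "arc_length l \<Longrightarrow> carleson_box \<theta> l \<in> lmeasurable"
  using bounded_subset[OF bounded_ball carleson_box_subset_disk] carleson_box_borel
  by (intro bounded_set_imp_lmeasurable) auto

lemma set_integral_const_lmeasurable:
  fixes c :: real
  assumes "A \<in> lmeasurable"
  shows "set_integrable lebesgue A (\<lambda>x. c)" "(LINT x:A|lebesgue. c) = c * measure lebesgue A"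
proof -
  have i: "integrable lebesgue (indicat_real A)" using assms by (simp add: lmeasurable_iff_integrable)
  then show "set_integrable lebesgue A (\<lambda>x. c)" unfolding set_integrable_def by (rule integrable_scaleR_left)
  have "(LINT x:A|lebesgue. c) = (LINT x|lebesgue. indicat_real A x) * c"
    unfolding set_lebesgue_integral_def using i by (simp add: integral_mult_left_zero)
  then show "(LINT x:A|lebesgue. c) = c * measure lebesgue A"
    using assms by (simp add: lmeasure_integral[symmetric] mult.commute)
qed

section \<open>The logarithmic condition: decay from it, and its proof from
  \<open>B_class\<close>\<close>

context disk_weight
begin

text \<open>The shallow strip \<open>E\<close> has at most a quarter of the area and the set
  \<open>A\<close> where \<open>w \<le> \<gamma> * f\<close> at most half, so at least a quarter
  remains. There \<open>w > \<gamma> * f\<close> almost everywhere, hence \<open>Q - E\<close>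
  carries at least the fraction \<open>\<gamma> / 4\<close> of the mass.\<close>

lemma shallow_decay_of_exp_log_bound:
  assumes "exp_log_bound w"
  shows "\<exists>N \<beta>. shallow_decay w N \<beta>"
proof -
  obtain C where C: "C > 0" and H: "\<And>\<theta> l. arc_length l \<Longrightarrow> set_integrable lebesgue (carleson_box \<theta> l) (\<lambda>x. ln (inverse (w x)))"
    "\<And>\<theta> l. arc_length l \<Longrightarrow> mean w (carleson_box \<theta> l) * ennreal (exp ((LINT x:carleson_box \<theta> l|lebesgue. ln (inverse (w x))) / measure lebesgue (carleson_box \<theta> l))) \<le> ennreal C"
    using assms unfolding exp_log_bound_def Let_def by auto
  \<comment> \<open>\<open>L / 2\<close> dominates \<open>ln C + 1\<close>, the bound found below
    for the mean of \<open>g\<close>, and the absolute value keeps \<open>L\<close> positive. On the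
    set where \<open>w \<le> \<gamma> * f\<close> one has \<open>g \<ge> L\<close>, so this set has
    at most half the area.\<close>
  define L where "L = 2 * (\<bar>ln C\<bar> + 1)"
  define \<gamma> where "\<gamma> = exp (- L)"
  have L: "2 * (ln C + 1) \<le> L" "0 < L" by (auto simp: L_def)
  have \<gamma>: "0 < \<gamma>" "\<gamma> < 1" using L by (auto simp: \<gamma>_def)
  \<comment> \<open>The estimate for shallow strips then gives
    \<open>56 / 224 = 1 / 4\<close>.\<close>
  define N :: nat where "N = 224"
  have N: "128 \<le> N" "1 < N" by (auto simp: N_def)
  have main: "mass w (strip a l (l / real N)) \<le> ennreal (1 - \<gamma> / 4) * mass w (strip a l l)" if l: "arc_length l" for a l
  proof -
    have l0: "0 < l" "l \<le> 2 * pi" using l by (auto simp: arc_length_def)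
    define \<theta> where "\<theta> = a + l / 2"
    have a: "a = \<theta> - l / 2" by (simp add: \<theta>_def)
    let ?B = "carleson_box \<theta> l"
    define Q where "Q = strip a l l"
    define E where "E = strip a l (l / real N)"
    note b = box_facts[OF l, of \<theta>, folded a, folded Q_def]
    define M where "M = measure lebesgue Q"
    define f where "f = \<nu> Q / M"
    have M: "0 < M" and f: "0 < f" using b by (auto simp: M_def f_def)
    have lN: "0 < l / real N" "l / real N \<le> l" using l0 N by (auto simp: divide_le_eq)
    have E1: "E \<in> lmeasurable" unfolding E_def by (rule strip_lmeasurable[OF l0(2)])
    have E2: "E \<subseteq> Q" unfolding E_def Q_def strip_def using lN by (intro sector_mono) auto
    have E3: "E \<subseteq> unit_disk" unfolding E_def by (rule strip_subset_disk)
    note E = E1 E2 E3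
    have EM: "measure lebesgue E \<le> M / 4"
      using measure_shallow_strip[of N l a] N l by (simp add: E_def M_def Q_def N_def)
    have Bm: "?B \<in> sets lebesgue" using carleson_box_borel[OF l] by simp
    have Bfin: "emeasure lebesgue ?B = ennreal M"
      using emeasure_carleson_box[OF l, of \<theta>] emeasure_strip[OF l0(2), of a l] by (simp add: a[symmetric] M_def Q_def)
    define I where "I = (LINT x:?B|lebesgue. ln (inverse (w x)))"
    have "ennreal (f * exp (I / M)) \<le> ennreal C"
      using H(2)[OF l, of \<theta>] f unfolding b(4,5) I_def[symmetric] f_def[unfolded M_def, symmetric] M_def
      by (subst ennreal_mult) auto
    then have "f * exp (I / M) \<le> C" using C by simp
    then have "ln (f * exp (I / M)) \<le> ln C" using f C by (subst ln_le_cancel_iff) auto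
    then have "ln f + I / M \<le> ln C" using f by (simp add: ln_mult)
    then have IM: "ln f * M + I \<le> ln C * M" using M by (simp add: field_simps)
    \<comment> \<open>The logarithm of \<open>f / w\<close> changes sign; the added term
      \<open>w / f\<close> has integral \<open>M\<close>, which costs only the \<open>+ 1\<close> in
      the bound for the mean.\<close>
    define g where "g = (\<lambda>x. ln f + ln (inverse (w x)) + w x / f)"
    have g0: "0 \<le> g x" for x
    proof -
      have "ln (w x / f) \<le> w x / f - 1" using w_pos[of x] f by (intro ln_le_minus_one) auto
      then show ?thesis using w_pos[of x] f by (simp add: g_def ln_div ln_inverse)
    qed
    have wint: "set_integrable lebesgue ?B w" "(LINT x:?B|lebesgue. w x) = \<nu> Q"
    proof -
      have nn: "(\<integral>\<^sup>+ x. ennreal (indicator ?B x *\<^sub>R w x) \<partial>lebesgue) = ennreal (\<nu> Q)"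
        unfolding b(1)[symmetric] mass_def by (intro nn_integral_cong) (auto split: split_indicator)
      have i: "integrable lebesgue (\<lambda>x. indicator ?B x *\<^sub>R w x)"
        by (rule integrableI_nonneg) (use Bm nn w_pos in \<open>auto simp: less_imp_le\<close>)
      then show "set_integrable lebesgue ?B w" by (simp add: set_integrable_def)
      show "(LINT x:?B|lebesgue. w x) = \<nu> Q" unfolding set_lebesgue_integral_def
        by (rule integral_eq_nn_integral[THEN trans]) (use Bm nn w_pos in \<open>auto simp: less_imp_le\<close>)
    qed
    have cint: "set_integrable lebesgue ?B (\<lambda>x. ln f)" "(LINT x:?B|lebesgue. ln f) = ln f * M"
      using set_integral_const_lmeasurable[OF carleson_box_lmeasurable[OF l, of \<theta>]] b(4) by (auto simp: M_def)
    have gint: "set_integrable lebesgue ?B g"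
      unfolding g_def using cint(1) H(1)[OF l, of \<theta>] wint(1) by (intro set_integral_add(1) set_integrable_divide) auto
    have "(LINT x:?B|lebesgue. g x) = ln f * M + I + \<nu> Q / f"
      unfolding g_def I_def using cint H(1)[OF l, of \<theta>] wint
      by (subst set_integral_add(2) | intro set_integral_add(1) set_integrable_divide | simp)+
    also have "\<nu> Q / f = M" using b M by (simp add: f_def M_def)
    finally have gI: "(LINT x:?B|lebesgue. g x) \<le> (ln C + 1) * M" using IM by (simp add: distrib_right)
    define A where "A = {x \<in> ?B. w x \<le> \<gamma> * f}"
    have "A = ?B \<inter> {x \<in> space lebesgue. w x \<le> \<gamma> * f}" by (auto simp: A_def)
    moreover have "{x \<in> space lebesgue. w x \<le> \<gamma> * f} \<in> sets lebesgue" by measurable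
    ultimately have Am: "A \<in> sets lebesgue" using Bm by (metis sets.Int)
    have Ad: "A \<subseteq> unit_disk" using carleson_box_subset_disk by (auto simp: A_def)
    then have Al: "A \<in> lmeasurable" using Am bounded_set_imp_lmeasurable bounded_subset[OF bounded_ball] by blast
    have "ennreal (L * measure lebesgue A) = (\<integral>\<^sup>+ x. ennreal L * indicator A x \<partial>lebesgue)"
      using Al L by (simp add: nn_integral_cmult_indicator fmeasurableD emeasure_eq_measure2 ennreal_mult)
    also have "\<dots> \<le> (\<integral>\<^sup>+ x. ennreal (indicator ?B x *\<^sub>R g x) \<partial>lebesgue)"
    proof (rule nn_integral_mono)
      fix x
      show "ennreal L * indicator A x \<le> ennreal (indicator ?B x *\<^sub>R g x)"
      proof (cases "x \<in> A")
        case True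
        then have x: "x \<in> ?B" "w x \<le> \<gamma> * f" by (auto simp: A_def)
        have "ln (w x) \<le> ln (\<gamma> * f)" using x w_pos[of x] \<gamma> f by (subst ln_le_cancel_iff) auto
        also have "\<dots> = - L + ln f" using \<gamma> f by (simp add: ln_mult \<gamma>_def)
        finally have "L \<le> g x" using w_pos[of x] f by (simp add: g_def ln_inverse add_increasing2)
        then show ?thesis using True x by (simp add: ennreal_leI)
      qed simp
    qed
    also have "\<dots> = ennreal (LINT x:?B|lebesgue. g x)"
      unfolding set_lebesgue_integral_def using gint g0
      by (intro nn_integral_eq_integral) (auto simp: set_integrable_def)
    finally have "L * measure lebesgue A \<le> (LINT x:?B|lebesgue. g x)"
      using L g0 by (subst (asm) ennreal_le_iff) (auto simp: set_lebesgue_integral_def intro!: integral_nonneg_AE)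
    also have "\<dots> \<le> (ln C + 1) * M" by (rule gI)
    also have "\<dots> \<le> L / 2 * M" using L M by (intro mult_right_mono) auto
    finally have "L * measure lebesgue A \<le> L * (M / 2)" by simp
    then have AM: "measure lebesgue A \<le> M / 2" using L(2) by (simp only: mult_le_cancel_left_pos)
    have Gm: "Q - E - A \<in> lmeasurable" using b(7) E(1) Al by (intro fmeasurable_Diff) auto
    have "M \<le> measure lebesgue (Q - E - A) + measure lebesgue E + measure lebesgue A"
    proof -
      have "measure lebesgue Q \<le> measure lebesgue ((Q - E - A) \<union> (E \<union> A))"
        using Gm E(1) Al b(7) by (intro measure_mono_fmeasurable fmeasurable.Un) auto
      also have "\<dots> \<le> measure lebesgue (Q - E - A) + measure lebesgue (E \<union> A)"
        using Gm E(1) Al by (intro measure_Un_le) auto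
      also have "measure lebesgue (E \<union> A) \<le> measure lebesgue E + measure lebesgue A"
        using E(1) Al by (intro measure_Un_le) auto
      finally show ?thesis by (simp add: M_def)
    qed
    then have G4: "M / 4 \<le> measure lebesgue (Q - E - A)" using EM AM by linarith
    have "AE x in lebesgue. x \<in> ?B \<longleftrightarrow> x \<in> Q"
      unfolding Q_def using AE_carleson_box_strip[OF l, of \<theta>] by (simp add: a[symmetric])
    \<comment> \<open>\<open>A\<close> is cut out of the open box but \<open>Q\<close> is the
      half-open strip, so the inequality may fail on their null difference.\<close>
    then have "AE x in lebesgue. ennreal (\<gamma> * f) * indicator (Q - E - A) x \<le> ennreal (w x) * indicator (Q - E) x"
      by (rule eventually_mono) (auto simp: A_def ennreal_leI split: split_indicator)
    then have "(\<integral>\<^sup>+ x. ennreal (\<gamma> * f) * indicator (Q - E - A) x \<partial>lebesgue) \<le> mass w (Q - E)"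
      unfolding mass_def by (rule nn_integral_mono_AE)
    moreover have GE: "mass w (Q - E) = ennreal (\<nu> (Q - E))" using b(8) by (intro mass_eq_\<nu>) blast
    ultimately have "ennreal (\<gamma> * f * measure lebesgue (Q - E - A)) \<le> ennreal (\<nu> (Q - E))"
      using Gm \<gamma> f GE
      by (auto simp: nn_integral_cmult_indicator fmeasurableD emeasure_eq_measure2 ennreal_mult)
    then have "\<gamma> * f * measure lebesgue (Q - E - A) \<le> \<nu> (Q - E)" by simp
    moreover have "\<gamma> * f * (M / 4) \<le> \<gamma> * f * measure lebesgue (Q - E - A)" using G4 \<gamma> f by (intro mult_left_mono) auto
    moreover have "\<gamma> * f * (M / 4) = \<gamma> / 4 * \<nu> Q" using M by (simp add: f_def)
    moreover have "\<nu> Q = \<nu> E + \<nu> (Q - E)"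
      using \<nu>_Un[of E "Q - E"] E b(7,8) by (simp add: fmeasurableD Un_absorb1 sets.Diff)
    ultimately have "\<gamma> / 4 * \<nu> Q \<le> \<nu> (Q - E)" "\<nu> Q = \<nu> E + \<nu> (Q - E)" by linarith+
    moreover have "(1 - \<gamma> / 4) * \<nu> Q = \<nu> Q - \<gamma> / 4 * \<nu> Q" by (simp add: left_diff_distrib)
    ultimately have "\<nu> E \<le> (1 - \<gamma> / 4) * \<nu> Q" by linarith
    then have "ennreal (\<nu> E) \<le> ennreal (1 - \<gamma> / 4) * ennreal (\<nu> Q)"
      using \<gamma> by (subst ennreal_mult[symmetric]) (auto intro: ennreal_leI)
    then show ?thesis using mass_eq_\<nu>[OF E(3)] mass_eq_\<nu>[OF b(8)] by (simp add: E_def Q_def)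
  qed
  have "shallow_decay w N (1 - \<gamma> / 4)"
    unfolding shallow_decay_def using N \<gamma> main by auto
  then show ?thesis by blast
qed

text \<open>Jensen's inequality for \<open>u = w powr - s\<close> with
  \<open>s = 1 / (p - 1)\<close>: the mean of \<open>ln (1 / w)\<close> is at most
  \<open>ln m / s\<close>, where \<open>m\<close> is the mean of \<open>u\<close>, and
  \<open>exp (ln m / s) = m powr (p - 1)\<close> is the second factor in
  \<open>B_const\<close>.\<close>

lemma exp_log_bound_of_B_class:
  assumes p: "1 < p" and Bp: "B_class p w"
  shows "exp_log_bound w"
proof -
  define s where "s = 1 / (p - 1)"
  have s: "0 < s" using p by (simp add: s_def)
  have ps: "1 - p / (p - 1) = - s" using p by (simp add: s_def field_simps)
  define C where "C = enn2real (B_const p w)"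
  have Ctop: "B_const p w = ennreal C" using Bp by (simp add: B_class_def C_def ennreal_enn2real)
  have C0: "0 \<le> C" by (simp add: C_def)
  have H: "mean w (carleson_box \<theta> l) * ennreal_powr (mean (\<lambda>z. w z powr - s) (carleson_box \<theta> l)) (p - 1) \<le> ennreal C"
    if "arc_length l" for \<theta> l
    unfolding Ctop[symmetric] B_const_def ps by (rule SUP_upper2[of "(\<theta>, l)"]) (use that in auto)
  show ?thesis
    unfolding exp_log_bound_def Let_def
  proof (intro exI[of _ "C + 1"] conjI allI impI)
    show "0 < C + 1" using C0 by simp
    fix \<theta> l assume l: "arc_length l"
    have l0: "0 < l" "l \<le> 2 * pi" using l by (auto simp: arc_length_def)
    let ?B = "carleson_box \<theta> l"
    define Q where "Q = strip (\<theta> - l / 2) l l"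
    note b = box_facts[OF l, of \<theta>, folded Q_def]
    define M where "M = measure lebesgue Q"
    define f where "f = \<nu> Q / M"
    have M: "0 < M" and f: "0 < f" using b by (auto simp: M_def f_def)
    have Bm: "?B \<in> sets lebesgue" using carleson_box_borel[OF l] by simp
    have Bfin: "emeasure lebesgue ?B = ennreal M"
      using emeasure_carleson_box[OF l, of \<theta>] emeasure_strip[OF l0(2), of "\<theta> - l / 2" l] by (simp add: M_def Q_def)
    define u where "u = (\<lambda>z. w z powr - s)"
    have u: "0 < u z" for z using w_pos[of z] by (simp add: u_def)
    have [measurable]: "u \<in> borel_measurable lebesgue" unfolding u_def by measurable
    have le: "ennreal f * ennreal_powr (mean u ?B) (p - 1) \<le> ennreal C"
      using H[OF l, of \<theta>] unfolding b(5) u_def f_def M_def .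
    have fin: "mean u ?B \<noteq> top"
    proof
      assume "mean u ?B = top"
      then have "ennreal f * top \<le> ennreal C" using le by (simp add: ennreal_powr_def)
      then show False using f by (simp add: ennreal_mult_top top_unique)
    qed
    define m where "m = enn2real (mean u ?B)"
    have m: "mean u ?B = ennreal m" using fin by (simp add: m_def less_top)
    have mass_u: "mass u ?B = ennreal (m * M)"
    proof -
      have "mass u ?B = mean u ?B * emeasure lebesgue ?B"
        unfolding mean_def Bfin using M by (simp add: ennreal_divide_times ennreal_divide_self)
      moreover have "0 \<le> m" by (simp add: m_def)
      ultimately show ?thesis using M unfolding m Bfin by (simp add: ennreal_mult)
    qed
    have "mass u ?B \<noteq> 0"
    proof
      assume "mass u ?B = 0"
      then have "AE z in lebesgue. ennreal (u z) * indicator ?B z = 0"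
        unfolding mass_def using Bm by (subst (asm) nn_integral_0_iff_AE) auto
      moreover have "ennreal (u z) * indicator ?B z = 0 \<longleftrightarrow> z \<notin> ?B" for z
        using u[of z] by (simp add: indicator_def ennreal_eq_0_iff not_le)
      ultimately have "AE z in lebesgue. z \<notin> ?B" by simp
      then have "emeasure lebesgue ?B = 0" using AE_iff_measurable[OF Bm, of "\<lambda>z. z \<notin> ?B"] by simp
      then show False using M by (simp add: Bfin)
    qed
    then have m0: "0 < m" using M m_def by (cases "m = 0") (auto simp: mass_u less_le)
    have pp: "p - 1 = 1 / s" using s p by (simp add: s_def)
    have fm: "f * m powr (1 / s) \<le> C"
      using le f m0 C0 fin unfolding pp by (simp add: ennreal_powr_def m ennreal_mult'[symmetric])
    have uint: "set_integrable lebesgue ?B u" "(LINT x:?B|lebesgue. u x) = m * M"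
    proof -
      have nn: "(\<integral>\<^sup>+ x. ennreal (indicator ?B x *\<^sub>R u x) \<partial>lebesgue) = ennreal (m * M)"
        unfolding mass_u[symmetric] mass_def by (intro nn_integral_cong) (auto split: split_indicator)
      have i: "integrable lebesgue (\<lambda>x. indicator ?B x *\<^sub>R u x)"
        by (rule integrableI_nonneg) (use Bm nn u in \<open>auto simp: less_imp_le\<close>)
      then show "set_integrable lebesgue ?B u" by (simp add: set_integrable_def)
      show "(LINT x:?B|lebesgue. u x) = m * M" unfolding set_lebesgue_integral_def
        by (rule integral_eq_nn_integral[THEN trans]) (use Bm nn u m0 M in \<open>auto simp: less_imp_le\<close>)
    qed
    have wint: "set_integrable lebesgue ?B w"
    proof -
      have nn: "(\<integral>\<^sup>+ x. ennreal (indicator ?B x *\<^sub>R w x) \<partial>lebesgue) = ennreal (\<nu> Q)"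
        unfolding b(1)[symmetric] mass_def by (intro nn_integral_cong) (auto split: split_indicator)
      have i: "integrable lebesgue (\<lambda>x. indicator ?B x *\<^sub>R w x)"
        by (rule integrableI_nonneg) (use Bm nn w_pos in \<open>auto simp: less_imp_le\<close>)
      then show "set_integrable lebesgue ?B w" by (simp add: set_integrable_def)
    qed
    have lnu: "ln (inverse (w x)) = ln (u x) / s" for x
      using w_pos[of x] s by (simp add: u_def ln_powr ln_inverse)
    \<comment> \<open>The tangent of the logarithm at \<open>m\<close> lies above it; the integral
      of this inequality over the box is Jensen's inequality.\<close>
    have up: "ln (inverse (w x)) \<le> (u x / m - 1 + ln m) / s" for x
    proof -
      have "ln (u x / m) \<le> u x / m - 1" using u[of x] m0 by (intro ln_le_minus_one) auto
      then have "ln (u x) \<le> u x / m - 1 + ln m" using u[of x] m0 by (simp add: ln_div)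
      then show ?thesis using s unfolding lnu by (intro divide_right_mono) auto
    qed
    \<comment> \<open>Together with the integrable upper bound this lower bound makes the logarithm
      absolutely integrable, as \<open>exp_log_bound\<close> demands.\<close>
    have lo: "- w x \<le> ln (inverse (w x))" for x
      using ln_le_minus_one[OF w_pos[of x]] w_pos[of x] by (simp add: ln_inverse)
    have cint: "set_integrable lebesgue ?B (\<lambda>x. c)" "(LINT x:?B|lebesgue. c) = c * M" for c :: real
      using set_integral_const_lmeasurable[OF carleson_box_lmeasurable[OF l, of \<theta>]] b(4) by (auto simp: M_def)
    define h where "h = (\<lambda>x. u x * (1 / (m * s)) + (ln m - 1) / s)"
    have up': "ln (inverse (w x)) \<le> h x" for x
      using up[of x] m0 s by (simp add: h_def field_simps)
    have hint: "set_integrable lebesgue ?B h" "(LINT x:?B|lebesgue. h x) = ln m / s * M"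
    proof -
      have 1: "set_integrable lebesgue ?B (\<lambda>x. u x * (1 / (m * s)))" using uint(1) by (rule set_integrable_mult_left)
      show "set_integrable lebesgue ?B h" unfolding h_def by (intro set_integral_add(1) 1 cint)
      have "(LINT x:?B|lebesgue. h x) = (LINT x:?B|lebesgue. u x * (1 / (m * s))) + (ln m - 1) / s * M"
        unfolding h_def by (subst set_integral_add(2)[OF 1 cint(1)]) (simp only: cint(2))
      also have "(LINT x:?B|lebesgue. u x * (1 / (m * s))) = m * M * (1 / (m * s))"
        by (simp only: set_integral_mult_left uint(2))
      finally show "(LINT x:?B|lebesgue. h x) = ln m / s * M" using m0 s by (simp add: field_simps)
    qed
    show lint: "set_integrable lebesgue ?B (\<lambda>x. ln (inverse (w x)))"
      unfolding set_integrable_def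
    proof (rule Bochner_Integration.integrable_bound)
      show "integrable lebesgue (\<lambda>x. indicator ?B x *\<^sub>R (\<bar>h x\<bar> + w x))"
        using set_integral_add(1)[OF set_integrable_abs[OF hint(1)] wint] by (simp add: set_integrable_def)
      show "(\<lambda>x. indicator ?B x *\<^sub>R ln (inverse (w x))) \<in> borel_measurable lebesgue" using Bm by measurable
      have "\<bar>ln (inverse (w x))\<bar> \<le> \<bar>h x\<bar> + w x" for x using up'[of x] lo[of x] w_pos[of x] by linarith
      then show "AE x in lebesgue. norm (indicator ?B x *\<^sub>R ln (inverse (w x))) \<le> norm (indicator ?B x *\<^sub>R (\<bar>h x\<bar> + w x))"
        by (intro AE_I2) (auto split: split_indicator intro: order_trans[OF _ abs_ge_self])
    qed
    have "(LINT x:?B|lebesgue. ln (inverse (w x))) \<le> ln m / s * M"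
      unfolding hint(2)[symmetric] using up' by (intro set_integral_mono lint hint(1)) auto
    then have "(LINT x:?B|lebesgue. ln (inverse (w x))) / M \<le> ln m / s" using M by (simp add: divide_le_eq)
    then have "exp ((LINT x:?B|lebesgue. ln (inverse (w x))) / M) \<le> exp (ln m / s)" by simp
    also have "\<dots> = m powr (1 / s)" using m0 by (simp add: powr_def)
    finally have "f * exp ((LINT x:?B|lebesgue. ln (inverse (w x))) / M) \<le> f * m powr (1 / s)"
      using f by (intro mult_left_mono) auto
    then have "f * exp ((LINT x:?B|lebesgue. ln (inverse (w x))) / M) \<le> C + 1" using fm by linarith
    then show "mean w ?B * ennreal (exp ((LINT x:?B|lebesgue. ln (inverse (w x))) / measure lebesgue ?B)) \<le> ennreal (C + 1)"
      unfolding b(4,5) f_def[symmetric] M_def[symmetric] using f by (subst ennreal_mult[symmetric]) (auto intro: ennreal_leI simp: f_def M_def)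
  qed
qed

end

section \<open>Geometric decay, reverse Hoelder and \<open>B_class\<close>\<close>

context disk_weight
begin

text \<open>The decay is applied to every box of generation \<open>k\<close> and added up, which
  gains a factor \<open>\<beta>\<close> whenever the depth is divided by \<open>N\<close>.\<close>

lemma mass_strip_decay:
  assumes d: "shallow_decay w N \<beta>" and l: "arc_length l"
  shows "mass w (strip a l (l / real N ^ k)) \<le> ennreal (\<beta> ^ k) * mass w (strip a l l)"
proof (induction k)
  case (Suc k)
  note D = shallow_decayD[OF d]
  have l0: "0 < l" "l \<le> 2 * pi" using l by (auto simp: arc_length_def)
  define h where "h = l / real N ^ k"
  have e: "l / real N ^ Suc k = h / real N" by (simp add: h_def mult.commute)
  have "mass w (strip a l (h / real N)) = (\<Sum>j<N ^ k. mass w (strip (a + real j * h) h (h / real N)))"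
    unfolding mass_def h_def by (rule strip_partition_nn_integral[OF D(2) l0]) simp
  also have "\<dots> \<le> (\<Sum>j<N ^ k. ennreal \<beta> * mass w (strip (a + real j * h) h h))"
  proof (rule sum_mono)
    fix j assume "j \<in> {..<N ^ k}"
    then show "mass w (strip (a + real j * h) h (h / real N)) \<le> ennreal \<beta> * mass w (strip (a + real j * h) h h)"
      using subarc(1)[OF D(2) l, of j k] unfolding h_def by (intro D(5)) auto
  qed
  also have "\<dots> = ennreal \<beta> * (\<Sum>j<N ^ k. mass w (strip (a + real j * h) h h))" by (simp add: sum_distrib_left)
  also have "(\<Sum>j<N ^ k. mass w (strip (a + real j * h) h h)) = mass w (strip a l h)"
    unfolding mass_def h_def by (rule strip_partition_nn_integral[OF D(2) l0, symmetric]) simp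
  also have "ennreal \<beta> * mass w (strip a l h) \<le> ennreal \<beta> * (ennreal (\<beta> ^ k) * mass w (strip a l l))"
    using Suc.IH unfolding h_def by (intro mult_left_mono) auto
  also have "\<dots> = ennreal (\<beta> ^ Suc k) * mass w (strip a l l)"
    using D(3) by (simp add: ennreal_mult mult.assoc)
  finally show ?case unfolding e .
qed simp

lemma nn_integral_layers_geometric:
  assumes N: "1 < N" and l: "arc_length l" and f: "f \<in> borel_measurable lebesgue"
    and A: "0 \<le> A" "0 \<le> x" "x < 1"
    and le: "\<And>k. (\<integral>\<^sup>+ z \<in> layer N a l k. f z \<partial>lebesgue) \<le> ennreal (A * x ^ k)"
  shows "(\<integral>\<^sup>+ z \<in> strip a l l. f z \<partial>lebesgue) \<le> ennreal (A / (1 - x))"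
proof -
  have "(\<lambda>k. A * x ^ k) sums (A * (1 / (1 - x)))" using A by (intro sums_mult geometric_sums) auto
  then have "(\<Sum>k. ennreal (A * x ^ k)) = ennreal (A / (1 - x))"
    using A by (intro suminf_ennreal_eq) auto
  moreover have "(\<integral>\<^sup>+ z \<in> strip a l l. f z \<partial>lebesgue) \<le> (\<Sum>k. ennreal (A * x ^ k))"
    using l unfolding arc_length_def by (subst nn_integral_layers[OF N _ _ f]) (auto intro!: suminf_le le)
  ultimately show ?thesis by simp
qed

lemma powr_mean_le:
  assumes l: "arc_length l" and "0 < a" "0 \<le> y"
    and le: "mass g (carleson_box \<theta> l) \<le> ennreal (y * measure lebesgue (strip (\<theta> - l / 2) l l))"
  shows "ennreal_powr (mean g (carleson_box \<theta> l)) a \<le> ennreal (y powr a)"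
proof -
  let ?B = "carleson_box \<theta> l"
  define Q where "Q = strip (\<theta> - l / 2) l l"
  note b = box_facts[OF l, of \<theta>, folded Q_def]
  have em: "emeasure lebesgue ?B = ennreal (measure lebesgue Q)"
    using l unfolding emeasure_carleson_box[OF l] Q_def arc_length_def by (intro emeasure_strip) simp
  have "mean g ?B \<le> ennreal (y * measure lebesgue Q) / ennreal (measure lebesgue Q)"
    unfolding mean_def em using le by (intro divide_right_mono_ennreal) (simp add: Q_def)
  also have "\<dots> = ennreal y" using b(3) assms by (simp add: divide_ennreal)
  finally have "mean g ?B \<le> ennreal y" .
  then have m: "mean g ?B \<noteq> top" "enn2real (mean g ?B) \<le> y"
    using assms by (auto simp: top_unique intro: enn2real_leI)
  then show ?thesis using assms by (auto simp: ennreal_powr_def intro!: ennreal_leI powr_mono2)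
qed

lemma \<nu>_top_ge:
  assumes d: "shallow_decay w N \<beta>" and l: "arc_length l"
  shows "(1 - \<beta>) * \<nu> (strip a l l) \<le> \<nu> (layer N a l 0)"
proof -
  note D = shallow_decayD[OF d]
  have l0: "0 < l" "l \<le> 2 * pi" using l by (auto simp: arc_length_def)
  have "\<nu> (strip a l l) = \<nu> (layer N a l 0) + \<nu> (strip a l (l / real N))"
    unfolding strip_split[OF D(2) l0(1), of a]
    using layer_borel[OF l0(2), of N a 0] strip_borel[OF l0(2), of a] layer_strip_disjoint
      strip_split[OF D(2) l0(1), of a] strip_subset_disk[of a l l]
    by (intro \<nu>_Un) auto
  moreover have "\<nu> (strip a l (l / real N)) \<le> \<beta> * \<nu> (strip a l l)"
    using D(5)[OF l, of a] D(3) unfolding mass_eq_\<nu>[OF strip_subset_disk]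
    by (subst (asm) ennreal_mult[symmetric]) auto
  ultimately show ?thesis by (simp add: algebra_simps)
qed

end

context top_weight
begin

text \<open>Decay leaves at least the fraction \<open>1 - \<beta>\<close> of the mass in the top,
  where all values are at most \<open>K N ^ Suc k * w z\<close>.\<close>

lemma layer_lower:
  assumes d: "shallow_decay w N \<beta>" and l: "arc_length l" and z: "z \<in> layer N a l k"
  shows "(1 - \<beta>) * (\<nu> (strip a l l) / measure lebesgue (strip a l l)) \<le> K N ^ Suc k * w z"
proof -
  note D = shallow_decayD[OF d]
  have N7: "7 \<le> N" using D by simp
  have l0: "0 < l" "l \<le> 2 * pi" using l by (auto simp: arc_length_def)
  let ?T = "layer N a l 0" and ?Q = "strip a l l"
  have Kp: "0 < K N ^ Suc k" using K_ge_1[of N] by (intro zero_less_power) linarith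
  have sub: "?T \<subseteq> ?Q" using layer_subset_strip[OF D(2) l0(1), of 0 0 a] by simp
  have c: "0 < K N ^ Suc k * w z" using Kp w_pos[of z] by (rule mult_pos_pos)
  have "(1 - \<beta>) * \<nu> ?Q \<le> \<nu> ?T" by (rule \<nu>_top_ge[OF d l])
  also have "\<nu> ?T \<le> K N ^ Suc k * w z * measure lebesgue ?T"
  proof (rule \<nu>_le_const)
    show "?T \<subseteq> unit_disk" using sub strip_subset_disk by blast
    show "w \<xi> \<le> K N ^ Suc k * w z" if "\<xi> \<in> ?T" for \<xi>
      by (rule layer_compare(2)[OF N7 l z that])
  qed (use layer_lmeasurable[OF l0 D(2)] c in \<open>auto simp del: power_Suc\<close>)
  also have "\<dots> \<le> K N ^ Suc k * w z * measure lebesgue ?Q"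
    using c sub layer_lmeasurable[OF l0 D(2)] strip_lmeasurable[OF l0(2)]
    by (intro mult_left_mono measure_mono_fmeasurable) (auto simp del: power_Suc)
  finally show ?thesis using measure_strip_pos[OF l0 l0(1), of a] by (simp add: field_simps del: power_Suc)
qed

lemma exponent_exists:
  assumes "1 < (b::real)"
  obtains s where "0 < s" "K N powr s \<le> b"
proof
  have K: "1 \<le> K N" by (rule K_ge_1)
  then have K1: "0 < ln (K N + 1)" by simp
  \<comment> \<open>The \<open>+ 1\<close> keeps the denominator positive in the case
    \<open>K N = 1\<close>.\<close>
  show "0 < ln b / ln (K N + 1)" using assms K1 by simp
  have "K N powr (ln b / ln (K N + 1)) \<le> (K N + 1) powr (ln b / ln (K N + 1))"
    using K assms K1 by (intro powr_mono2) auto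
  also have "\<dots> = b" using K K1 assms by (simp add: powr_def)
  finally show "K N powr (ln b / ln (K N + 1)) \<le> b" .
qed

text \<open>On layer \<open>k\<close> the extra power \<open>w powr s\<close> is at most
  \<open>(16 * f) powr s * X ^ Suc k\<close>, while the layer carries at most the fraction
  \<open>\<beta> ^ k\<close> of the mass. The dominating series has ratio
  \<open>X * \<beta>\<close>.\<close>

lemma reverse_Hoelder_of_shallow_decay:
  assumes d: "shallow_decay w N \<beta>"
  shows "reverse_Hoelder w"
proof -
  note D = shallow_decayD[OF d]
  have "1 < 1 / sqrt \<beta>" using D by simp
  \<comment> \<open>This choice gives the ratio
    \<open>X * \<beta> \<le> sqrt \<beta> < 1\<close>.\<close>
  then obtain s where s: "0 < s" "K N powr s \<le> 1 / sqrt \<beta>" by (rule exponent_exists)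
  define X where "X = K N powr s"
  have X: "0 < X" using K_ge_1[of N] by (simp add: X_def)
  have "X * \<beta> \<le> 1 / sqrt \<beta> * \<beta>" using s D by (intro mult_right_mono) (auto simp: X_def)
  also have "\<dots> = sqrt \<beta>" using D by (simp add: real_div_sqrt)
  finally have X\<beta>: "X * \<beta> < 1" using D by (simp add: order_le_less_trans)
  define r where "r = 1 + s"
  define c where "c = 16 powr s * X / (1 - X * \<beta>)"
  have c: "0 < c" using X X\<beta> by (simp add: c_def)
  have "ennreal_powr (mean (\<lambda>z. w z powr r) (carleson_box \<theta> l)) (1 / r) \<le> ennreal (c powr (1 / r)) * mean w (carleson_box \<theta> l)"
    if l: "arc_length l" for \<theta> l
  proof -
    have l0: "0 < l" "l \<le> 2 * pi" using l by (auto simp: arc_length_def)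
    define a where "a = \<theta> - l / 2"
    define Q where "Q = strip a l l"
    note b = box_facts[OF l, of \<theta>, folded a_def, folded Q_def]
    define f where "f = \<nu> Q / measure lebesgue Q"
    have f: "0 < f" using b by (simp add: f_def)
    have "(\<integral>\<^sup>+ z \<in> strip a l l. ennreal (w z powr r) \<partial>lebesgue) \<le> ennreal ((16 * f) powr s * X * \<nu> Q / (1 - X * \<beta>))"
    proof (rule nn_integral_layers_geometric[OF D(2) l])
      fix k
      let ?b = "(16 * f) powr s * X ^ Suc k"
      have b0: "0 \<le> ?b" using X by simp
      have pt: "w z powr r \<le> ?b * w z" if z: "z \<in> layer N a l k" for z
      proof -
        have K0: "0 \<le> K N ^ Suc k" using K_ge_1[of N] by (intro zero_le_power) linarith
        have "w z \<le> 16 * K N ^ Suc k * f" using layer_upper[OF D(1) l z] by (simp add: f_def Q_def)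
        then have "w z powr s \<le> (16 * K N ^ Suc k * f) powr s" using w_pos[of z] s by (intro powr_mono2) auto
        also have "\<dots> = (16 * f) powr s * (K N ^ Suc k) powr s"
          using f K0 by (simp add: powr_mult mult_ac del: power_Suc)
        also have "(K N ^ Suc k) powr s = X ^ Suc k"
          using K_ge_1[of N] by (simp add: X_def powr_powr powr_realpow[symmetric] mult.commute del: power_Suc of_nat_Suc)
        finally have "w z * w z powr s \<le> w z * ?b" using w_pos[of z] by (intro mult_left_mono) auto
        then show ?thesis using w_pos[of z] by (simp add: r_def powr_add mult_ac)
      qed
      have sub: "layer N a l k \<subseteq> strip a l (l / real N ^ k)" by (rule layer_subset_strip[OF D(2) l0(1)]) simp
      have "(\<integral>\<^sup>+ z \<in> layer N a l k. ennreal (w z powr r) \<partial>lebesgue) \<le> (\<integral>\<^sup>+ z \<in> strip a l (l / real N ^ k). ennreal (?b * w z) \<partial>lebesgue)"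
      proof (rule nn_integral_mono)
        fix z
        show "ennreal (w z powr r) * indicator (layer N a l k) z \<le> ennreal (?b * w z) * indicator (strip a l (l / real N ^ k)) z"
          using pt[of z] sub by (auto intro: ennreal_leI split: split_indicator)
      qed
      also have "\<dots> = ennreal ?b * mass w (strip a l (l / real N ^ k))"
        by (rule mass_strip_times_w[OF l0(2) b0])
      also have "\<dots> \<le> ennreal ?b * (ennreal (\<beta> ^ k) * mass w Q)"
        unfolding Q_def by (intro mult_left_mono mass_strip_decay[OF d l]) simp
      also have "\<dots> = ennreal (?b * (\<beta> ^ k * \<nu> Q))"
        using D b0 unfolding mass_eq_\<nu>[OF b(8)] by (simp add: ennreal_mult del: power_Suc)
      also have "?b * (\<beta> ^ k * \<nu> Q) = (16 * f) powr s * X * \<nu> Q * (X * \<beta>) ^ k"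
        by (simp add: power_mult_distrib)
      finally show "(\<integral>\<^sup>+ z \<in> layer N a l k. ennreal (w z powr r) \<partial>lebesgue) \<le> ennreal ((16 * f) powr s * X * \<nu> Q * (X * \<beta>) ^ k)" .
    qed (use X X\<beta> D in auto)
    also have "(16 * f) powr s * X * \<nu> Q / (1 - X * \<beta>) = c * f powr r * measure lebesgue Q"
    proof -
      have "\<nu> Q = f * measure lebesgue Q" using b by (simp add: f_def)
      moreover have "f powr r = f * f powr s" using f by (simp add: r_def powr_add)
      ultimately show ?thesis using f by (simp add: c_def powr_mult)
    qed
    finally have "mass (\<lambda>z. w z powr r) (carleson_box \<theta> l) \<le> ennreal (c * f powr r * measure lebesgue Q)"
      unfolding mass_carleson_box[OF l] unfolding mass_def a_def Q_def .
    then have "ennreal_powr (mean (\<lambda>z. w z powr r) (carleson_box \<theta> l)) (1 / r) \<le> ennreal ((c * f powr r) powr (1 / r))"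
      using c s unfolding Q_def a_def by (intro powr_mean_le l) (auto simp: r_def)
    also have "(c * f powr r) powr (1 / r) = c powr (1 / r) * f"
      using c f s by (simp add: powr_mult powr_powr r_def)
    finally show ?thesis
      using f unfolding b(5) f_def[symmetric] by (simp add: ennreal_mult)
  qed
  moreover have "1 < r" "0 < c powr (1 / r)" using s c by (auto simp: r_def)
  ultimately show ?thesis unfolding reverse_Hoelder_def by blast
qed

text \<open>By \<open>layer_lower\<close>, \<open>w powr - s\<close> grows at most like
  \<open>X ^ k\<close>, while the area of layer \<open>k\<close> decays like the inverse of
  \<open>N ^ k\<close>; the series converges since \<open>X \<le> 2 < N\<close>. The relation
  \<open>p - 1 = 1 / s\<close> makes \<open>- s\<close> the exponent in
  \<open>B_const\<close>.\<close>

lemma B_class_of_shallow_decay: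
  assumes d: "shallow_decay w N \<beta>"
  shows "\<exists>p>1. B_class p w"
proof -
  note D = shallow_decayD[OF d]
  obtain s where s: "0 < s" "K N powr s \<le> 2" using exponent_exists[of 2 N] by auto
  define X where "X = K N powr s"
  have X: "0 < X" using K_ge_1[of N] by (simp add: X_def)
  define x where "x = X / real N"
  have x: "0 < x" "x < 1" using X s D by (auto simp: x_def X_def)
  define c where "c = (1 - \<beta>) powr - s * 56 * X / (1 - x)"
  have c: "0 < c" using D X x by (simp add: c_def)
  define p where "p = 1 + 1 / s"
  have ps: "1 - p / (p - 1) = - s" using s by (simp add: p_def field_simps)
  have "mean w (carleson_box \<theta> l) * ennreal_powr (mean (\<lambda>z. w z powr - s) (carleson_box \<theta> l)) (p - 1) \<le> ennreal (c powr (1 / s))"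
    if l: "arc_length l" for \<theta> l
  proof -
    have l0: "0 < l" "l \<le> 2 * pi" using l by (auto simp: arc_length_def)
    define a where "a = \<theta> - l / 2"
    define Q where "Q = strip a l l"
    note b = box_facts[OF l, of \<theta>, folded a_def, folded Q_def]
    define f where "f = \<nu> Q / measure lebesgue Q"
    have f: "0 < f" using b by (simp add: f_def)
    define g where "g = ((1 - \<beta>) * f) powr - s"
    have "(\<integral>\<^sup>+ z \<in> strip a l l. ennreal (w z powr - s) \<partial>lebesgue) \<le> ennreal (g * X * 56 * measure lebesgue Q / (1 - x))"
    proof (rule nn_integral_layers_geometric[OF D(2) l])
      fix k
      have pt: "w z powr - s \<le> g * X ^ Suc k" if z: "z \<in> layer N a l k" for z
      proof -
        have K0: "0 < K N ^ Suc k" using K_ge_1[of N] by (intro zero_less_power) linarith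
        have "(1 - \<beta>) * f \<le> K N ^ Suc k * w z" using layer_lower[OF d l z] by (simp add: f_def Q_def)
        then have "(K N ^ Suc k * w z) powr - s \<le> g" unfolding g_def using D f s by (intro powr_mono2') auto
        moreover have "(K N ^ Suc k * w z) powr - s = (K N ^ Suc k) powr - s * w z powr - s"
          using K0 w_pos[of z] by (simp add: powr_mult del: power_Suc)
        moreover have "(K N ^ Suc k) powr s = X ^ Suc k"
          using K_ge_1[of N] by (simp add: X_def powr_powr powr_realpow[symmetric] mult.commute del: power_Suc of_nat_Suc)
        ultimately have "w z powr - s / X ^ Suc k \<le> g" using X by (simp add: powr_minus field_simps del: power_Suc)
        moreover have "0 < X ^ Suc k" using X by simp
        ultimately show ?thesis by (simp add: pos_divide_le_eq del: power_Suc)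
      qed
      have sub: "layer N a l k \<subseteq> strip a l (l / real N ^ k)" by (rule layer_subset_strip[OF D(2) l0(1)]) simp
      have [measurable]: "strip a l (l / real N ^ k) \<in> sets lebesgue" using strip_borel[OF l0(2)] by simp
      have "(\<integral>\<^sup>+ z \<in> layer N a l k. ennreal (w z powr - s) \<partial>lebesgue) \<le> (\<integral>\<^sup>+ z. ennreal (g * X ^ Suc k) * indicator (strip a l (l / real N ^ k)) z \<partial>lebesgue)"
      proof (rule nn_integral_mono)
        fix z
        show "ennreal (w z powr - s) * indicator (layer N a l k) z \<le> ennreal (g * X ^ Suc k) * indicator (strip a l (l / real N ^ k)) z"
          using pt[of z] sub by (auto intro: ennreal_leI split: split_indicator)
      qed
      also have "\<dots> = ennreal (g * X ^ Suc k * measure lebesgue (strip a l (l / real N ^ k)))"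
        using emeasure_strip[OF l0(2)] X by (simp add: nn_integral_cmult_indicator ennreal_mult g_def del: power_Suc)
      also have "\<dots> \<le> ennreal (g * X ^ Suc k * (56 / real N ^ k * measure lebesgue Q))"
        using measure_shallow_strip[of "N ^ k" l a] D(2) l X unfolding Q_def
        by (intro ennreal_leI mult_left_mono) (auto simp: g_def)
      also have "g * X ^ Suc k * (56 / real N ^ k * measure lebesgue Q) = g * X * 56 * measure lebesgue Q * x ^ k"
        by (simp add: x_def power_divide)
      finally show "(\<integral>\<^sup>+ z \<in> layer N a l k. ennreal (w z powr - s) \<partial>lebesgue) \<le> ennreal (g * X * 56 * measure lebesgue Q * x ^ k)" .
    qed (use X x in \<open>auto simp: g_def\<close>)
    also have "g * X * 56 * measure lebesgue Q / (1 - x) = c * f powr - s * measure lebesgue Q"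
      using D f by (simp add: g_def c_def powr_mult)
    finally have "mass (\<lambda>z. w z powr - s) (carleson_box \<theta> l) \<le> ennreal (c * f powr - s * measure lebesgue Q)"
      unfolding mass_carleson_box[OF l] unfolding mass_def a_def Q_def .
    then have "ennreal_powr (mean (\<lambda>z. w z powr - s) (carleson_box \<theta> l)) (1 / s) \<le> ennreal ((c * f powr - s) powr (1 / s))"
      using c s unfolding Q_def a_def by (intro powr_mean_le l) auto
    also have "(c * f powr - s) powr (1 / s) = c powr (1 / s) / f"
      using c f s by (simp add: powr_mult powr_powr powr_minus_divide powr_divide)
    finally have "ennreal f * ennreal_powr (mean (\<lambda>z. w z powr - s) (carleson_box \<theta> l)) (1 / s) \<le> ennreal f * ennreal (c powr (1 / s) / f)"
      by (intro mult_left_mono) auto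
    also have "\<dots> = ennreal (c powr (1 / s))" using f by (simp add: ennreal_mult[symmetric])
    finally show ?thesis unfolding b(5) f_def p_def by simp
  qed
  then have "B_const p w \<le> ennreal (c powr (1 / s))"
    unfolding B_const_def ps by (intro SUP_least) auto
  then have "B_class p w" unfolding B_class_def by (simp add: order_le_less_trans)
  then show ?thesis using s by (intro exI[of _ p]) (simp add: p_def)
qed

end

section \<open>The maximal function under decay, and the equivalences\<close>

context top_weight
begin

text \<open>If \<open>J\<close> meets a node \<open>I\<close> of comparable length, the tops of \<open>Q_J\<close> and \<open>Q_I\<close> are at bounded
  hyperbolic distance.\<close>

lemma tops_compare:
  assumes N: "128 \<le> N" and m: "0 < m" "m < h" "h \<le> real N * m"
    and z: "z \<in> carleson_box \<theta> m" "z \<in> sector b h A" "z \<noteq> 0"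
    and \<xi>: "\<xi> \<in> layer N (\<theta> - m / 2) m 0" and \<zeta>: "\<zeta> \<in> layer N b h 0"
  shows "w \<xi> \<le> K N * w \<zeta>"
proof -
  have N0: "1 \<le> real N" "0 < real N" "1 \<le> N" using N by auto
  obtain r \<alpha>' where \<alpha>': "z = of_real r * cis \<alpha>'" "0 \<le> r" "\<bar>\<theta> - \<alpha>'\<bar> < m / 2"
    using z(1) by (auto simp: carleson_box_def)
  obtain r' \<alpha> where \<alpha>: "z = of_real r' * cis \<alpha>" "0 < r'" "b \<le> \<alpha>" "\<alpha> < b + h"
    using z(2) by (auto simp: sector_def)
  have "cmod z = r" using \<alpha>'(1,2) by (simp add: norm_mult)
  moreover have "cmod z = r'" using \<alpha>(1,2) by (simp add: norm_mult)
  ultimately have "r = r'" by simp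
  then have cis: "cis \<alpha> = cis \<alpha>'" using \<alpha> \<alpha>' by simp
  obtain t \<phi> where t: "\<xi> = polar t \<phi>" "1 - t \<in> {1 - m / real N ^ 0<..1 - m / real N ^ Suc 0}" "t < 1" "\<theta> - m / 2 \<le> \<phi>" "\<phi> < \<theta> - m / 2 + m"
    using \<xi> unfolding layer_def by (rule sector_polarE)
  obtain t' \<phi>' where t': "\<zeta> = polar t' \<phi>'" "1 - t' \<in> {1 - h / real N ^ 0<..1 - h / real N ^ Suc 0}" "t' < 1" "b \<le> \<phi>'" "\<phi>' < b + h"
    using \<zeta> unfolding layer_def by (rule sector_polarE)
  have tb: "m \<le> real N * t" "t < m" "h \<le> real N * t'" "t' < h" using t t' N0 by (auto simp: field_simps)
  have "0 < real N * t" "0 < real N * t'" using tb m by linarith+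
  then have p: "0 < t" "0 < t'" using N0 by (auto simp: zero_less_mult_iff)
  \<comment> \<open>The two boxes may describe \<open>z\<close> by angles that differ by a multiple
    of \<open>2 * pi\<close>. Shifting \<open>\<phi>\<close> by \<open>\<alpha> - \<alpha>'\<close>
    puts both arcs on one branch, where differences of angles are meaningful.\<close>
  have "cis (\<phi> + \<alpha> - \<alpha>') = cis \<phi>" using cis by (simp add: cis_mult[symmetric] cis_divide[symmetric])
  then have \<xi>': "\<xi> = polar t (\<phi> + \<alpha> - \<alpha>')" using t(1) by (simp add: polar_def)
  have "\<bar>\<phi> + \<alpha> - \<alpha>' - \<phi>'\<bar> \<le> m + h" using t(4,5) t'(4,5) \<alpha>(3,4) \<alpha>'(3) unfolding abs_le_iff abs_less_iff by linarith
  also have "\<dots> \<le> 2 * h" using m by simp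
  finally have ang: "\<bar>\<phi> + \<alpha> - \<alpha>' - \<phi>'\<bar> \<le> 2 * h" .
  have "real N * m \<le> real N * (real N * t)" using tb N0 by (intro mult_left_mono) auto
  then have hN: "h \<le> real N ^ 2 * t" using m by (simp add: power2_eq_square mult.assoc)
  have "real N * t' \<le> real N ^ 2 * t'" using N0 p by (intro mult_right_mono) (auto simp: power2_eq_square)
  then have tt: "t \<le> 2 * real N ^ 2 * t'" using tb m p mult_nonneg_nonneg[of "real N ^ 2" t'] by linarith
  have tt': "t' \<le> 2 * real N ^ 2 * t" "2 * h \<le> 2 * real N ^ 2 * t" using hN tb p m by linarith+
  show ?thesis unfolding \<xi>' t'(1)
    by (rule K_compare) (use N0 p t t' tt tt' ang in linarith)+
qed

text \<open>The arcs in the maximal function are arbitrary. One shorter than the base arc is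
  compared with an arc of the N-adic subdivision that is longer by a factor of at most
  \<open>N\<close> and whose box contains the same point; every other one is compared with the base
  arc.\<close>

lemma B_infinity_of_shallow_decay:
  assumes d: "shallow_decay w N \<beta>"
  shows "B_infinity w"
proof -
  note D = shallow_decayD[OF d]
  \<comment> \<open>The factor \<open>1 / (1 - \<beta>)\<close> passes from the mass of a box to
    that of its top, \<open>K N\<close> compares two tops, and 16 bounds the ratio of the areas of a
    box and its top.\<close>
  define \<kappa> where "\<kappa> = 16 * K N / (1 - \<beta>)"
  have \<kappa>: "0 < \<kappa>" using K_ge_1[of N] D by (simp add: \<kappa>_def)
  have bound: "(\<integral>\<^sup>+ z \<in> carleson_box \<theta> l. carleson_maximal (\<lambda>x. w x * indicator (carleson_box \<theta> l) x) z \<partial>lebesgue)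
      \<le> ennreal \<kappa> * mass w (carleson_box \<theta> l)" if l: "arc_length l" for \<theta> l
  proof -
    have l0: "0 < l" "l \<le> 2 * pi" using l by (auto simp: arc_length_def)
    let ?B = "carleson_box \<theta> l"
    define a where "a = \<theta> - l / 2"
    define Q where "Q = strip a l l"
    note b = box_facts[OF l, of \<theta>, folded a_def, folded Q_def]
    define h where "h = (\<lambda>k. l / real N ^ k)"
    define A where "A = (\<lambda>k j. a + real j * h k)"
    define S where "S = (\<lambda>k j. strip (A k j) (h k) (h k))"
    \<comment> \<open>Mass of the top over area of the whole box: integrating \<open>e k j\<close>
      over \<open>S k j\<close> returns exactly the mass of the top, and the tops tile
      \<open>Q\<close>.\<close>
    define e where "e = (\<lambda>k j. \<nu> (layer N (A k j) (h k) 0) / measure lebesgue (S k j))"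
    define G where "G = (\<lambda>z. \<Sum>k. \<Sum>j<N ^ k. ennreal (e k j) * indicator (S k j) z)"
    have h: "arc_length (h k)" "0 < h k" "h k \<le> 2 * pi" for k
      using subarc(1)[OF D(2) l, of 0 k] D(2) by (auto simp: h_def arc_length_def)
    have Sm: "0 < measure lebesgue (S k j)" for k j
      unfolding S_def using h by (intro measure_strip_pos) auto
    have [measurable]: "S k j \<in> sets lebesgue" for k j unfolding S_def using strip_borel[OF h(3)] by simp
    have e0: "0 \<le> e k j" for k j by (simp add: e_def)
    have G_ge: "ennreal (e k j) \<le> G z" if "j < N ^ k" "z \<in> S k j" for k j z
    proof -
      have "ennreal (e k j) = ennreal (e k j) * indicator (S k j) z" using that by simp
      also have "\<dots> \<le> (\<Sum>j<N ^ k. ennreal (e k j) * indicator (S k j) z)"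
        using that by (intro member_le_sum) auto
      also have "\<dots> \<le> G z" unfolding G_def
        using sum_le_suminf[of "\<lambda>k. \<Sum>j<N ^ k. ennreal (e k j) * indicator (S k j) z" "{k}"] by simp
      finally show ?thesis .
    qed
    have maximal: "mean (\<lambda>x. \<bar>w x * indicator ?B x\<bar>) (carleson_box \<psi> m) \<le> ennreal \<kappa> * G z"
      if m: "arc_length m" "z \<in> carleson_box \<psi> m" and z: "z \<in> Q" for \<psi> m z
    proof -
      have m0: "0 < m" "m \<le> 2 * pi" using m by (auto simp: arc_length_def)
      define R where "R = strip (\<psi> - m / 2) m m"
      note bR = box_facts[OF m(1), of \<psi>, folded R_def]
      have emR: "emeasure lebesgue (carleson_box \<psi> m) = ennreal (measure lebesgue R)"
        unfolding emeasure_carleson_box[OF m(1)] R_def by (rule emeasure_strip[OF m0(2)])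
      have mono: "mean (\<lambda>x. \<bar>w x * indicator ?B x\<bar>) (carleson_box \<psi> m) \<le> ennreal (y / measure lebesgue R)"
        if "mass (\<lambda>x. \<bar>w x * indicator ?B x\<bar>) (carleson_box \<psi> m) \<le> ennreal y" "0 \<le> y" for y
      proof -
        have "mean (\<lambda>x. \<bar>w x * indicator ?B x\<bar>) (carleson_box \<psi> m) \<le> ennreal y / ennreal (measure lebesgue R)"
          unfolding mean_def emR using that(1) by (rule divide_right_mono_ennreal)
        then show ?thesis using that(2) bR(3) by (simp add: divide_ennreal)
      qed
      have z0: "z \<noteq> 0" using norm_sector[of z a l "{1 - l<..<1}"] z unfolding Q_def strip_def by auto
      show ?thesis
      proof (cases "l \<le> m")
        \<comment> \<open>Here the mass is at most that of \<open>Q\<close> and the area at least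
          1/8 of that of \<open>Q\<close>, so the root \<open>S 0 0 = Q\<close> of the subdivision
          suffices.\<close>
        case True
        have "mass (\<lambda>x. \<bar>w x * indicator ?B x\<bar>) (carleson_box \<psi> m) \<le> mass w ?B"
          unfolding mass_def using w_pos by (intro nn_integral_mono) (auto split: split_indicator simp: less_imp_le)
        then have 1: "mean (\<lambda>x. \<bar>w x * indicator ?B x\<bar>) (carleson_box \<psi> m) \<le> ennreal (\<nu> Q / measure lebesgue R)"
          using mono[of "\<nu> Q"] b(1) by simp
        have "measure lebesgue Q \<le> 2 * l * min l 1" unfolding Q_def using l0 by (intro measure_strip_bounds) auto
        also have "\<dots> \<le> 8 * (m * min m 1 / 4)" using True l0 mult_mono[of l m "min l 1" "min m 1"] by simp
        also have "\<dots> \<le> 8 * measure lebesgue R" unfolding R_def using m0 by (intro mult_left_mono measure_strip_bounds) auto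
        finally have QR: "measure lebesgue Q \<le> 8 * measure lebesgue R" .
        have S00: "S 0 0 = Q" by (simp add: S_def A_def h_def Q_def)
        have "\<nu> Q / measure lebesgue R \<le> 8 * \<nu> Q / measure lebesgue Q"
          using QR b(2,3) bR(3) mult_left_mono[OF QR, of "\<nu> Q"] by (simp add: field_simps)
        also have "\<dots> \<le> 8 * (\<nu> (layer N a l 0) / (1 - \<beta>)) / measure lebesgue Q"
          using \<nu>_top_ge[OF d l, of a] D(4) b(3) unfolding Q_def
          by (intro divide_right_mono mult_left_mono) (auto simp: field_simps)
        also have "\<dots> = 8 / (1 - \<beta>) * e 0 0" by (simp add: e_def S00) (simp add: A_def h_def)
        also have "\<dots> \<le> \<kappa> * e 0 0"
          using K_ge_1[of N] D(4) e0 unfolding \<kappa>_def by (intro mult_right_mono divide_right_mono) auto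
        finally have "ennreal (\<nu> Q / measure lebesgue R) \<le> ennreal \<kappa> * ennreal (e 0 0)"
          using \<kappa> e0 by (subst ennreal_mult[symmetric]) (auto intro: ennreal_leI)
        also have "\<dots> \<le> ennreal \<kappa> * G z" using G_ge[of 0 0 z] z by (intro mult_left_mono) (auto simp: S00)
        finally show ?thesis using 1 by simp
      next
        case False
        \<comment> \<open>The last generation whose arcs are longer than \<open>m\<close>; its boxes
          are deep enough for one of them to contain \<open>z\<close>.\<close>
        then obtain k where k: "l / real N ^ Suc k \<le> m" "m < l / real N ^ k"
          using layer_exists[OF D(2) l0(1) m0(1)] by auto
        have hk: "m < h k" "h k \<le> real N * m"
          using k D(2) by (auto simp: h_def field_simps)
        have "1 - m < cmod z" "cmod z < 1" using m(2) by (auto simp: carleson_box_def norm_mult)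
        then have "1 - h k < cmod z" "cmod z < 1" using hk by auto
        moreover obtain x \<alpha> where x: "z = of_real x * cis \<alpha>" "0 < x" "a \<le> \<alpha>" "\<alpha> < a + l"
          using z unfolding Q_def strip_def sector_def by blast
        moreover have "cmod z = x" using x(1,2) by (simp add: norm_mult)
        ultimately have "z \<in> strip a l (h k)"
          unfolding strip_def sector_def by (intro CollectI exI[of _ x] exI[of _ \<alpha>]) auto
        then have "z \<in> (\<Union>j<N ^ k. S k j)"
          unfolding S_def A_def strip_def using sector_partition[OF l0(1), of "N ^ k"] D(2) by (simp add: h_def)
        then obtain j where j: "j < N ^ k" "z \<in> S k j" by auto
        have "mass (\<lambda>x. \<bar>w x * indicator ?B x\<bar>) (carleson_box \<psi> m) \<le> mass w (carleson_box \<psi> m)"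
          unfolding mass_def using w_pos by (intro nn_integral_mono) (auto split: split_indicator simp: less_imp_le)
        then have 1: "mean (\<lambda>x. \<bar>w x * indicator ?B x\<bar>) (carleson_box \<psi> m) \<le> ennreal (\<nu> R / measure lebesgue R)"
          using mono[of "\<nu> R"] bR(1) by simp
        let ?T = "layer N (\<psi> - m / 2) m 0" and ?U = "layer N (A k j) (h k) 0"
        have Um: "?U \<in> lmeasurable" "?T \<in> lmeasurable" using layer_lmeasurable h m0 D(2) by auto
        have Tsub: "?T \<subseteq> R" unfolding R_def using layer_subset_strip[OF D(2) m0(1), of 0 0] by simp
        have Usub: "?U \<subseteq> S k j" unfolding S_def using layer_subset_strip[OF D(2) h(2), of 0 0] by simp
        have Sd: "S k j \<subseteq> unit_disk" unfolding S_def by (rule strip_subset_disk)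
        \<comment> \<open>A lower bound for \<open>w\<close> on the top \<open>?U\<close> of the
          node, obtained from the mean over the box of the arbitrary arc.\<close>
        define q where "q = (1 - \<beta>) * (\<nu> R / measure lebesgue R) / K N"
        have q0: "0 \<le> q" using D(4) K_ge_1[of N] bR(6) by (simp add: q_def)
        have "q * measure lebesgue ?U \<le> \<nu> ?U"
        proof (rule \<nu>_ge_const[OF Um(1) _ q0])
          show "?U \<subseteq> unit_disk" using Usub Sd by blast
          fix \<zeta> assume \<zeta>: "\<zeta> \<in> ?U"
          have c: "0 < K N * w \<zeta>" using K_ge_1[of N] w_pos[of \<zeta>] by simp
          have "(1 - \<beta>) * \<nu> R \<le> \<nu> ?T" unfolding R_def by (rule \<nu>_top_ge[OF d m(1)])
          also have "\<dots> \<le> K N * w \<zeta> * measure lebesgue ?T"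
          proof (rule \<nu>_le_const[OF Um(2)])
            show "?T \<subseteq> unit_disk" using Tsub bR(8) by blast
            show "w \<xi> \<le> K N * w \<zeta>" if "\<xi> \<in> ?T" for \<xi>
              using tops_compare[OF D(1) m0(1) hk m(2) _ z0 that \<zeta>] j(2) unfolding S_def strip_def by blast
          qed (use c in simp)
          also have "\<dots> \<le> K N * w \<zeta> * measure lebesgue R"
            using c Tsub Um(2) bR(7) by (intro mult_left_mono measure_mono_fmeasurable) auto
          finally show "q \<le> w \<zeta>" using bR(3) K_ge_1[of N] by (simp add: q_def field_simps)
        qed
        moreover have "q * measure lebesgue (S k j) \<le> q * (16 * measure lebesgue ?U)"
          unfolding S_def using q0 by (intro mult_left_mono measure_strip_le_layer[OF D(1) h(2,3)]) auto
        ultimately have "q * measure lebesgue (S k j) \<le> 16 * \<nu> ?U" by simp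
        then have "q \<le> 16 * e k j" using Sm[of k j] by (simp add: e_def field_simps)
        then have "q * K N \<le> 16 * e k j * K N" using K_ge_1[of N] by (intro mult_right_mono) auto
        moreover have "q * K N = (1 - \<beta>) * (\<nu> R / measure lebesgue R)" using K_ge_1[of N] by (simp add: q_def)
        ultimately have "(1 - \<beta>) * (\<nu> R / measure lebesgue R) \<le> 16 * e k j * K N" by linarith
        then have "\<nu> R / measure lebesgue R \<le> \<kappa> * e k j"
          unfolding \<kappa>_def using D(4) by (simp add: le_divide_eq mult_ac)
        then have "ennreal (\<nu> R / measure lebesgue R) \<le> ennreal \<kappa> * ennreal (e k j)"
          using \<kappa> e0 by (subst ennreal_mult[symmetric]) (auto intro: ennreal_leI)
        also have "\<dots> \<le> ennreal \<kappa> * G z" using G_ge[OF j] by (intro mult_left_mono) auto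
        finally show ?thesis using 1 by simp
      qed
    qed
    have "carleson_maximal (\<lambda>x. w x * indicator ?B x) z \<le> ennreal \<kappa> * G z" if "z \<in> Q" for z
      unfolding carleson_maximal_def using maximal that by (intro SUP_least) auto
    then have "(\<integral>\<^sup>+ z \<in> Q. carleson_maximal (\<lambda>x. w x * indicator ?B x) z \<partial>lebesgue) \<le> (\<integral>\<^sup>+ z. ennreal \<kappa> * G z \<partial>lebesgue)"
      by (intro nn_integral_mono) (auto split: split_indicator)
    also have "\<dots> = ennreal \<kappa> * (\<integral>\<^sup>+ z. G z \<partial>lebesgue)"
      unfolding G_def by (intro nn_integral_cmult) measurable
    also have "(\<integral>\<^sup>+ z. G z \<partial>lebesgue) = (\<Sum>k. \<integral>\<^sup>+ z. (\<Sum>j<N ^ k. ennreal (e k j) * indicator (S k j) z) \<partial>lebesgue)"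
      unfolding G_def by (intro nn_integral_suminf) measurable
    also have "\<dots> = (\<Sum>k. mass w (layer N a l k))"
    proof (rule suminf_cong)
      fix k
      have "(\<integral>\<^sup>+ z. (\<Sum>j<N ^ k. ennreal (e k j) * indicator (S k j) z) \<partial>lebesgue)
          = (\<Sum>j<N ^ k. \<integral>\<^sup>+ z. ennreal (e k j) * indicator (S k j) z \<partial>lebesgue)"
        by (intro nn_integral_sum) measurable
      also have "\<dots> = (\<Sum>j<N ^ k. mass w (layer N (A k j) (h k) 0))"
      proof (rule sum.cong[OF refl])
        fix j
        have "layer N (A k j) (h k) 0 \<subseteq> unit_disk"
          using layer_subset_strip[OF D(2) h(2), of 0 0] strip_subset_disk by blast
        then have "mass w (layer N (A k j) (h k) 0) = ennreal (e k j * measure lebesgue (S k j))"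
          using Sm[of k j] by (simp add: mass_eq_\<nu> e_def)
        also have "\<dots> = ennreal (e k j) * emeasure lebesgue (S k j)"
          using emeasure_strip[OF h(3)] e0[of k j] unfolding S_def by (simp only: ennreal_mult measure_nonneg)
        finally show "(\<integral>\<^sup>+ z. ennreal (e k j) * indicator (S k j) z \<partial>lebesgue) = mass w (layer N (A k j) (h k) 0)"
          by (subst nn_integral_cmult_indicator) simp_all
      qed
      also have "\<dots> = mass w (layer N a l k)"
        unfolding mass_def A_def h_def by (rule layer_partition_nn_integral[OF D(2) l0, symmetric]) simp
      finally show "(\<integral>\<^sup>+ z. (\<Sum>j<N ^ k. ennreal (e k j) * indicator (S k j) z) \<partial>lebesgue) = mass w (layer N a l k)" .
    qed
    also have "\<dots> = mass w Q"
      unfolding mass_def Q_def by (rule nn_integral_layers[OF D(2) l0, symmetric]) simp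
    also have "mass w Q = mass w ?B" unfolding Q_def a_def by (rule mass_carleson_box[OF l, symmetric])
    finally show ?thesis unfolding Q_def a_def nn_integral_carleson_box[OF l] .
  qed
  have "B_infinity_const w \<le> ennreal \<kappa>"
    unfolding B_infinity_const_def
  proof (intro SUP_least, clarify)
    fix \<theta> l assume l: "arc_length l"
    note b = box_facts[OF l, of \<theta>]
    have "(\<integral>\<^sup>+ z \<in> carleson_box \<theta> l. carleson_maximal (\<lambda>x. w x * indicator (carleson_box \<theta> l) x) z \<partial>lebesgue) / mass w (carleson_box \<theta> l)
        \<le> ennreal \<kappa> * mass w (carleson_box \<theta> l) / mass w (carleson_box \<theta> l)"
      by (rule divide_right_mono_ennreal[OF bound[OF l]])
    also have "\<dots> = ennreal \<kappa>" using b(1,2) \<kappa> by (simp add: ennreal_mult[symmetric] divide_ennreal)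
    finally show "(\<integral>\<^sup>+ z \<in> carleson_box \<theta> l. carleson_maximal (\<lambda>x. w x * indicator (carleson_box \<theta> l) x) z \<partial>lebesgue) / mass w (carleson_box \<theta> l) \<le> ennreal \<kappa>" .
  qed
  then show ?thesis unfolding B_infinity_def by (simp add: order_le_less_trans)
qed

text \<open>The implications run from \<open>B_infinity\<close> through \<open>LlogL_bound\<close>,
  \<open>small_measurable_sets\<close> and \<open>small_box_unions\<close> to
  \<open>shallow_decay\<close>, which gives back \<open>B_infinity\<close> and also
  \<open>reverse_Hoelder\<close> and \<open>B_class\<close>. These two return through
  \<open>small_measurable_sets\<close> and \<open>exp_log_bound\<close> respectively.\<close>

lemma equivalences:
  "(B_infinity w \<longleftrightarrow> (\<exists>C>0. LlogL_bound C w))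
      \<and> (B_infinity w \<longleftrightarrow> small_box_unions w)
      \<and> (B_infinity w \<longleftrightarrow> small_measurable_sets w)
      \<and> (B_infinity w \<longleftrightarrow> reverse_Hoelder w)
      \<and> (B_infinity w \<longleftrightarrow> (\<exists>p>1. B_class p w))
      \<and> (B_infinity w \<longleftrightarrow> exp_log_bound w)"
proof -
  have 12: "\<exists>C>0. LlogL_bound C w" if "B_infinity w"
  proof -
    let ?c = "16 * LlogL_factor \<rho> C * enn2real (B_infinity_const w)"
    have c: "0 \<le> ?c" using LlogL_factor_pos by simp
    \<comment> \<open>Adding 1 yields a positive constant without a lower bound for
      \<open>B_infinity_const w\<close>.\<close>
    have "LlogL_bound (?c + 1) w"
      using LlogL_of_B_infinity[OF that] unfolding LlogL_bound_def Let_def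
      by (meson order_trans mult_right_mono ennreal_leI zero_le less_add_one less_imp_le)
    moreover have "0 < ?c + 1" using c by linarith
    ultimately show ?thesis by blast
  qed
  have 23: "small_measurable_sets w" if "\<exists>C>0. LlogL_bound C w"
    using that small_measurable_sets_of_LlogL by blast
  have decay: "small_box_unions w \<Longrightarrow> \<exists>N \<beta>. shallow_decay w N \<beta>" "exp_log_bound w \<Longrightarrow> \<exists>N \<beta>. shallow_decay w N \<beta>"
    by (rule shallow_decay_of_small_box_unions, assumption) (rule shallow_decay_of_exp_log_bound)
  show ?thesis
    using 12 23 small_box_unions_of_small_measurable_sets[of w] decay B_infinity_of_shallow_decay
      reverse_Hoelder_of_shallow_decay small_measurable_sets_of_reverse_Hoelder
      B_class_of_shallow_decay exp_log_bound_of_B_class by metis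
qed

end

text \<open>So a weight may be replaced by one that is positive and measurable on the whole plane.\<close>

context
  fixes w v :: "complex \<Rightarrow> real"
  assumes eq: "\<forall>z\<in>unit_disk. w z = v z"
begin

lemma box_eq: "z \<in> carleson_box \<theta> l \<Longrightarrow> w z = v z"
  using eq carleson_box_subset_disk by blast

lemma mass_box_eq: "mass w (carleson_box \<theta> l) = mass v (carleson_box \<theta> l)"
  by (rule mass_cong) (rule box_eq)

lemma mean_box_eq: "mean w (carleson_box \<theta> l) = mean v (carleson_box \<theta> l)"
  by (simp add: mean_def mass_box_eq)

lemma mean_powr_box_eq: "mean (\<lambda>z. w z powr s) (carleson_box \<theta> l) = mean (\<lambda>z. v z powr s) (carleson_box \<theta> l)"
  unfolding mean_def by (intro arg_cong2[of _ _ _ _ divide] mass_cong) (simp_all add: box_eq)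

lemma B_infinity_const_eq: "B_infinity_const w = B_infinity_const v"
proof -
  have "(\<lambda>x. w x * indicator (carleson_box \<theta> l) x) = (\<lambda>x. v x * indicator (carleson_box \<theta> l) x)" for \<theta> l
    by (auto simp: fun_eq_iff box_eq split: split_indicator)
  then show ?thesis unfolding B_infinity_const_def by (simp only: mass_box_eq)
qed

lemma B_class_eq: "B_class p w = B_class p v"
  unfolding B_class_def B_const_def by (simp only: mean_box_eq mean_powr_box_eq)

lemma LlogL_bound_eq: "LlogL_bound C w = LlogL_bound C v"
proof -
  have "(\<integral>\<^sup>+ x \<in> carleson_box \<theta> l. ennreal (w x * ln (exp 1 + w x * m / d)) \<partial>lebesgue)
      = (\<integral>\<^sup>+ x \<in> carleson_box \<theta> l. ennreal (v x * ln (exp 1 + v x * m / d)) \<partial>lebesgue)" for \<theta> l m d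
    by (intro nn_integral_cong) (simp add: box_eq split: split_indicator)
  then show ?thesis unfolding LlogL_bound_def Let_def mass_box_eq by simp
qed

lemma small_box_unions_eq: "small_box_unions w = small_box_unions v"
proof -
  have "mass w (\<Union>(\<phi>, m)\<in>F. carleson_box \<phi> m) = mass v (\<Union>(\<phi>, m)\<in>F. carleson_box \<phi> m)" for F
    by (rule mass_cong) (auto simp: box_eq)
  then show ?thesis unfolding small_box_unions_def mass_box_eq by simp
qed

lemma small_measurable_sets_eq: "small_measurable_sets w = small_measurable_sets v"
proof -
  have "mass w \<Omega> = mass v \<Omega>" if "\<Omega> \<subseteq> carleson_box \<theta> l" for \<Omega> \<theta> l
    using that by (intro mass_cong) (auto simp: box_eq)
  then show ?thesis unfolding small_measurable_sets_def mass_box_eq by (metis (no_types, lifting))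
qed

lemma reverse_Hoelder_eq: "reverse_Hoelder w = reverse_Hoelder v"
  unfolding reverse_Hoelder_def by (simp only: mean_box_eq mean_powr_box_eq)

lemma exp_log_bound_eq: "exp_log_bound w = exp_log_bound v"
proof -
  have "indicator (carleson_box \<theta> l) x *\<^sub>R ln (inverse (w x)) = indicator (carleson_box \<theta> l) x *\<^sub>R ln (inverse (v x))" for \<theta> l x
    by (simp add: box_eq split: split_indicator)
  then show ?thesis
    by (simp only: exp_log_bound_def Let_def mean_box_eq set_integrable_def set_lebesgue_integral_def)
qed

end

section \<open>Extension of the weight to the plane and conclusion\<close>

lemma carleson_top_subset_disk: "0 < l \<Longrightarrow> \<rho> < 1 \<Longrightarrow> carleson_top \<rho> \<theta> l \<subseteq> unit_disk"
proof
  assume "0 < l" "\<rho> < 1"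
  then have "0 < (1 - \<rho>) * l" by simp
  moreover fix z assume "z \<in> carleson_top \<rho> \<theta> l"
  then obtain r \<alpha> where "z = of_real r * cis \<alpha>" "0 \<le> r" "r < 1 - (1 - \<rho>) * l"
    by (auto simp: carleson_top_def)
  ultimately show "z \<in> unit_disk" by (simp add: norm_mult)
qed

text \<open>Near constancy survives the extension because the tops lie inside the disk, where the
  weight is unchanged.\<close>

lemma top_weight_extension:
  assumes w: "weight w" "set_integrable lebesgue unit_disk w"
    and \<rho>: "0 < \<rho>" "\<rho> < 1" "0 < C" "nearly_constant_on_tops \<rho> C w"
  shows "top_weight (\<lambda>z. if z \<in> unit_disk then w z else 1) \<rho> C" (is "top_weight ?v \<rho> C")
proof unfold_locales
  have d: "unit_disk \<in> sets lebesgue" by simp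
  have wm: "w \<in> borel_measurable (lebesgue_on unit_disk)" and wp: "\<And>z. z \<in> unit_disk \<Longrightarrow> 0 < w z"
    using w(1) by (auto simp: weight_def)
  show "?v \<in> borel_measurable lebesgue"
  proof (subst measurable_If_restrict_space_iff)
    show "{x \<in> space lebesgue. x \<in> unit_disk} \<in> sets lebesgue" by simp
    show "w \<in> borel_measurable (restrict_space lebesgue {x. x \<in> unit_disk}) \<and>
        (\<lambda>z. 1) \<in> borel_measurable (restrict_space lebesgue {x. x \<notin> unit_disk})"
      using wm unfolding Collect_mem_eq by simp
  qed
  show "0 < ?v z" for z using wp by simp
  have "integrable lebesgue (\<lambda>x. indicator unit_disk x *\<^sub>R w x)" using w(2) by (simp add: set_integrable_def)
  then have "(\<integral>\<^sup>+ x. ennreal (norm (indicator unit_disk x *\<^sub>R w x)) \<partial>lebesgue) < \<infinity>"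
    by (simp add: integrable_iff_bounded)
  moreover have "mass ?v unit_disk = (\<integral>\<^sup>+ x. ennreal (norm (indicator unit_disk x *\<^sub>R w x)) \<partial>lebesgue)"
    unfolding mass_def using wp by (intro nn_integral_cong) (auto split: split_indicator simp: less_imp_le)
  ultimately show "mass ?v unit_disk < top" by simp
  show "nearly_constant_on_tops \<rho> C ?v"
    unfolding nearly_constant_on_tops_def
  proof (intro allI impI ballI)
    fix \<theta> l z \<xi> assume l: "arc_length l" and z: "z \<in> carleson_top \<rho> \<theta> l" "\<xi> \<in> carleson_top \<rho> \<theta> l"
    then have "z \<in> unit_disk" "\<xi> \<in> unit_disk"
      using carleson_top_subset_disk[of l \<rho> \<theta>] \<rho> by (auto simp: arc_length_def)
    then show "inverse C * ?v \<xi> \<le> ?v z \<and> ?v z \<le> C * ?v \<xi>"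
      using \<rho>(4) l z unfolding nearly_constant_on_tops_def by simp
  qed
qed (use \<rho> in auto)

theorem theorem1p6:
  shows
    "(\<forall>w. weight w \<and> set_integrable lebesgue unit_disk w
          \<and> (\<exists>\<rho> C\<^sub>\<rho>. 0 < \<rho> \<and> \<rho> < 1 \<and> 0 < C\<^sub>\<rho> \<and> nearly_constant_on_tops \<rho> C\<^sub>\<rho> w) \<longrightarrow>
        (B_infinity w \<longleftrightarrow> (\<exists>C>0. LlogL_bound C w))
      \<and> (B_infinity w \<longleftrightarrow> small_box_unions w)
      \<and> (B_infinity w \<longleftrightarrow> small_measurable_sets w)
      \<and> (B_infinity w \<longleftrightarrow> reverse_Hoelder w)
      \<and> (B_infinity w \<longleftrightarrow> (\<exists>p>1. B_class p w))
      \<and> (B_infinity w \<longleftrightarrow> exp_log_bound w))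
     \<and>
     (\<forall>\<rho> C\<^sub>\<rho>. 0 < \<rho> \<and> \<rho> < 1 \<and> 0 < C\<^sub>\<rho> \<longrightarrow>
        (\<exists>C'>0. \<forall>w. weight w \<and> set_integrable lebesgue unit_disk w
            \<and> nearly_constant_on_tops \<rho> C\<^sub>\<rho> w \<and> B_infinity w \<longrightarrow>
          LlogL_bound (C' * enn2real (B_infinity_const w)) w))"
proof (intro conjI[of "\<forall>w. _ w"] allI impI)
  fix w :: "complex \<Rightarrow> real"
  assume "weight w \<and> set_integrable lebesgue unit_disk w
    \<and> (\<exists>\<rho> C\<^sub>\<rho>. 0 < \<rho> \<and> \<rho> < 1 \<and> 0 < C\<^sub>\<rho> \<and> nearly_constant_on_tops \<rho> C\<^sub>\<rho> w)"
  then obtain \<rho> C where *: "weight w" "set_integrable lebesgue unit_disk w"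
    "0 < \<rho>" "\<rho> < 1" "0 < C" "nearly_constant_on_tops \<rho> C w" by blast
  let ?v = "\<lambda>z. if z \<in> unit_disk then w z else 1"
  have v: "\<forall>z\<in>unit_disk. w z = ?v z" by simp
  have B: "B_infinity w = B_infinity ?v" unfolding B_infinity_def by (simp only: B_infinity_const_eq[of w ?v, OF v])
  show "(B_infinity w \<longleftrightarrow> (\<exists>C>0. LlogL_bound C w))
      \<and> (B_infinity w \<longleftrightarrow> small_box_unions w)
      \<and> (B_infinity w \<longleftrightarrow> small_measurable_sets w)
      \<and> (B_infinity w \<longleftrightarrow> reverse_Hoelder w)
      \<and> (B_infinity w \<longleftrightarrow> (\<exists>p>1. B_class p w))
      \<and> (B_infinity w \<longleftrightarrow> exp_log_bound w)"
    unfolding B LlogL_bound_eq[of w ?v, OF v] small_box_unions_eq[of w ?v, OF v] small_measurable_sets_eq[of w ?v, OF v]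
      reverse_Hoelder_eq[of w ?v, OF v] B_class_eq[of w ?v, OF v] exp_log_bound_eq[of w ?v, OF v]
    by (rule top_weight.equivalences[OF top_weight_extension[OF *]])
next
  fix \<rho> C :: real assume \<rho>: "0 < \<rho> \<and> \<rho> < 1 \<and> 0 < C"
  \<comment> \<open>Positivity of \<open>LlogL_factor\<close> was derived from
    \<open>1 \<le> C\<close>, which rests on the existence of a weight. Here \<open>C > 0\<close> is
    arbitrary, and the maximum secures a positive constant.\<close>
  define C' where "C' = max 1 (16 * LlogL_factor \<rho> C)"
  show "\<exists>C'>0. \<forall>w. weight w \<and> set_integrable lebesgue unit_disk w
            \<and> nearly_constant_on_tops \<rho> C w \<and> B_infinity w \<longrightarrow>
          LlogL_bound (C' * enn2real (B_infinity_const w)) w"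
  proof (intro exI[of _ C'] conjI allI impI)
    show "0 < C'" by (simp add: C'_def)
    fix w :: "complex \<Rightarrow> real"
    assume w: "weight w \<and> set_integrable lebesgue unit_disk w \<and> nearly_constant_on_tops \<rho> C w \<and> B_infinity w"
    let ?v = "\<lambda>z. if z \<in> unit_disk then w z else 1"
    have v: "\<forall>z\<in>unit_disk. w z = ?v z" by simp
    have tw: "top_weight ?v \<rho> C" using w \<rho> by (intro top_weight_extension) auto
    have "B_infinity ?v" using w unfolding B_infinity_def by (simp only: B_infinity_const_eq[of w ?v, OF v])
    note L = top_weight.LlogL_of_B_infinity[OF tw this]
    have "16 * LlogL_factor \<rho> C * enn2real (B_infinity_const ?v) \<le> C' * enn2real (B_infinity_const ?v)"
      unfolding C'_def by (intro mult_right_mono) auto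
    then have "LlogL_bound (C' * enn2real (B_infinity_const ?v)) ?v"
      using L unfolding LlogL_bound_def Let_def by (meson order_trans mult_right_mono ennreal_leI zero_le)
    then show "LlogL_bound (C' * enn2real (B_infinity_const w)) w"
      unfolding LlogL_bound_eq[of w ?v, OF v] B_infinity_const_eq[of w ?v, OF v] .
  qed
qed

end
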